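(* Let $n\ge2$, $k,Q\ge1$, let $\Omega\subset\mathbb R^n$ be open, let $v=\sum_{\ell=1}^Q[\![v^\ell]\!]\in W^{2,2}_{\mathrm{loc}}(\Omega,\mathcal A_Q(\mathbb R^k))$ and let $j_2v=\sum_{\ell=1}^Q[\![(v^\ell,Dv^\ell,D^2v^\ell)]\!]$ be the approximate second jet of $v$. Then, for a.e. $x\in\Omega$ and every $\ell$, $D^2v^\ell(x)$ is symmetric. If $v$ is also outer stationary (for the Dirichlet energy), then, for a.e. $x\in\Omega$ and every $\ell$, $D^2v^\ell(x)$ is also trace-free, that is $$D^2_{ij}v^\ell(x)=D^2_{ji}v^\ell(x)\quad(i,j=1,\dots,n),\qquad\sum_{i=1}^nD^2_{ii}v^\ell(x)=0.$$
   Context: **$Q$-points.** For a finite-dimensional Euclidean space $E$, $\mathcal A_Q(E)$ is the set of unordered $Q$-tuples $T=\sum_{\ell=1}^Q[\![T_\ell]\!]$ of points of $E$ counted with multiplicity ($[\![p]\!]$ is the Dirac mass at $p$), with metric $\mathcal G(T,S)=\min_{\sigma\in\mathfrak S_Q}\big(\sum_\ell|T_\ell-S_{\sigma(\ell)}|^2\big)^{1/2}$. On $\operatorname{Hom}$ spaces, $A:B=\operatorname{tr}(A^*B)$. **Sobolev maps.** Let $\xi$ be Almgren's bi-Lipschitz embedding of $\mathcal A_Q(E)$ into some $\mathbb R^N$. $v\in W^{1,2}(\Omega,\mathcal A_Q(E))$ if $\xi\circ v\in W^{1,2}(\Omega,\mathbb R^N)$. Such $v$ is a.e. approximately differentiable: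 for a.e. $x$, writing $v(x)=\sum_\ell[\![a_\ell]\!]$, there are $A_\ell\in\operatorname{Hom}(\mathbb R^n,E)$, with $A_\ell=A_m$ whenever $a_\ell=a_m$, and a measurable set $F$ with density $1$ at $x$ such that $\mathcal G(v(x+h),\sum_\ell[\![a_\ell+A_\ell h]\!])=o(|h|)$ as $h\to0$, $x+h\in F$. One sets $j_1v=\sum_\ell[\![(a_\ell,A_\ell)]\!]$, $Dv=\sum_\ell[\![A_\ell]\!]$. $v\in W^{2,2}(\Omega,\mathcal A_Q(\mathbb R^k))$ if $v\in W^{1,2}$ and $j_1v\in W^{1,2}$; writing the approximate first jet of $j_1v$ as $\sum_\ell[\![((a_\ell,A_\ell),(B_\ell,S_\ell))]\!]$, with $S_\ell$ a bilinear map $\mathbb R^n\times\mathbb R^n\to\mathbb R^k$ (the derivative of the component $A_\ell$), the approximate second jet is $j_2v=\sum_\ell[\![(a_\ell,A_\ell,S_\ell)]\!]$. In the claim, $v^\ell=a_\ell$, $Dv^\ell=A_\ell$, $D^2v^\ell=S_\ell$, and $D^2_{ij}v^\ell=S_\ell(e_i,e_j)\in\mathbb R^k$. Local spaces are defined as usual. **Outer stationarity.** $v$ is outer stationary (stationary with respect to outer variations) if $\int_\Omega\sum_\ell Dv^\ell:D(\psi(x,v^\ell))=0$ for all $\psi\in C_c^1(\Omega\times\mathbb R^k,\mathbb R^k)$, where $D(\psi(x,v^\ell))=D_x\psi(x,v^\ell)+D_y\psi(x,v^\ell)Dv^\ell$. *)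

theory Defs
  imports "HOL-Analysis.Analysis" "HOL-Library.Multiset"
begin

section \<open>Q-points\<close>

text \<open>A Q-point of \<open>'e\<close> is a multiset of size Q. Letting both enumerations vary gives the same
  finite set of costs as fixing them and minimising over permutations.\<close>

definition Gdist :: "'e::euclidean_space multiset \<Rightarrow> 'e multiset \<Rightarrow> real" where
  "Gdist T S = Min {sqrt (\<Sum>l<size T. (norm (xs ! l - ys ! l))\<^sup>2) | xs ys. mset xs = T \<and> mset ys = S}"

text \<open>Almgren's map for a list \<open>es\<close> of h unit vectors: project onto each direction, sort the Q
  values increasingly, concatenate, and rescale by \<open>1 / sqrt h\<close>. The result is a vector of
  \<open>\<real>\<^sup>N\<close> with \<open>N = h * Q\<close>, stored as a list.\<close>

definition almgren_map :: "'e::euclidean_space list \<Rightarrow> 'e multiset \<Rightarrow> real list" where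
  "almgren_map es T = map (\<lambda>t. t / sqrt (real (length es)))
     (concat (map (\<lambda>e. sorted_list_of_multiset (image_mset (\<lambda>y. y \<bullet> e) T)) es))"

text \<open>By Almgren's theorem such directions exist for every Q. Since Lipschitz functions on subsets
  of \<open>\<real>\<^sup>N\<close> extend, Sobolev spaces do not depend on which of them are used.\<close>

definition almgren_embedding :: "nat \<Rightarrow> 'e::euclidean_space list \<Rightarrow> bool" where
  "almgren_embedding Q es \<longleftrightarrow>
     (\<forall>e\<in>set es. norm e = 1) \<and>
     (\<exists>c C. 0 < c \<and> (\<forall>T S. size T = Q \<longrightarrow> size S = Q \<longrightarrow>
        c * Gdist T S \<le> L2_set (\<lambda>j. almgren_map es T ! j - almgren_map es S ! j) {..<length es * Q} \<and>
        L2_set (\<lambda>j. almgren_map es T ! j - almgren_map es S ! j) {..<length es * Q} \<le> C * Gdist T S))"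


section \<open>Sobolev functions\<close>

text \<open>Functions in \<open>C\<^sub>c\<^sup>1(U)\<close> are taken to be extended by zero to the whole space.\<close>

definition C1_c :: "'x::euclidean_space set \<Rightarrow> ('x \<Rightarrow> 'y::euclidean_space) \<Rightarrow> bool" where
  "C1_c U \<phi> \<longleftrightarrow>
     (\<exists>\<phi>'. (\<forall>x. (\<phi> has_derivative blinfun_apply (\<phi>' x)) (at x)) \<and> continuous_on UNIV \<phi>') \<and>
     compact (closure {x. \<phi> x \<noteq> 0}) \<and> closure {x. \<phi> x \<noteq> 0} \<subseteq> U"

definition L2_on :: "(real^'n) set \<Rightarrow> (real^'n \<Rightarrow> real) \<Rightarrow> bool" where
  "L2_on \<Omega> u \<longleftrightarrow> u \<in> borel_measurable (lebesgue_on \<Omega>) \<and> integrable (lebesgue_on \<Omega>) (\<lambda>x. (u x)\<^sup>2)"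

text \<open>Testing with \<open>C\<^sub>c\<^sup>1\<close> functions or with \<open>C\<^sub>c\<^sup>\<infinity>\<close> functions gives the same weak derivatives,
  by mollification.\<close>

definition weak_pderiv :: "(real^'n) set \<Rightarrow> 'n \<Rightarrow> (real^'n \<Rightarrow> real) \<Rightarrow> (real^'n \<Rightarrow> real) \<Rightarrow> bool" where
  "weak_pderiv \<Omega> i u g \<longleftrightarrow> (\<forall>\<phi>::real^'n \<Rightarrow> real. C1_c \<Omega> \<phi> \<longrightarrow>
     (\<integral>x. u x * frechet_derivative \<phi> (at x) (axis i 1) \<partial>lebesgue_on \<Omega>) =
     - (\<integral>x. g x * \<phi> x \<partial>lebesgue_on \<Omega>))"

definition W12 :: "(real^'n) set \<Rightarrow> (real^'n \<Rightarrow> real) \<Rightarrow> bool" where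
  "W12 \<Omega> u \<longleftrightarrow> L2_on \<Omega> u \<and> (\<forall>i. \<exists>g. L2_on \<Omega> g \<and> weak_pderiv \<Omega> i u g)"

text \<open>A Sobolev map only has to take values in Q-points almost everywhere, so that maps defined
  a.e., such as first jets, can be considered. Membership of \<open>\<xi> \<circ> v\<close> in \<open>W\<^sup>1\<^sup>,\<^sup>2(\<Omega>, \<real>\<^sup>N)\<close> is
  membership of its N components.\<close>

definition W12_Q :: "nat \<Rightarrow> (real^'n) set \<Rightarrow> (real^'n \<Rightarrow> 'e::euclidean_space multiset) \<Rightarrow> bool" where
  "W12_Q Q \<Omega> v \<longleftrightarrow>
     (AE x in lebesgue_on \<Omega>. size (v x) = Q) \<and>
     (\<exists>es. almgren_embedding Q es \<and>
        (\<forall>j<length es * Q. W12 \<Omega> (\<lambda>x. almgren_map es (v x) ! j)))"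


section \<open>Approximate jets\<close>

text \<open>A linear map A from \<open>\<real>\<^sup>n\<close> to \<open>'e\<close> is represented by the vector of its values on the standard
  basis, \<open>A $ i = A e\<^sub>i\<close>, an element of \<open>'e^'n\<close>. The inner product of this Euclidean space is
  \<open>A : B = tr (A\<^sup>* B)\<close>. For \<open>'e = real^'k\<close> this is the transpose of the usual matrix of A.\<close>

definition hom_apply :: "('e::euclidean_space)^'n \<Rightarrow> real^'n \<Rightarrow> 'e" where
  "hom_apply A h = (\<Sum>i\<in>UNIV. (h $ i) *\<^sub>R (A $ i))"

definition density_one :: "'x::euclidean_space set \<Rightarrow> 'x \<Rightarrow> bool" where
  "density_one F x \<longleftrightarrow> F \<in> sets lebesgue \<and>
     ((\<lambda>r. measure lebesgue (F \<inter> ball x r) / measure lebesgue (ball x r)) \<longlongrightarrow> 1) (at_right 0)"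

definition is_approx_jet ::
    "(real^'n \<Rightarrow> 'e::euclidean_space multiset) \<Rightarrow> real^'n \<Rightarrow> ('e \<times> ('e^'n)) multiset \<Rightarrow> bool" where
  "is_approx_jet v x J \<longleftrightarrow>
     v x = image_mset fst J \<and>
     (\<forall>p\<in>#J. \<forall>q\<in>#J. fst p = fst q \<longrightarrow> snd p = snd q) \<and>
     (\<exists>F. density_one F x \<and>
        ((\<lambda>h. Gdist (v (x + h)) (image_mset (\<lambda>(a, A). a + hom_apply A h) J) / norm h) \<longlongrightarrow> 0)
          (at 0 within {h. x + h \<in> F}))"

text \<open>The approximate first jet at a point is unique if it exists. Where it does not exist the value
  is \<open>{#}\<close>, which for \<open>Q \<ge> 1\<close> is not a Q-point; hence \<open>W12_Q Q \<Omega> (j1 v)\<close> includes the a.e.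
  approximate differentiability of v.\<close>

definition j1 :: "(real^'n \<Rightarrow> 'e::euclidean_space multiset) \<Rightarrow> real^'n \<Rightarrow> ('e \<times> ('e^'n)) multiset" where
  "j1 v x = (if \<exists>J. is_approx_jet v x J then SOME J. is_approx_jet v x J else {#})"

text \<open>The points of \<open>j1 (j1 v) x\<close> are \<open>((a, A), C)\<close> with \<open>C $ i = (B e\<^sub>i, S e\<^sub>i)\<close>, where \<open>S e\<^sub>i\<close> is the
  derivative of the component A in direction \<open>e\<^sub>i\<close>. In \<open>j2 v x\<close>, \<open>S $ i $ j = S(e\<^sub>i, e\<^sub>j)\<close>.\<close>

definition j2 :: "(real^'n \<Rightarrow> (real^'k) multiset) \<Rightarrow> real^'n \<Rightarrow>
    ((real^'k) \<times> ((real^'k)^'n) \<times> (((real^'k)^'n)^'n)) multiset" where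
  "j2 v x = image_mset (\<lambda>((a, A), C). (a, A, \<chi> i. snd (C $ i))) (j1 (j1 v) x)"

definition W22_Q :: "nat \<Rightarrow> (real^'n) set \<Rightarrow> (real^'n \<Rightarrow> (real^'k) multiset) \<Rightarrow> bool" where
  "W22_Q Q \<Omega> v \<longleftrightarrow> W12_Q Q \<Omega> v \<and> W12_Q Q \<Omega> (j1 v)"

definition W22_Q_loc :: "nat \<Rightarrow> (real^'n) set \<Rightarrow> (real^'n \<Rightarrow> (real^'k) multiset) \<Rightarrow> bool" where
  "W22_Q_loc Q \<Omega> v \<longleftrightarrow>
     (\<forall>\<Omega>'. open \<Omega>' \<longrightarrow> compact (closure \<Omega>') \<longrightarrow> closure \<Omega>' \<subseteq> \<Omega> \<longrightarrow> W22_Q Q \<Omega>' v)"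


section \<open>Outer stationarity\<close>

text \<open>The i-th column of \<open>D(\<psi>(x, v\<^sup>l)) = D\<^sub>x\<psi>(x, v\<^sup>l) + D\<^sub>y\<psi>(x, v\<^sup>l) Dv\<^sup>l\<close> is its value on \<open>e\<^sub>i\<close>.\<close>

definition outer_stationary :: "(real^'n) set \<Rightarrow> (real^'n \<Rightarrow> (real^'k) multiset) \<Rightarrow> bool" where
  "outer_stationary \<Omega> v \<longleftrightarrow>
     (\<forall>\<psi>::(real^'n) \<times> (real^'k) \<Rightarrow> real^'k. C1_c (\<Omega> \<times> UNIV) \<psi> \<longrightarrow>
        (\<integral>x. (\<Sum>(a, A)\<in>#j1 v x. A \<bullet> (\<chi> i. frechet_derivative \<psi> (at (x, a)) (axis i 1, 0)
                                          + frechet_derivative \<psi> (at (x, a)) (0, A $ i)))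
           \<partial>lebesgue_on \<Omega>) = 0)"

end

theory Submission
  imports Defs
begin

text \<open>Let g be a test function on the target and put \<open>u = (\<Sum>l. g (v\<^sup>l))\<close>. This is an ordinary function whose
  weak derivatives are \<open>w\<^sub>j = (\<Sum>l. Dg(v\<^sup>l) D\<^sub>jv\<^sup>l)\<close>, so \<open>\<partial>\<^sub>iw\<^sub>j = \<partial>\<^sub>jw\<^sub>i\<close> in the sense of distributions. At a point
  x choose g to be linear near one sheet of \<open>v x\<close> and to vanish near the others, up to second order:
  then the approximate derivative of \<open>w\<^sub>j\<close> at x reads off \<open>D\<^sup>2\<^sub>i\<^sub>jv\<close> on that sheet. Likewise, with a cutoff \<open>\<chi>\<close> of
  the sheet, outer stationarity is a divergence equation for \<open>(\<Sum>l. \<chi>(v\<^sup>l) D\<^sub>iv\<^sup>l)\<close> which reads off the trace.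

  No chain rule for Q-valued Sobolev maps is needed. Testing with a kernel of scale h at x, the only
  issue is the small part of the ball where the first-order expansion fails. There \<open>\<bar>w\<^sub>j(z) - w\<^sub>j(x)\<bar>\<close> is
  at most a constant depending on x times the increment of the coordinates of the Almgren embedding,
  which are Sobolev functions. For these the \<open>L\<^sup>1\<close> mean of the Taylor remainder over balls of radius h
  is \<open>o(h)\<close> at almost every x, along a sequence of scales. The exceptional set depends only on the
  coordinates, so g may be chosen after x.\<close>

section \<open>Compactly supported test functions and translations\<close>

text \<open>The size of the growth constant decides what can be proved. For \<open>u\<close> it is
  global, since g is Lipschitz: the kernels at all scales then have an integrable majorant, and
  dominated convergence yields a weak derivative. For \<open>w_j\<close> it grows with the first jet
  at x, since differentiating V in \<open>V a \<bullet> A\<close> leaves a factor of size |A|; so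
  \<open>w_j\<close> gets only a limit at one good point at a time, which is enough to read off the
  second jet there. The kernels are partial derivatives of one bump. Once the derivative in j is
  moved from \<open>w_j\<close> onto the kernel, the symmetry in i and j becomes the equality of
  mixed derivatives of the bump. In the stationarity equation the derivative of the cutoff in y
  leaves a term quadratic in Dv. It carries no factor 1/h and vanishes at x, so it only has to tend
  to 0 in the mean; for this the scales are chosen to control the increments of the squares of the
  coordinates as well.\<close>

lemma C1_cI:
  fixes \<phi> :: "'x::euclidean_space \<Rightarrow> 'y::euclidean_space"
  assumes d: "\<And>x. (\<phi> has_derivative D x) (at x)"
    and c: "\<And>b. b \<in> Basis \<Longrightarrow> continuous_on UNIV (\<lambda>x. D x b)"
    and S: "compact S" "S \<subseteq> U" "\<And>x. x \<notin> S \<Longrightarrow> \<phi> x = 0"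
  shows "C1_c U \<phi>"
proof -
  have bl: "bounded_linear (D x)" for x
    using d has_derivative_bounded_linear by blast
  have cl: "closure {x. \<phi> x \<noteq> 0} \<subseteq> S"
    by (rule closure_minimal) (use S in \<open>auto simp: compact_imp_closed\<close>)
  \<comment> \<open>In finite dimension continuity along a basis is continuity in the operator norm,
    which is what \<open>C1_c\<close> asks of the derivative.\<close>
  have "continuous_on UNIV (\<lambda>x. Blinfun (D x))"
    by (intro continuous_on_blinfun_componentwise) (simp add: bounded_linear_Blinfun_apply bl c)
  moreover have "compact (closure {x. \<phi> x \<noteq> 0})"
    unfolding compact_closure
    by (rule bounded_subset[OF compact_imp_bounded[OF S(1)]]) (use S(3) in auto)
  ultimately show ?thesis
    unfolding C1_c_def using d cl S(2)
    by (intro conjI exI[of _ "\<lambda>x. Blinfun (D x)"]) (auto simp: bounded_linear_Blinfun_apply bl)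
qed

lemma C1_c_has_derivative:
  "C1_c U \<phi> \<Longrightarrow> (\<phi> has_derivative frechet_derivative \<phi> (at x)) (at x)"
  unfolding C1_c_def using frechet_derivative_works differentiableI by blast

lemma C1_c_continuous: "C1_c U \<phi> \<Longrightarrow> continuous_on S \<phi>"
  by (meson C1_c_has_derivative continuous_at_imp_continuous_on has_derivative_continuous)

lemma C1_c_frechet_derivative_eq:
  assumes "C1_c U \<phi>"
  obtains \<phi>' where "continuous_on UNIV \<phi>'" "\<And>x. frechet_derivative \<phi> (at x) = blinfun_apply (\<phi>' x)"
  using assms frechet_derivative_at unfolding C1_c_def by metis

lemma C1_c_continuous_frechet_derivative:
  assumes "C1_c U \<phi>"
  shows "continuous_on S (\<lambda>x. frechet_derivative \<phi> (at x) v)"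
proof -
  obtain \<phi>' where "continuous_on UNIV \<phi>'" "\<And>x. frechet_derivative \<phi> (at x) = blinfun_apply (\<phi>' x)"
    using C1_c_frechet_derivative_eq[OF assms] by blast
  then show ?thesis
    by (auto intro!: continuous_intros intro: continuous_on_subset)
qed

lemma C1_c_support:
  assumes "C1_c U \<phi>"
  obtains K where "compact K" "K \<subseteq> U" "\<And>x. x \<notin> K \<Longrightarrow> \<phi> x = 0"
    "\<And>x v. x \<notin> K \<Longrightarrow> frechet_derivative \<phi> (at x) v = 0"
proof -
  define K where "K = closure {x. \<phi> x \<noteq> 0}"
  have K: "compact K" "K \<subseteq> U" using assms by (auto simp: C1_c_def K_def)
  have z: "\<phi> x = 0" if "x \<notin> K" for x
    using that subsetD[OF closure_subset[of "{x. \<phi> x \<noteq> 0}"], of x] unfolding K_def by auto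
  have "frechet_derivative \<phi> (at x) = (\<lambda>v. 0)" if "x \<notin> K" for x
  proof -
    \<comment> \<open>The complement of K is open, so off K the map is locally zero and its
      derivative vanishes too.\<close>
    have "open (-K)" using K by (simp add: compact_imp_closed open_Compl)
    then have "(\<phi> has_derivative (\<lambda>v. 0)) (at x)"
      by (rule has_derivative_transform_within_open[OF has_derivative_const]) (use that z in auto)
    then show ?thesis by (simp add: frechet_derivative_at[symmetric])
  qed
  with K z show ?thesis by (intro that[of K]) auto
qed

text \<open>On the compact support continuity bounds the map and its derivative, off it both vanish;
  the mean value inequality on the whole space turns the derivative bound into the Lipschitz
  bound.\<close>

lemma C1_c_bounds:
  assumes "C1_c U \<phi>"
  obtains C where "C \<ge> 0" "\<And>x. norm (\<phi> x) \<le> C" "\<And>x y. norm (\<phi> x - \<phi> y) \<le> C * norm (x - y)"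
    "\<And>x v. norm (frechet_derivative \<phi> (at x) v) \<le> C * norm v"
proof -
  obtain \<phi>' where \<phi>': "continuous_on UNIV \<phi>'" "\<And>x. frechet_derivative \<phi> (at x) = blinfun_apply (\<phi>' x)"
    using C1_c_frechet_derivative_eq[OF assms] by blast
  obtain K where K: "compact K" "\<And>x. x \<notin> K \<Longrightarrow> \<phi> x = 0"
    "\<And>x v. x \<notin> K \<Longrightarrow> frechet_derivative \<phi> (at x) v = 0"
    using C1_c_support[OF assms] by metis
  have "bounded (\<phi>' ` K)"
    by (meson K(1) \<phi>'(1) compact_continuous_image compact_imp_bounded continuous_on_subset top_greatest)
  then obtain C1 where C1: "\<And>x. x \<in> K \<Longrightarrow> norm (\<phi>' x) \<le> C1" by (auto simp: bounded_iff)
  have "bounded (\<phi> ` K)"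
    by (meson K(1) assms C1_c_continuous compact_continuous_image compact_imp_bounded)
  then obtain C2 where C2: "\<And>x. x \<in> K \<Longrightarrow> norm (\<phi> x) \<le> C2" by (auto simp: bounded_iff)
  define C where "C = max 0 (max C1 C2)"
  have C: "C \<ge> 0" by (simp add: C_def)
  have b1: "norm (frechet_derivative \<phi> (at x) v) \<le> C * norm v" for x v
  proof (cases "x \<in> K")
    case True
    have "norm (blinfun_apply (\<phi>' x) v) \<le> norm (\<phi>' x) * norm v" by (rule norm_blinfun)
    also have "\<dots> \<le> C * norm v" using C1[OF True] by (intro mult_right_mono) (auto simp: C_def)
    finally show ?thesis by (simp add: \<phi>')
  qed (use K C in auto)
  have b2: "norm (\<phi> x) \<le> C" for x
    using K(2)[of x] C2[of x] C by (cases "x \<in> K") (auto simp: C_def)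
  have b3: "norm (\<phi> x - \<phi> y) \<le> C * norm (x - y)" for x y
  proof (rule differentiable_bound[of UNIV])
    show "onorm (frechet_derivative \<phi> (at z)) \<le> C" for z by (rule onorm_le) (rule b1)
    show "(\<phi> has_derivative frechet_derivative \<phi> (at z)) (at z within UNIV)" for z
      using C1_c_has_derivative[OF assms] by simp
  qed auto
  show ?thesis using that[OF C b2 b3 b1] .
qed

lemma C1_c_translate:
  assumes "C1_c U \<phi>" "\<And>x. x - s \<in> U \<Longrightarrow> x \<in> V"
  shows "C1_c V (\<lambda>x. \<phi> (x - s))"
    and "frechet_derivative (\<lambda>x. \<phi> (x - s)) (at x) = frechet_derivative \<phi> (at (x - s))"
proof -
  have d: "((\<lambda>x. \<phi> (x - s)) has_derivative frechet_derivative \<phi> (at (x - s))) (at x)" for x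
    by (rule has_derivative_compose[of "\<lambda>x. x - s" "\<lambda>x. x" x UNIV, OF _ C1_c_has_derivative[OF assms(1)], unfolded o_def])
       (auto intro!: derivative_eq_intros)
  then show "frechet_derivative (\<lambda>x. \<phi> (x - s)) (at x) = frechet_derivative \<phi> (at (x - s))"
    by (metis frechet_derivative_at)
  obtain K where K: "compact K" "K \<subseteq> U" "\<And>x. x \<notin> K \<Longrightarrow> \<phi> x = 0"
    using C1_c_support[OF assms(1)] by metis
  show "C1_c V (\<lambda>x. \<phi> (x - s))"
  proof (rule C1_cI[OF d])
    show "continuous_on UNIV (\<lambda>x. frechet_derivative \<phi> (at (x - s)) b)" for b
      by (rule continuous_on_compose2[OF C1_c_continuous_frechet_derivative[OF assms(1)]])
         (auto intro!: continuous_intros)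
    show "compact ((+) s ` K)" by (rule compact_translation[OF K(1)])
    show "(+) s ` K \<subseteq> V" using K(2) assms(2) by auto
    show "\<phi> (x - s) = 0" if "x \<notin> (+) s ` K" for x
    proof (rule K(3), rule)
      assume "x - s \<in> K"
      then have "s + (x - s) \<in> (+) s ` K" by blast
      then show False using that by simp
    qed
  qed
qed

lemma C1_c_integrable:
  assumes "C1_c U \<phi>"
  shows "integrable lborel \<phi>" "integrable lborel (\<lambda>x. frechet_derivative \<phi> (at x) v)"
proof -
  obtain K where K: "compact K" "\<And>x. x \<notin> K \<Longrightarrow> \<phi> x = 0"
    "\<And>x v. x \<notin> K \<Longrightarrow> frechet_derivative \<phi> (at x) v = 0"
    using C1_c_support[OF assms] by metis
  have "integrable lborel (\<lambda>x. indicator K x *\<^sub>R \<phi> x)"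
    by (rule borel_integrable_compact[OF K(1) C1_c_continuous[OF assms]])
  moreover have "(\<lambda>x. indicator K x *\<^sub>R \<phi> x) = \<phi>"
    using K(2) by (auto simp: indicator_def fun_eq_iff)
  ultimately show "integrable lborel \<phi>" by simp
  have "integrable lborel (\<lambda>x. indicator K x *\<^sub>R frechet_derivative \<phi> (at x) v)"
    by (rule borel_integrable_compact[OF K(1) C1_c_continuous_frechet_derivative[OF assms]])
  moreover have "(\<lambda>x. indicator K x *\<^sub>R frechet_derivative \<phi> (at x) v) = (\<lambda>x. frechet_derivative \<phi> (at x) v)"
    using K(3) by (auto simp: indicator_def fun_eq_iff)
  ultimately show "integrable lborel (\<lambda>x. frechet_derivative \<phi> (at x) v)" by simp
qed

lemma C1_c_borel_measurable:
  assumes "C1_c U \<phi>"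
  shows "\<phi> \<in> borel_measurable borel" "(\<lambda>x. frechet_derivative \<phi> (at x) v) \<in> borel_measurable borel"
  using C1_c_integrable[OF assms] by auto

section \<open>Translations under the integral sign and in \<open>L^1\<close>\<close>

lemma lborel_integral_translate:
  fixes f :: "'a::euclidean_space \<Rightarrow> 'b::{banach, second_countable_topology}"
  assumes "f \<in> borel_measurable borel"
  shows "(\<integral>x. f (x + s) \<partial>lborel) = (\<integral>x. f x \<partial>lborel)"
    and "integrable lborel (\<lambda>x. f (x + s)) \<longleftrightarrow> integrable lborel f"
proof -
  have "(\<integral>x. f x \<partial>lborel) = (\<integral>x. f x \<partial>distr lborel borel ((+) s))" by (simp add: lborel_distr_plus)
  also have "\<dots> = (\<integral>x. f (s + x) \<partial>lborel)" by (rule integral_distr) (use assms in auto)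
  finally show "(\<integral>x. f (x + s) \<partial>lborel) = (\<integral>x. f x \<partial>lborel)" by (simp add: add.commute)
  have "integrable lborel f \<longleftrightarrow> integrable (distr lborel borel ((+) s)) f" by (simp add: lborel_distr_plus)
  also have "\<dots> \<longleftrightarrow> integrable lborel (\<lambda>x. f (s + x))" by (rule integrable_distr_eq) (use assms in auto)
  finally show "integrable lborel (\<lambda>x. f (x + s)) \<longleftrightarrow> integrable lborel f" by (simp add: add.commute)
qed

lemma integrable_translate:
  fixes f :: "'a::euclidean_space \<Rightarrow> 'b::{banach, second_countable_topology}"
  shows "integrable lborel f \<Longrightarrow> integrable lborel (\<lambda>x. f (x + s))"
  using lborel_integral_translate(2)[of f s] borel_measurable_integrable by auto

text \<open>The shift sits on the test function, so f may be merely integrable: the difference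
  quotients of \<phi> are bounded by its Lipschitz constant times \<open>norm s\<close>, and
  dominated convergence applies. The sign comes from differentiating
  \<open>\<phi> (x - t *\<^sub>R s)\<close> in t.\<close>

lemma has_real_derivative_integral_translate:
  fixes f :: "'a::euclidean_space \<Rightarrow> real"
  assumes f: "integrable lborel f" and \<phi>: "C1_c U \<phi>"
  shows "((\<lambda>t. \<integral>x. f x * \<phi> (x - t *\<^sub>R s) \<partial>lborel) has_real_derivative
            - (\<integral>x. f x * frechet_derivative \<phi> (at (x - t *\<^sub>R s)) s \<partial>lborel)) (at t)"
proof -
  obtain C where C: "C \<ge> 0" "\<And>x. norm (\<phi> x) \<le> C" "\<And>x y. norm (\<phi> x - \<phi> y) \<le> C * norm (x - y)"
    "\<And>x v. norm (frechet_derivative \<phi> (at x) v) \<le> C * norm v"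
    using C1_c_bounds[OF \<phi>] by metis
  have [measurable]: "f \<in> borel_measurable borel" "\<phi> \<in> borel_measurable borel"
    "(\<lambda>x. frechet_derivative \<phi> (at x) s) \<in> borel_measurable borel"
    using f C1_c_borel_measurable[OF \<phi>] by auto
  have L: "linear (frechet_derivative \<phi> (at y))" for y
    using C1_c_has_derivative[OF \<phi>] has_derivative_linear by blast
  have int: "integrable lborel (\<lambda>x. f x * \<phi> (x - t *\<^sub>R s))" for t
    by (rule Bochner_Integration.integrable_bound[OF integrable_mult_right[OF integrable_norm[OF f], of C]])
       (use C(2) in \<open>auto simp: abs_mult mult.commute[of C] C(1) intro!: mult_left_mono\<close>)
  show ?thesis
    \<comment> \<open>Dominated convergence is a statement on sequences, so the limit is tested
      along arbitrary null sequences.\<close>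
    unfolding DERIV_def tendsto_at_iff_sequentially o_def
  proof (intro allI impI)
    fix X :: "nat \<Rightarrow> real" assume X: "\<forall>i. X i \<in> UNIV - {0}" "X \<longlonglongrightarrow> 0"
    have nz: "X i \<noteq> 0" for i using X by auto
    have eq: "((\<integral>x. f x * \<phi> (x - (t + X i) *\<^sub>R s) \<partial>lborel) - (\<integral>x. f x * \<phi> (x - t *\<^sub>R s) \<partial>lborel)) / X i
      = (\<integral>x. f x * ((\<phi> (x - (t + X i) *\<^sub>R s) - \<phi> (x - t *\<^sub>R s)) / X i) \<partial>lborel)" for i
      by (subst Bochner_Integration.integral_diff[symmetric, OF int int],
          subst integral_divide_zero[symmetric]) (simp add: field_simps)
    have "(\<lambda>i. \<integral>x. f x * ((\<phi> (x - (t + X i) *\<^sub>R s) - \<phi> (x - t *\<^sub>R s)) / X i) \<partial>lborel)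
      \<longlonglongrightarrow> (\<integral>x. f x * (- frechet_derivative \<phi> (at (x - t *\<^sub>R s)) s) \<partial>lborel)"
    proof (rule integral_dominated_convergence[where w = "\<lambda>x. (C * norm s) * norm (f x)"])
      show "integrable lborel (\<lambda>x. (C * norm s) * norm (f x))" using f by auto
      show "AE x in lborel. (\<lambda>i. f x * ((\<phi> (x - (t + X i) *\<^sub>R s) - \<phi> (x - t *\<^sub>R s)) / X i))
         \<longlonglongrightarrow> f x * (- frechet_derivative \<phi> (at (x - t *\<^sub>R s)) s)"
      proof (intro always_eventually allI tendsto_intros)
        fix x
        have "((\<lambda>t. \<phi> (x - t *\<^sub>R s)) has_vector_derivative frechet_derivative \<phi> (at (x - t *\<^sub>R s)) (- s)) (at t)"
          unfolding has_vector_derivative_def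
        proof (rule has_derivative_eq_rhs)
          show "((\<lambda>t. \<phi> (x - t *\<^sub>R s)) has_derivative (\<lambda>h. frechet_derivative \<phi> (at (x - t *\<^sub>R s)) (- (h *\<^sub>R s)))) (at t)"
            by (rule has_derivative_compose[OF _ C1_c_has_derivative[OF \<phi>], unfolded o_def])
               (auto intro!: derivative_eq_intros)
          show "(\<lambda>h. frechet_derivative \<phi> (at (x - t *\<^sub>R s)) (- (h *\<^sub>R s))) = (\<lambda>h. h *\<^sub>R frechet_derivative \<phi> (at (x - t *\<^sub>R s)) (- s))"
            by (simp add: linear_neg[OF L] linear_scale[OF L])
        qed
        then have "((\<lambda>t. \<phi> (x - t *\<^sub>R s)) has_real_derivative - frechet_derivative \<phi> (at (x - t *\<^sub>R s)) s) (at t)"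
          by (simp add: has_real_derivative_iff_has_vector_derivative linear_neg[OF L])
        then have q: "((\<lambda>h. (\<phi> (x - (t + h) *\<^sub>R s) - \<phi> (x - t *\<^sub>R s)) / h) \<longlongrightarrow> - frechet_derivative \<phi> (at (x - t *\<^sub>R s)) s) (at 0)"
          unfolding DERIV_def .
        have "filterlim X (at 0) sequentially" using X nz by (simp add: filterlim_at)
        then show "(\<lambda>i. (\<phi> (x - (t + X i) *\<^sub>R s) - \<phi> (x - t *\<^sub>R s)) / X i) \<longlonglongrightarrow> - frechet_derivative \<phi> (at (x - t *\<^sub>R s)) s"
          by (rule filterlim_compose[OF q])
      qed
      show "AE x in lborel. norm (f x * ((\<phi> (x - (t + X i) *\<^sub>R s) - \<phi> (x - t *\<^sub>R s)) / X i)) \<le> (C * norm s) * norm (f x)" for i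
      proof (intro always_eventually allI)
        fix x
        have "norm (\<phi> (x - (t + X i) *\<^sub>R s) - \<phi> (x - t *\<^sub>R s)) \<le> C * norm ((x - (t + X i) *\<^sub>R s) - (x - t *\<^sub>R s))" by (rule C(3))
        also have "(x - (t + X i) *\<^sub>R s) - (x - t *\<^sub>R s) = - (X i *\<^sub>R s)" by (simp add: algebra_simps)
        finally have "\<bar>\<phi> (x - (t + X i) *\<^sub>R s) - \<phi> (x - t *\<^sub>R s)\<bar> / \<bar>X i\<bar> \<le> C * norm s"
          using nz[of i] by (simp add: field_simps)
        then show "norm (f x * ((\<phi> (x - (t + X i) *\<^sub>R s) - \<phi> (x - t *\<^sub>R s)) / X i)) \<le> (C * norm s) * norm (f x)"
          using mult_left_mono[of _ _ "\<bar>f x\<bar>"]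
          by (simp add: abs_mult mult.commute[of "C * norm s"] flip: times_divide_eq_right)
      qed
    qed measurable
    then show "(\<lambda>i. ((\<integral>x. f x * \<phi> (x - (t + X i) *\<^sub>R s) \<partial>lborel) - (\<integral>x. f x * \<phi> (x - t *\<^sub>R s) \<partial>lborel)) / X i)
      \<longlonglongrightarrow> - (\<integral>x. f x * frechet_derivative \<phi> (at (x - t *\<^sub>R s)) s \<partial>lborel)"
      by (simp add: eq)
  qed
qed

text \<open>All translates of \<phi> have the same integral, so its derivative in the shift is 0. To
  apply the derivative formula above, the constant 1 is replaced by the indicator of a large ball,
  which is integrable.\<close>

lemma integral_frechet_derivative_C1_c:
  fixes \<phi> :: "'a::euclidean_space \<Rightarrow> real"
  assumes \<phi>: "C1_c U \<phi>"
  shows "(\<integral>x. frechet_derivative \<phi> (at x) s \<partial>lborel) = 0"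
proof -
  obtain K where K: "compact K" "\<And>x. x \<notin> K \<Longrightarrow> \<phi> x = 0"
    "\<And>x v. x \<notin> K \<Longrightarrow> frechet_derivative \<phi> (at x) v = 0"
    using C1_c_support[OF \<phi>] by metis
  have [measurable]: "\<phi> \<in> borel_measurable borel" using C1_c_borel_measurable[OF \<phi>] by auto
  obtain r where r: "\<And>x. x \<in> K \<Longrightarrow> norm x \<le> r" using compact_imp_bounded[OF K(1)] by (auto simp: bounded_iff)
  \<comment> \<open>This radius covers the supports of all translates by
    \<open>t *\<^sub>R s\<close> with |t| < 1.\<close>
  define f :: "'a \<Rightarrow> real" where "f = indicator (cball 0 (r + norm s))"
  have f: "integrable lborel f"
    unfolding f_def by (rule integrable_real_indicator) (use emeasure_bounded_finite[OF bounded_cball] in auto)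
  have "(\<integral>x. f x * \<phi> (x - t *\<^sub>R s) \<partial>lborel) = (\<integral>x. \<phi> x \<partial>lborel)" if "t \<in> {-1<..<1}" for t
  proof -
    have "f x * \<phi> (x - t *\<^sub>R s) = \<phi> (x + (- (t *\<^sub>R s)))" for x
    proof (cases "x - t *\<^sub>R s \<in> K")
      case True
      have "norm x \<le> norm (x - t *\<^sub>R s) + norm (t *\<^sub>R s)" using norm_triangle_ineq[of "x - t *\<^sub>R s" "t *\<^sub>R s"] by simp
      also have "\<dots> \<le> r + norm s" using r[OF True] that by (intro add_mono) (auto simp: mult_left_le_one_le)
      finally show ?thesis by (simp add: f_def)
    qed (use K(2) in auto)
    then show ?thesis using lborel_integral_translate(1)[of \<phi> "- (t *\<^sub>R s)"] by (simp only:) simp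
  qed
  then have "((\<lambda>t. \<integral>x. f x * \<phi> (x - t *\<^sub>R s) \<partial>lborel) has_real_derivative 0) (at 0)"
    by (intro has_field_derivative_transform_within_open[OF DERIV_const, of "{-1<..<1}"]) auto
  from DERIV_unique[OF this has_real_derivative_integral_translate[OF f \<phi>]]
  have "(\<integral>x. f x * frechet_derivative \<phi> (at x) s \<partial>lborel) = 0" by simp
  moreover have "f x * frechet_derivative \<phi> (at x) s = frechet_derivative \<phi> (at x) s" for x
    using K(3)[of x s] r[of x] by (cases "x \<in> K") (auto simp: f_def add_increasing2)
  ultimately show ?thesis by simp
qed

text \<open>Induction over integrable functions: indicators, sums, dominated limits. The content is
  the first case. A is enclosed in an open V of almost the same measure; few points of V leave it
  under a small shift, and as a shift preserves the measure of V, as much enters as leaves.\<close>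

lemma L1_translate_continuous:
  fixes f :: "'a::euclidean_space \<Rightarrow> 'b::{banach, second_countable_topology}"
  assumes "integrable lborel f"
  shows "((\<lambda>s. \<integral>x. norm (f (x + s) - f x) \<partial>lborel) \<longlongrightarrow> 0) (at 0)"
  using assms
proof (induction rule: integrable_induct)
  case (base A c)
  have [measurable]: "A \<in> sets borel" using base by auto
  show ?case
  proof (rule tendstoI)
    fix e :: real assume "e > 0"
    \<comment> \<open>The final bound is \<open>norm c * (4 * e')\<close>; adding 1 keeps the
      denominator positive when c = 0.\<close>
    define e' where "e' = e / (4 * (1 + norm c))"
    have e': "e' > 0" using \<open>e > 0\<close> by (simp add: e'_def add_pos_nonneg)
    obtain V where V: "open V" "A \<subseteq> V" "emeasure lborel (V - A) < ennreal e'"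
      using outer_regular_lborel[OF _ e', of A] base by (metis sets_lborel)
    have [measurable]: "V \<in> sets borel" using V by auto
    have "emeasure lborel V = emeasure lborel A + emeasure lborel (V - A)"
      using V by (subst plus_emeasure) (auto simp: Un_absorb1)
    then have Vf: "emeasure lborel V < \<infinity>" using order_less_trans[OF V(3) ennreal_less_top] base by (auto simp: ennreal_add_eq_top less_top)
    have iV: "integrable lborel (indicator V :: _ \<Rightarrow> real)" using Vf by auto
    have iA: "integrable lborel (indicator A :: _ \<Rightarrow> real)" using base by auto
    have iVs: "integrable lborel (\<lambda>x. indicator V (x + s) :: real)" for s
      using lborel_integral_translate(2)[of "indicator V :: _ \<Rightarrow> real" s] iV by auto
    have iAs: "integrable lborel (\<lambda>x. indicator A (x + s) :: real)" for s
      using lborel_integral_translate(2)[of "indicator A :: _ \<Rightarrow> real" s] iA by auto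
    have small: "(\<integral>x. indicator V x - indicator A x \<partial>lborel) < e'"
    proof -
      have "(\<integral>x. indicator V x - indicator A x \<partial>lborel) = (\<integral>x. indicator (V - A) x \<partial>lborel)"
        using V by (intro Bochner_Integration.integral_cong) (auto simp: indicator_def)
      also have "\<dots> = measure lborel (V - A)" by simp
      also have "\<dots> < e'" using V(3) e' by (simp add: measure_def enn2real_less_iff less_top[symmetric])
         (metis ennreal_less_top order_less_trans enn2real_less_iff top.not_eq_extremum)
      finally show ?thesis .
    qed
    \<comment> \<open>Only the positive part converges pointwise: a point of the open set V stays in
      V under small shifts, whereas a boundary point may enter V.\<close>
    have lim: "((\<lambda>s. \<integral>x. max 0 (indicator V x - indicator V (x + s)) \<partial>lborel) \<longlongrightarrow> (\<integral>x. (0::real) \<partial>(lborel::'a measure))) (at 0)"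
      unfolding tendsto_at_iff_sequentially o_def
    proof (intro allI impI)
      fix X :: "nat \<Rightarrow> 'a" assume X: "\<forall>i. X i \<in> UNIV - {0}" "X \<longlonglongrightarrow> 0"
      show "(\<lambda>i. \<integral>x. max 0 (indicator V x - indicator V (x + X i)) \<partial>lborel) \<longlonglongrightarrow> (\<integral>x. (0::real) \<partial>(lborel::'a measure))"
      proof (rule integral_dominated_convergence[where w = "indicator V"])
        show "AE x in lborel. (\<lambda>i. max 0 (indicator V x - indicator V (x + X i))) \<longlonglongrightarrow> (0::real)"
        proof (intro always_eventually allI)
          fix x
          show "(\<lambda>i. max 0 (indicator V x - indicator V (x + X i))) \<longlonglongrightarrow> (0::real)"
          proof (cases "x \<in> V")
            case True
            have "(\<lambda>i. x + X i) \<longlonglongrightarrow> x + 0" using X by (intro tendsto_intros)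
            then have "\<forall>\<^sub>F i in sequentially. x + X i \<in> V" using topological_tendstoD V(1) True by fastforce
            then show ?thesis by (intro tendsto_eventually) (auto elim!: eventually_mono simp: indicator_def)
          qed auto
        qed
        show "AE x in lborel. norm (max 0 (indicator V x - indicator V (x + X i)) :: real) \<le> indicator V x" for i
          by (auto simp: indicator_def)
      qed (use iV in auto)
    qed
    then have "\<forall>\<^sub>F s in at 0. (\<integral>x. max 0 (indicator V x - indicator V (x + s)) \<partial>lborel) < e'"
      using e' by (auto simp: order_tendsto_iff)
    then show "\<forall>\<^sub>F s in at 0. dist (\<integral>x. norm (indicat_real A (x + s) *\<^sub>R c - indicat_real A x *\<^sub>R c) \<partial>lborel) 0 < e"
    proof eventually_elim
      case (elim s)
      let ?m = "\<lambda>x. max 0 (indicator V x - indicator V (x + s)) :: real"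
      let ?d = "\<lambda>x. indicator V x - indicator A x :: real"
      have im: "integrable lborel ?m" using iV iVs by auto
      have id: "integrable lborel ?d" using iV iA by auto
      have ids: "integrable lborel (\<lambda>x. ?d (x + s))" using iVs iAs by auto
      have ds: "(\<integral>x. ?d (x + s) \<partial>lborel) = integral\<^sup>L lborel ?d"
        by (rule lborel_integral_translate(1)) measurable
      have Vs: "(\<integral>x. indicat_real V (x + s) \<partial>lborel) = (\<integral>x. indicat_real V x \<partial>lborel)"
        by (rule lborel_integral_translate(1)) measurable
      \<comment> \<open>For the increment d of the indicator of V, |d| = 2 max(0, -d) + d, and the
        last term integrates to 0 by translation invariance. The two terms \<open>?d\<close> pay for
        replacing A by V.\<close>
      have bnd: "norm (indicat_real A (x + s) *\<^sub>R c - indicat_real A x *\<^sub>R c)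
          \<le> norm c * (2 * ?m x + (indicator V (x + s) - indicator V x) + ?d x + ?d (x + s))" for x
        using V(2) by (auto simp: indicator_def)
      have ii: "integrable lborel (\<lambda>x. 2 * ?m x + (indicator V (x + s) - indicator V x) + ?d x + ?d (x + s))"
        by (intro Bochner_Integration.integrable_add integrable_mult_right Bochner_Integration.integrable_diff im id ids iVs iV)
      have "(\<integral>x. norm (indicat_real A (x + s) *\<^sub>R c - indicat_real A x *\<^sub>R c) \<partial>lborel)
          \<le> (\<integral>x. norm c * (2 * ?m x + (indicator V (x + s) - indicator V x) + ?d x + ?d (x + s)) \<partial>lborel)"
        by (rule integral_mono) (use bnd ii iA iAs in auto)
      also have "\<dots> = norm c * (2 * (\<integral>x. ?m x \<partial>lborel) + 2 * (\<integral>x. ?d x \<partial>lborel))"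
      proof -
        have "(\<integral>x. 2 * ?m x + (indicator V (x + s) - indicator V x) + ?d x + ?d (x + s) \<partial>lborel) =
          (\<integral>x. 2 * ?m x \<partial>lborel) + ((\<integral>x. indicator V (x + s) \<partial>lborel) - (\<integral>x. indicator V x \<partial>lborel)) + (\<integral>x. ?d x \<partial>lborel) + (\<integral>x. ?d (x + s) \<partial>lborel)"
          using im iV iVs iA iAs by simp
        then show ?thesis using ds Vs by simp
      qed
      also have "\<dots> \<le> norm c * (4 * e')"
        using elim small by (intro mult_left_mono) auto
      also have "\<dots> < e"
        using \<open>e > 0\<close> unfolding e'_def by (simp add: field_simps add_pos_nonneg)
      finally show ?case by (simp add: dist_norm)
    qed
  qed
next
  case (add f g)
  have [measurable]: "f \<in> borel_measurable borel" "g \<in> borel_measurable borel" using add by auto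
  have i: "integrable lborel (\<lambda>x. norm (f (x + s) - f x))" "integrable lborel (\<lambda>x. norm (g (x + s) - g x))" for s
    using integrable_translate[OF add(1), of s] integrable_translate[OF add(2), of s] add(1,2) by auto
  have "((\<lambda>s. (\<integral>x. norm (f (x + s) - f x) \<partial>lborel) + (\<integral>x. norm (g (x + s) - g x) \<partial>lborel)) \<longlongrightarrow> 0 + 0) (at 0)"
    by (intro tendsto_add add(3,4))
  then have lim: "((\<lambda>s. (\<integral>x. norm (f (x + s) - f x) \<partial>lborel) + (\<integral>x. norm (g (x + s) - g x) \<partial>lborel)) \<longlongrightarrow> 0) (at 0)" by simp
  show ?case
  proof (rule Lim_null_comparison[OF always_eventually lim], intro allI)
    fix s
    have "(\<integral>x. norm (f (x + s) + g (x + s) - (f x + g x)) \<partial>lborel) \<le> (\<integral>x. norm (f (x + s) - f x) + norm (g (x + s) - g x) \<partial>lborel)"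
    proof (rule integral_mono)
      show "norm (f (x + s) + g (x + s) - (f x + g x)) \<le> norm (f (x + s) - f x) + norm (g (x + s) - g x)" for x
        using norm_triangle_ineq[of "f (x + s) - f x" "g (x + s) - g x"] by (simp add: algebra_simps)
      show "integrable lborel (\<lambda>x. norm (f (x + s) + g (x + s) - (f x + g x)))"
        using integrable_translate[OF add(1), of s] integrable_translate[OF add(2), of s] add(1,2) by auto
    qed (use i in auto)
    then show "norm (\<integral>x. norm (f (x + s) + g (x + s) - (f x + g x)) \<partial>lborel) \<le> (\<integral>x. norm (f (x + s) - f x) \<partial>lborel) + (\<integral>x. norm (g (x + s) - g x) \<partial>lborel)"
      using i by simp
  qed
next
  case (lim f S)
  have [measurable]: "f \<in> borel_measurable borel" "S i \<in> borel_measurable borel" for i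
    using lim.hyps(1)[of i] lim.hyps(4) by auto
  \<comment> \<open>The approximants are bounded by 2|f|, hence their distance to f by 3|f|.\<close>
  have "(\<lambda>i. \<integral>x. norm (S i x - f x) \<partial>lborel) \<longlonglongrightarrow> (\<integral>x. 0 \<partial>(lborel::'a measure))"
  proof (rule integral_dominated_convergence[where w = "\<lambda>x. 3 * norm (f x)"])
    show "AE x in lborel. (\<lambda>i. norm (S i x - f x)) \<longlonglongrightarrow> 0"
      using lim.hyps(2) by (intro always_eventually allI) (simp add: tendsto_norm_zero LIM_zero)
    show "AE x in lborel. norm (norm (S i x - f x)) \<le> 3 * norm (f x)" for i
    proof (intro always_eventually allI)
      fix x show "norm (norm (S i x - f x)) \<le> 3 * norm (f x)"
        using norm_triangle_ineq4[of "S i x" "f x"] lim.hyps(3)[of x i] by simp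
    qed
  qed (use lim.hyps in auto)
  then have l: "(\<lambda>i. \<integral>x. norm (S i x - f x) \<partial>lborel) \<longlonglongrightarrow> 0" by simp
  show ?case
  proof (rule tendstoI)
    fix e :: real assume "e > 0"
    then obtain i where i: "(\<integral>x. norm (S i x - f x) \<partial>lborel) < e / 3"
      using order_tendstoD(2)[OF l, of "e/3"] by (auto simp: eventually_sequentially)
    have "\<forall>\<^sub>F s in at 0. (\<integral>x. norm (S i (x + s) - S i x) \<partial>lborel) < e / 3"
      using order_tendstoD(2)[OF lim.IH, of "e/3" i] \<open>e > 0\<close> by auto
    then show "\<forall>\<^sub>F s in at 0. dist (\<integral>x. norm (f (x + s) - f x) \<partial>lborel) 0 < e"
    proof eventually_elim
      case (elim s)
      have iS: "integrable lborel (\<lambda>x. norm (S i (x + s) - S i x))" "integrable lborel (\<lambda>x. norm (S i x - f x))"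
         "integrable lborel (\<lambda>x. norm (f (x + s) - f x))" "integrable lborel (\<lambda>x. norm (S i (x + s) - f (x + s)))"
        using lim.hyps(1)[of i] lim.hyps(4) integrable_translate[OF lim.hyps(4), of s] integrable_translate[OF lim.hyps(1)[of i], of s] by auto
      have "(\<integral>x. norm (f (x + s) - f x) \<partial>lborel) \<le> (\<integral>x. norm (S i (x + s) - f (x + s)) + (norm (S i (x + s) - S i x) + norm (S i x - f x)) \<partial>lborel)"
      proof (rule integral_mono)
        show "norm (f (x + s) - f x) \<le> norm (S i (x + s) - f (x + s)) + (norm (S i (x + s) - S i x) + norm (S i x - f x))" for x
          by norm
      qed (use iS in auto)
      also have "\<dots> = (\<integral>x. norm (S i (x + s) - f (x + s)) \<partial>lborel) + ((\<integral>x. norm (S i (x + s) - S i x) \<partial>lborel) + (\<integral>x. norm (S i x - f x) \<partial>lborel))"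
        using iS by simp
      also have "(\<integral>x. norm (S i (x + s) - f (x + s)) \<partial>lborel) = (\<integral>x. norm (S i x - f x) \<partial>lborel)"
        by (rule lborel_integral_translate(1)) measurable
      finally have "(\<integral>x. norm (f (x + s) - f x) \<partial>lborel) < e" using i elim by linarith
      then show ?case using iS(3) by (simp add: dist_norm)
    qed
  qed
qed

section \<open>Bump functions and a first-order Taylor estimate for Sobolev functions\<close>

text \<open>For k at least 2 this is continuously differentiable, with derivative a multiple of
  \<open>bump (k - 1) c z\<close> times the inner product with z; so fields built from it have
  explicit derivatives in the same family. With c the square of r it is a cutoff to the ball of
  radius r.\<close>

definition bump :: "nat \<Rightarrow> real \<Rightarrow> 'a::euclidean_space \<Rightarrow> real" where
  "bump k c z = (max 0 (c - z \<bullet> z)) ^ k"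

lemma has_real_derivative_max_power:
  "((\<lambda>t::real. (max 0 t) ^ Suc (Suc k)) has_real_derivative (real (Suc (Suc k)) * (max 0 t) ^ Suc k)) (at t)"
proof -
  consider "t > 0" | "t < 0" | "t = 0" by linarith
  then show ?thesis
  proof cases
    case 1
    have "((\<lambda>t::real. t ^ Suc (Suc k)) has_real_derivative (real (Suc (Suc k)) * t ^ Suc k)) (at t)"
      using DERIV_pow[of "Suc (Suc k)" t] by simp
    then have "((\<lambda>t::real. (max 0 t) ^ Suc (Suc k)) has_real_derivative (real (Suc (Suc k)) * t ^ Suc k)) (at t)"
      by (rule has_field_derivative_transform_within_open[of _ _ _ "{0<..}"]) (use 1 in auto)
    then show ?thesis using 1 by simp
  next
    case 2
    have "((\<lambda>t::real. (max 0 t) ^ Suc (Suc k)) has_real_derivative 0) (at t)"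
      by (rule has_field_derivative_transform_within_open[OF DERIV_const[of 0], of "{..<0}"]) (use 2 in auto)
    then show ?thesis using 2 by simp
  next
    case 3
    \<comment> \<open>At 0 the quotient is bounded by a positive power of |h|; here the exponent has
      to be at least 2.\<close>
    have "((\<lambda>h. (max 0 h) ^ Suc (Suc k) / h) \<longlongrightarrow> 0) (at (0::real))"
    proof (rule Lim_null_comparison)
      show "\<forall>\<^sub>F h in at (0::real). norm ((max 0 h) ^ Suc (Suc k) / h) \<le> \<bar>h\<bar> ^ Suc k"
      proof (intro always_eventually allI)
        fix h :: real
        show "norm ((max 0 h) ^ Suc (Suc k) / h) \<le> \<bar>h\<bar> ^ Suc k"
        proof (cases "h > 0")
          case False
          then have "(max 0 h) ^ Suc (Suc k) = 0" by simp
          then show ?thesis by (simp only:) simp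
        qed (auto simp: abs_mult)
      qed
      show "((\<lambda>h. \<bar>h\<bar> ^ Suc k) \<longlongrightarrow> 0) (at (0::real))"
        by (rule tendsto_eq_intros | simp)+
    qed
    then show ?thesis unfolding DERIV_def using 3 by simp
  qed
qed

lemma has_derivative_bump [derivative_intros]:
  "(bump (Suc (Suc k)) c has_derivative
     (\<lambda>v. - 2 * real (Suc (Suc k)) * bump (Suc k) c z * (z \<bullet> v))) (at z)"
proof -
  have "((\<lambda>z. c - z \<bullet> z) has_derivative (\<lambda>v. - 2 * (z \<bullet> v))) (at z)"
    by (auto intro!: derivative_eq_intros simp: inner_commute)
  from DERIV_compose_FDERIV[OF has_real_derivative_max_power this]
  show ?thesis unfolding bump_def[abs_def] by (simp add: algebra_simps)
qed

lemma continuous_on_bump [continuous_intros]: "continuous_on S (bump k c)"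
  unfolding bump_def[abs_def] by (intro continuous_intros)

lemma borel_measurable_bump [measurable]: "bump k c \<in> borel_measurable borel"
  by (intro borel_measurable_continuous_onI continuous_intros)

lemma bump_nonneg: "bump k c z \<ge> 0"
  by (simp add: bump_def)

lemma bump_le: "c \<ge> 0 \<Longrightarrow> bump k c z \<le> c ^ k"
  unfolding bump_def by (rule power_mono) auto

lemma bump_eq_0: "norm z \<ge> r \<Longrightarrow> r \<ge> 0 \<Longrightarrow> k > 0 \<Longrightarrow> bump k (r\<^sup>2) z = 0"
  using power_mono[of r "norm z" 2] by (auto simp: bump_def max_def dot_square_norm)

section \<open>\<open>L^1\<close> norms by duality with \<open>C1_c\<close> functions\<close>

lemma real_polynomial_function_C1:
  fixes p :: "'a::euclidean_space \<Rightarrow> real"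
  assumes "real_polynomial_function p"
  shows "\<exists>p'. (\<forall>x. (p has_derivative p' x) (at x)) \<and> (\<forall>b. continuous_on UNIV (\<lambda>x. p' x b))"
  using assms
proof (induction rule: real_polynomial_function.induct)
  case (linear f)
  then show ?case
    by (intro exI[of _ "\<lambda>_. f"]) (auto intro: bounded_linear_imp_has_derivative)
next
  case (const c)
  then show ?case by (intro exI[of _ "\<lambda>_ _. 0"]) auto
next
  case (add f g)
  then obtain f' g' where "\<forall>x. (f has_derivative f' x) (at x)" "\<forall>b. continuous_on UNIV (\<lambda>x. f' x b)"
    "\<forall>x. (g has_derivative g' x) (at x)" "\<forall>b. continuous_on UNIV (\<lambda>x. g' x b)" by metis
  then show ?case
    by (intro exI[of _ "\<lambda>x b. f' x b + g' x b"]) (auto intro!: derivative_intros continuous_intros)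
next
  case (mult f g)
  then obtain f' g' where *: "\<forall>x. (f has_derivative f' x) (at x)" "\<forall>b. continuous_on UNIV (\<lambda>x. f' x b)"
    "\<forall>x. (g has_derivative g' x) (at x)" "\<forall>b. continuous_on UNIV (\<lambda>x. g' x b)" by metis
  then have "continuous_on UNIV f" "continuous_on UNIV g"
    by (meson continuous_at_imp_continuous_on has_derivative_continuous)+
  with * show ?case
    by (intro exI[of _ "\<lambda>x b. f x * g' x b + f' x b * g x"]) (auto intro!: derivative_intros continuous_intros)
qed

text \<open>The factor \<open>q x / (1 + q x)\<close> lies in [0,1), vanishes off the ball of radius
  r' and tends to 1 as m grows wherever the bump is positive: a \<open>C^1\<close> approximation of
  the indicator of the ball. Since r' < r the support is compact inside the open ball.\<close>

lemma C1_c_cutoff_polynomial: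
  fixes p :: "'a::euclidean_space \<Rightarrow> real" and m :: real and x0 :: 'a
  assumes p: "real_polynomial_function p" and m: "m \<ge> 0" and r: "0 \<le> r'" "r' < r"
  defines "q \<equiv> \<lambda>x. m * bump 2 (r'\<^sup>2) (x - x0)"
  shows "C1_c (ball x0 r) (\<lambda>x. p x * (q x / (1 + q x)))"
proof -
  obtain p' where p': "\<And>x. (p has_derivative p' x) (at x)" "\<And>b. continuous_on UNIV (\<lambda>x. p' x b)"
    using real_polynomial_function_C1[OF p] by metis
  have cp: "continuous_on UNIV p"
    using p' by (meson continuous_at_imp_continuous_on has_derivative_continuous)
  have q0: "q x \<ge> 0" for x using m by (simp add: q_def bump_nonneg)
  then have q1: "1 + q x \<noteq> 0" for x by (metis add_pos_nonneg less_numeral_extra(3) zero_less_one)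
  define q' where "q' = (\<lambda>x v. m * (- 4 * bump 1 (r'\<^sup>2) (x - x0) * ((x - x0) \<bullet> v)))"
  have dq: "(q has_derivative q' x) (at x)" for x
  proof -
    have "((\<lambda>x. bump 2 (r'\<^sup>2) (x - x0)) has_derivative (\<lambda>v. - 4 * bump 1 (r'\<^sup>2) (x - x0) * ((x - x0) \<bullet> v))) (at x)"
    proof -
      have "((\<lambda>x. x - x0) has_derivative (\<lambda>v. v)) (at x)" by (auto intro!: derivative_eq_intros)
      from has_derivative_compose[OF this, where g = "bump (Suc (Suc 0)) (r'\<^sup>2)", OF has_derivative_bump]
      show ?thesis by (simp add: numeral_2_eq_2)
    qed
    then show ?thesis unfolding q_def q'_def by (rule has_derivative_mult_right)
  qed
  have cq: "continuous_on UNIV q" 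
    using dq by (meson continuous_at_imp_continuous_on has_derivative_continuous)
  have cq': "continuous_on UNIV (\<lambda>x. q' x b)" for b
    unfolding q'_def by (intro continuous_intros continuous_on_compose2[OF continuous_on_bump[of UNIV]]) auto
  define \<theta>' where "\<theta>' = (\<lambda>x v. q' x v * (1 / (1 + q x)\<^sup>2))"
  have d\<theta>: "((\<lambda>x. q x / (1 + q x)) has_derivative \<theta>' x) (at x)" for x
  proof -
    have "((\<lambda>t. t / (1 + t)) has_real_derivative (1 / (1 + q x)\<^sup>2)) (at (q x))"
      using q1[of x] by (auto intro!: derivative_eq_intros simp: power2_eq_square)
    from DERIV_compose_FDERIV[OF this dq] show ?thesis by (simp add: \<theta>'_def)
  qed
  show ?thesis
  proof (rule C1_cI)
    show "((\<lambda>x. p x * (q x / (1 + q x))) has_derivative (\<lambda>v. p x * \<theta>' x v + p' x v * (q x / (1 + q x)))) (at x)" for x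
      by (rule has_derivative_mult[OF p'(1) d\<theta>])
    show "continuous_on UNIV (\<lambda>x. p x * \<theta>' x b + p' x b * (q x / (1 + q x)))" for b
      unfolding \<theta>'_def by (intro continuous_intros cp cq cq' p'(2)) (use q1 in auto)
    show "compact (cball x0 r')" by simp
    show "cball x0 r' \<subseteq> ball x0 r" using r by auto
    show "p x * (q x / (1 + q x)) = 0" if "x \<notin> cball x0 r'" for x
      using that r bump_eq_0[of r' "x - x0" 2] by (auto simp: q_def dist_norm norm_minus_commute)
  qed
qed

text \<open>The test functions approximate the sign of D: a measurable function is an a.e. limit of
  continuous ones, these are uniformly close to polynomials on the closed ball, and a polynomial
  times a cutoff lies in \<open>C1_c\<close>. Dominated convergence with majorant |D| passes the
  bound to the limit.\<close>

lemma integral_abs_le_C1_c: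
  fixes D :: "'a::euclidean_space \<Rightarrow> real"
  assumes D: "integrable lborel D" and r: "r > 0"
    and bound: "\<And>\<psi>. C1_c (ball x0 r) \<psi> \<Longrightarrow> (\<And>x. \<bar>\<psi> x\<bar> \<le> 1) \<Longrightarrow> (\<integral>x. D x * \<psi> x \<partial>lborel) \<le> M"
  shows "(\<integral>x. indicator (ball x0 r) x * \<bar>D x\<bar> \<partial>lborel) \<le> M"
proof -
  have [measurable]: "D \<in> borel_measurable borel" "ball x0 r \<in> sets borel" using D by auto
  have "(\<lambda>x. sgn (D x)) \<in> borel_measurable lebesgue"
    by (rule measurable_completion) measurable
  from lebesgue_measurable_imp_measurable_on_real[OF this, of UNIV]
  obtain N g where N: "negligible N" and g: "\<And>n. continuous_on UNIV (g n)"
    and lim: "\<And>x. x \<notin> N \<Longrightarrow> (\<lambda>n. g n x) \<longlonglongrightarrow> sgn (D x)"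
    unfolding measurable_on_def by auto
  \<comment> \<open>Clipping to [-1,1] preserves the limit, because the sign already lies
    there.\<close>
  define c where "c = (\<lambda>n x. max (-1) (min 1 (g n x)))"
  have c: "continuous_on S (c n)" for n S
    unfolding c_def by (intro continuous_intros continuous_on_subset[OF g]) auto
  have c1: "\<bar>c n x\<bar> \<le> 1" for n x by (auto simp: c_def)
  have "\<exists>p. real_polynomial_function p \<and> (\<forall>x\<in>cball x0 r. \<bar>c n x - p x\<bar> < 1 / real (Suc n))" for n
    using Stone_Weierstrass_real_polynomial_function[OF compact_cball c, of "1 / real (Suc n)"] by (metis divide_pos_pos of_nat_0_less_iff zero_less_Suc zero_less_one)
  then obtain p where p: "\<And>n. real_polynomial_function (p n)"
    and pc: "\<And>n x. x \<in> cball x0 r \<Longrightarrow> \<bar>c n x - p n x\<bar> < 1 / real (Suc n)" by metis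
  \<comment> \<open>Radii increasing to r from below: every cutoff has compact support inside the
    open ball, and every point of the ball is eventually reached.\<close>
  define r' where "r' = (\<lambda>n. r * (1 - 1 / real (Suc n)))"
  have r': "0 \<le> r' n" "r' n < r" for n using r by (auto simp: r'_def field_simps)
  define q where "q = (\<lambda>n x. real n * bump 2 ((r' n)\<^sup>2) (x - x0))"
  have q0: "q n x \<ge> 0" for n x by (simp add: q_def bump_nonneg)
  define \<eta> where "\<eta> = (\<lambda>n x. q n x / (1 + q n x))"
  have \<eta>01: "0 \<le> \<eta> n x" "\<eta> n x \<le> 1" for n x using q0[of n x] by (auto simp: \<eta>_def)
  have \<eta>0: "\<eta> n x = 0" if "x \<notin> ball x0 r" for n x
    using that r'[of n] bump_eq_0[of "r' n" "x - x0" 2] by (auto simp: \<eta>_def q_def dist_norm norm_minus_commute)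
  \<comment> \<open>On the ball the polynomial exceeds 1 in absolute value by at most
    \<open>1 / real (Suc n)\<close>; the divisor restores the bound 1.\<close>
  define \<psi> where "\<psi> = (\<lambda>n x. p n x * \<eta> n x / (1 + 1 / real (Suc n)))"
  have \<psi>C: "C1_c (ball x0 r) (\<psi> n)" for n
  proof -
    have "real_polynomial_function (\<lambda>x. p n x * (1 / (1 + 1 / real (Suc n))))"
      by (intro real_polynomial_function.intros(2,4) p)
    from C1_c_cutoff_polynomial[OF this _ r'(1)[of n] r'(2)[of n], of "real n"]
    show ?thesis unfolding \<psi>_def \<eta>_def q_def by (simp add: mult.commute)
  qed
  have \<psi>1: "\<bar>\<psi> n x\<bar> \<le> 1" for n x
  proof (cases "x \<in> ball x0 r")
    case True
    have "\<bar>p n x\<bar> \<le> 1 + 1 / real (Suc n)" using pc[of x n] c1[of n x] True by (auto simp: abs_le_iff abs_less_iff)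
    then have "\<bar>p n x\<bar> * \<eta> n x \<le> (1 + 1 / real (Suc n)) * 1"
      using \<eta>01[of n x] by (intro mult_mono) (auto intro: add_nonneg_nonneg)
    then have "\<bar>p n x\<bar> * \<eta> n x / (1 + 1 / real (Suc n)) \<le> 1" by (subst divide_le_eq) (auto simp: add_pos_pos)
    then show ?thesis using \<eta>01[of n x] by (simp add: \<psi>_def abs_mult)
  qed (auto simp: \<psi>_def \<eta>0)
  have lim0: "(\<lambda>n. 1 / real (Suc n)) \<longlonglongrightarrow> 0" using LIMSEQ_inverse_real_of_nat by (simp add: inverse_eq_divide)
  have \<eta>lim: "(\<lambda>n. \<eta> n x) \<longlonglongrightarrow> 1" if "x \<in> ball x0 r" for x
  proof -
    have "r' \<longlonglongrightarrow> r * (1 - 0)" unfolding r'_def by (intro tendsto_intros lim0)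
    then have L: "(\<lambda>n. bump 2 ((r' n)\<^sup>2) (x - x0)) \<longlonglongrightarrow> bump 2 (r\<^sup>2) (x - x0)"
      unfolding bump_def by (auto intro!: tendsto_intros)
    have b: "bump 2 (r\<^sup>2) (x - x0) > 0"
    proof -
      have "norm (x - x0) < r" using that by (simp add: dist_norm norm_minus_commute)
      then have "(norm (x - x0))\<^sup>2 < r\<^sup>2" by (simp add: power_strict_mono)
      then show ?thesis by (simp add: bump_def dot_square_norm)
    qed
    have "filterlim (\<lambda>n. q n x) at_top sequentially"
      unfolding q_def by (subst mult.commute) (rule filterlim_tendsto_pos_mult_at_top[OF L b filterlim_real_sequentially])
    then have "filterlim (\<lambda>n. 1 + q n x) at_top sequentially"
      by (intro filterlim_tendsto_add_at_top[OF tendsto_const])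
    then have "(\<lambda>n. inverse (1 + q n x)) \<longlonglongrightarrow> 0" by (rule tendsto_inverse_0_at_top)
    then have "(\<lambda>n. 1 - inverse (1 + q n x)) \<longlonglongrightarrow> 1 - 0" by (intro tendsto_intros)
    moreover have "1 - inverse (1 + q n x) = \<eta> n x" for n
      using q0[of n x] by (simp add: \<eta>_def field_simps)
    ultimately show ?thesis by simp
  qed
  have plim: "(\<lambda>n. p n x) \<longlonglongrightarrow> sgn (D x)" if "x \<in> ball x0 r" "x \<notin> N" for x
  proof -
    have "(\<lambda>n. c n x) \<longlonglongrightarrow> max (-1) (min 1 (sgn (D x)))" unfolding c_def by (intro tendsto_intros lim that)
    then have "(\<lambda>n. c n x) \<longlonglongrightarrow> sgn (D x)" by (simp add: sgn_if)
    moreover have "(\<lambda>n. c n x - p n x) \<longlonglongrightarrow> 0"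
      by (rule Lim_null_comparison[OF _ lim0]) (use pc[of x] that in \<open>auto simp: less_imp_le\<close>)
    ultimately have "(\<lambda>n. c n x - (c n x - p n x)) \<longlonglongrightarrow> sgn (D x) - 0" by (rule tendsto_diff)
    then show ?thesis by simp
  qed
  have [measurable]: "\<psi> n \<in> borel_measurable borel" for n using C1_c_borel_measurable[OF \<psi>C] by auto
  have "(\<lambda>n. \<integral>x. D x * \<psi> n x \<partial>lborel) \<longlonglongrightarrow> (\<integral>x. indicator (ball x0 r) x * \<bar>D x\<bar> \<partial>lborel)"
  proof (rule integral_dominated_convergence[where w = "\<lambda>x. norm (D x)"])
    show "AE x in lborel. (\<lambda>n. D x * \<psi> n x) \<longlonglongrightarrow> indicator (ball x0 r) x * \<bar>D x\<bar>"
    proof -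
      have "AE x in lebesgue. x \<notin> N" using N by (simp add: negligible_iff_null_sets AE_not_in)
      then have "AE x in lborel. x \<notin> N" by (simp add: AE_completion_iff)
      then show ?thesis
      proof eventually_elim
        case (elim x)
        show ?case
        proof (cases "x \<in> ball x0 r")
          case True
          have "(\<lambda>n. D x * (p n x * \<eta> n x / (1 + 1 / real (Suc n)))) \<longlonglongrightarrow> D x * (sgn (D x) * 1 / (1 + 0))"
            by (intro tendsto_intros plim[OF True elim] \<eta>lim[OF True] lim0) simp
          then show ?thesis using True by (simp add: \<psi>_def abs_sgn)
        qed (simp add: \<psi>_def \<eta>0)
      qed
    qed
    show "AE x in lborel. norm (D x * \<psi> n x) \<le> norm (D x)" for n
      using \<psi>1[of n] by (auto simp: abs_mult mult_left_le)
  qed (use D in auto)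
  then show ?thesis
    by (rule LIMSEQ_le_const2) (use bound[OF \<psi>C \<psi>1] in auto)
qed

text \<open>Since \<phi> is supported in U, the integrals over the whole space see f and G on U
  alone. Both may therefore be extended by zero across the boundary of U without creating a boundary
  term.\<close>

definition weak_gradient :: "(real^'n) set \<Rightarrow> (real^'n \<Rightarrow> real) \<Rightarrow> (real^'n \<Rightarrow> real^'n) \<Rightarrow> bool" where
  "weak_gradient U f G \<longleftrightarrow> (\<forall>\<phi> i. C1_c U \<phi> \<longrightarrow>
     (\<integral>x. f x * frechet_derivative \<phi> (at x) (axis i 1) \<partial>lborel) = - (\<integral>x. G x $ i * \<phi> x \<partial>lborel))"

lemma integrable_mult_C1_c:
  fixes f :: "'a::euclidean_space \<Rightarrow> real"
  assumes "integrable lborel f" "C1_c U \<phi>"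
  shows "integrable lborel (\<lambda>x. f x * \<phi> x)" "integrable lborel (\<lambda>x. f x * frechet_derivative \<phi> (at x) v)"
proof -
  obtain C where C: "C \<ge> 0" "\<And>x. norm (\<phi> x) \<le> C"
    "\<And>x v. norm (frechet_derivative \<phi> (at x) v) \<le> C * norm v"
    using C1_c_bounds[OF assms(2)] by metis
  have [measurable]: "f \<in> borel_measurable borel" "\<phi> \<in> borel_measurable borel"
    "(\<lambda>x. frechet_derivative \<phi> (at x) v) \<in> borel_measurable borel"
    using assms(1) C1_c_borel_measurable[OF assms(2)] by auto
  show "integrable lborel (\<lambda>x. f x * \<phi> x)"
    by (rule Bochner_Integration.integrable_bound[OF integrable_mult_right[OF integrable_norm[OF assms(1)], of C]])
       (use C in \<open>auto simp: abs_mult mult.commute[of C] intro!: mult_left_mono\<close>)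
  show "integrable lborel (\<lambda>x. f x * frechet_derivative \<phi> (at x) v)"
    by (rule Bochner_Integration.integrable_bound[OF integrable_mult_right[OF integrable_norm[OF assms(1)], of "C * norm v"]])
       (use C in \<open>auto simp: abs_mult mult.commute[of "C * norm v"] intro!: mult_left_mono\<close>)
qed

lemma weak_gradient_inner:
  assumes f: "integrable lborel f" and G: "integrable lborel G" and w: "weak_gradient U f G" and \<phi>: "C1_c U \<phi>"
  shows "(\<integral>x. f x * frechet_derivative \<phi> (at x) s \<partial>lborel) = - (\<integral>x. (G x \<bullet> s) * \<phi> x \<partial>lborel)"
proof -
  have L: "linear (frechet_derivative \<phi> (at y))" for y
    using C1_c_has_derivative[OF \<phi>] has_derivative_linear by blast
  have Gi: "integrable lborel (\<lambda>x. G x $ i)" for i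
    using integrable_inner_left[OF G, of "axis i 1"] by (simp add: inner_axis)
  have s: "s = (\<Sum>i\<in>UNIV. s $ i *\<^sub>R axis i 1)"
    using basis_expansion[of s] by (simp add: scalar_mult_eq_scaleR)
  have fd: "frechet_derivative \<phi> (at x) s = (\<Sum>i\<in>UNIV. s $ i * frechet_derivative \<phi> (at x) (axis i 1))" for x
    by (subst s) (simp add: linear_sum[OF L] linear_scale[OF L])
  have "(\<integral>x. f x * frechet_derivative \<phi> (at x) s \<partial>lborel)
      = (\<integral>x. (\<Sum>i\<in>UNIV. s $ i * (f x * frechet_derivative \<phi> (at x) (axis i 1))) \<partial>lborel)"
    by (simp add: fd sum_distrib_left algebra_simps)
  also have "\<dots> = (\<Sum>i\<in>UNIV. s $ i * (\<integral>x. f x * frechet_derivative \<phi> (at x) (axis i 1) \<partial>lborel))"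
    using integrable_mult_C1_c(2)[OF f \<phi>] by (subst Bochner_Integration.integral_sum) auto
  also have "\<dots> = - (\<Sum>i\<in>UNIV. s $ i * (\<integral>x. G x $ i * \<phi> x \<partial>lborel))"
    using w \<phi> by (simp add: weak_gradient_def sum_negf)
  also have "(\<Sum>i\<in>UNIV. s $ i * (\<integral>x. G x $ i * \<phi> x \<partial>lborel)) = (\<integral>x. (\<Sum>i\<in>UNIV. s $ i * (G x $ i * \<phi> x)) \<partial>lborel)"
    using integrable_mult_C1_c(1)[OF Gi \<phi>] by (subst Bochner_Integration.integral_sum) auto
  also have "\<dots> = (\<integral>x. (G x \<bullet> s) * \<phi> x \<partial>lborel)"
    by (simp add: inner_vec_def sum_distrib_right sum_distrib_left algebra_simps)
  finally show ?thesis .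
qed

text \<open>By duality the remainder is tested with \<psi>. The integral of f against \<psi> shifted
  by \<open>t *\<^sub>R s\<close> is differentiable in t, its derivative being the integral of
  \<open>G (x + t *\<^sub>R s) \<bullet> s\<close> against \<psi>; the mean value theorem then turns
  the tested remainder into an increment of G. The bound on \<open>norm s\<close> keeps the shifted
  test functions supported in the ball of radius R.\<close>

lemma weak_gradient_taylor:
  fixes f :: "real^'n \<Rightarrow> real"
  assumes f: "integrable lborel f" and G: "integrable lborel G" and w: "weak_gradient (ball x0 R) f G"
    and r: "0 < r" "norm s \<le> R - r"
    and \<omega>: "\<And>t. 0 \<le> t \<Longrightarrow> t \<le> 1 \<Longrightarrow> (\<integral>x. norm (G (x + t *\<^sub>R s) - G x) \<partial>lborel) \<le> \<omega>"
  shows "(\<integral>x. indicator (ball x0 r) x * \<bar>f (x + s) - f x - G x \<bullet> s\<bar> \<partial>lborel) \<le> norm s * \<omega>"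
proof (rule integral_abs_le_C1_c)
  have Gs: "integrable lborel (\<lambda>x. G x \<bullet> s)" using G by auto
  show "integrable lborel (\<lambda>x. f (x + s) - f x - G x \<bullet> s)"
    using f integrable_translate[OF f, of s] Gs by auto
  fix \<psi> :: "real^'n \<Rightarrow> real" assume \<psi>: "C1_c (ball x0 r) \<psi>" and \<psi>1: "\<And>x. \<bar>\<psi> x\<bar> \<le> 1"
  have [measurable]: "f \<in> borel_measurable borel" "G \<in> borel_measurable borel" "\<psi> \<in> borel_measurable borel"
    using f G C1_c_borel_measurable[OF \<psi>] by auto
  define F where "F = (\<lambda>t. \<integral>x. f x * \<psi> (x - t *\<^sub>R s) \<partial>lborel)"
  have tr: "C1_c (ball x0 R) (\<lambda>x. \<psi> (x - t *\<^sub>R s))"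
    "frechet_derivative (\<lambda>x. \<psi> (x - t *\<^sub>R s)) (at x) = frechet_derivative \<psi> (at (x - t *\<^sub>R s))"
    if "0 \<le> t" "t \<le> 1" for t x
  proof -
    have b: "y \<in> ball x0 R" if "y - t *\<^sub>R s \<in> ball x0 r" for y
    proof -
      have "norm (y - x0) \<le> norm (y - t *\<^sub>R s - x0) + norm (t *\<^sub>R s)"
        using norm_triangle_ineq[of "y - t *\<^sub>R s - x0" "t *\<^sub>R s"] by simp
      also have "norm (t *\<^sub>R s) \<le> norm s" using \<open>0 \<le> t\<close> \<open>t \<le> 1\<close> by (simp add: mult_left_le_one_le)
      finally show ?thesis using that r by (simp add: dist_norm norm_minus_commute)
    qed
    show "C1_c (ball x0 R) (\<lambda>x. \<psi> (x - t *\<^sub>R s))" by (rule C1_c_translate(1)[OF \<psi> b])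
    show "frechet_derivative (\<lambda>x. \<psi> (x - t *\<^sub>R s)) (at x) = frechet_derivative \<psi> (at (x - t *\<^sub>R s))"
      by (rule C1_c_translate(2)[OF \<psi> b])
  qed
  have D: "(F has_real_derivative (\<integral>x. (G (x + t *\<^sub>R s) \<bullet> s) * \<psi> x \<partial>lborel)) (at t)" if t: "0 \<le> t" "t \<le> 1" for t
  proof -
    have "- (\<integral>x. f x * frechet_derivative \<psi> (at (x - t *\<^sub>R s)) s \<partial>lborel) = (\<integral>x. (G x \<bullet> s) * \<psi> (x - t *\<^sub>R s) \<partial>lborel)"
      using weak_gradient_inner[OF f G w tr(1)[OF t], of s] by (simp add: tr(2)[OF t])
    also have "\<dots> = (\<integral>x. (G (x + t *\<^sub>R s) \<bullet> s) * \<psi> (x + t *\<^sub>R s - t *\<^sub>R s) \<partial>lborel)"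
      by (rule lborel_integral_translate(1)[symmetric]) measurable
    finally show ?thesis using has_real_derivative_integral_translate[OF f \<psi>, of s t] by (simp add: F_def)
  qed
  \<comment> \<open>The mean value point depends on \<psi>; this is harmless because \<omega> bounds
    the increments of G for all t in [0,1].\<close>
  obtain \<tau> where \<tau>: "0 < \<tau>" "\<tau> < 1" "F 1 - F 0 = (\<integral>x. (G (x + \<tau> *\<^sub>R s) \<bullet> s) * \<psi> x \<partial>lborel)"
    using MVT2[of 0 1 F "\<lambda>t. \<integral>x. (G (x + t *\<^sub>R s) \<bullet> s) * \<psi> x \<partial>lborel"] D by auto
  have i1: "integrable lborel (\<lambda>x. f (x + s) * \<psi> x)" by (rule integrable_mult_C1_c[OF integrable_translate[OF f] \<psi>])
  have i2: "integrable lborel (\<lambda>x. f x * \<psi> x)" by (rule integrable_mult_C1_c[OF f \<psi>])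
  have i3: "integrable lborel (\<lambda>x. (G x \<bullet> s) * \<psi> x)" by (rule integrable_mult_C1_c[OF Gs \<psi>])
  have G\<tau>: "integrable lborel (\<lambda>x. G (x + \<tau> *\<^sub>R s) \<bullet> s)"
    using integrable_translate[OF G, of "\<tau> *\<^sub>R s"] by auto
  have i4: "integrable lborel (\<lambda>x. (G (x + \<tau> *\<^sub>R s) \<bullet> s) * \<psi> x)" by (rule integrable_mult_C1_c[OF G\<tau> \<psi>])
  have "F 1 = (\<integral>x. f (x + s) * \<psi> (x + s - 1 *\<^sub>R s) \<partial>lborel)"
    unfolding F_def by (rule lborel_integral_translate(1)[symmetric]) measurable
  then have F1: "F 1 = (\<integral>x. f (x + s) * \<psi> x \<partial>lborel)" by simp
  have F0: "F 0 = (\<integral>x. f x * \<psi> x \<partial>lborel)" by (simp add: F_def)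
  have "(\<integral>x. (f (x + s) - f x - G x \<bullet> s) * \<psi> x \<partial>lborel)
     = (\<integral>x. f (x + s) * \<psi> x \<partial>lborel) - (\<integral>x. f x * \<psi> x \<partial>lborel) - (\<integral>x. (G x \<bullet> s) * \<psi> x \<partial>lborel)"
    using i1 i2 i3 by (simp add: left_diff_distrib)
  also have "\<dots> = (\<integral>x. (G (x + \<tau> *\<^sub>R s) \<bullet> s) * \<psi> x \<partial>lborel) - (\<integral>x. (G x \<bullet> s) * \<psi> x \<partial>lborel)"
    using \<tau>(3) F0 F1 by simp
  also have "\<dots> = (\<integral>x. ((G (x + \<tau> *\<^sub>R s) - G x) \<bullet> s) * \<psi> x \<partial>lborel)"
    using i3 i4 by (simp add: inner_diff_left left_diff_distrib)
  also have "\<dots> \<le> (\<integral>x. norm s * norm (G (x + \<tau> *\<^sub>R s) - G x) \<partial>lborel)"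
  proof (rule integral_mono)
    show "integrable lborel (\<lambda>x. ((G (x + \<tau> *\<^sub>R s) - G x) \<bullet> s) * \<psi> x)"
      using i3 i4 by (simp add: inner_diff_left left_diff_distrib)
    show "integrable lborel (\<lambda>x. norm s * norm (G (x + \<tau> *\<^sub>R s) - G x))"
      using integrable_translate[OF G] G by auto
    show "((G (x + \<tau> *\<^sub>R s) - G x) \<bullet> s) * \<psi> x \<le> norm s * norm (G (x + \<tau> *\<^sub>R s) - G x)" for x
    proof -
      have "((G (x + \<tau> *\<^sub>R s) - G x) \<bullet> s) * \<psi> x \<le> \<bar>(G (x + \<tau> *\<^sub>R s) - G x) \<bullet> s\<bar> * \<bar>\<psi> x\<bar>"
        by (metis abs_ge_self abs_mult)
      also have "\<dots> \<le> (norm (G (x + \<tau> *\<^sub>R s) - G x) * norm s) * 1"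
        by (intro mult_mono Cauchy_Schwarz_ineq2 \<psi>1) auto
      finally show ?thesis by (simp add: mult.commute)
    qed
  qed
  also have "\<dots> \<le> norm s * \<omega>"
    using \<omega>[of \<tau>] \<tau> by (simp add: mult_left_mono)
  finally show "(\<integral>x. (f (x + s) - f x - G x \<bullet> s) * \<psi> x \<partial>lborel) \<le> norm s * \<omega>" .
qed (use r in auto)

section \<open>Averages over small balls\<close>

declare borel_open[OF open_ball, measurable]

text \<open>Tonelli: for a fixed shift \<open>h *\<^sub>R y\<close> the integral over x is at most
  \<omega>, and y then runs over the unit ball.\<close>

lemma nn_integral_average_le:
  fixes \<Phi> :: "'a::euclidean_space \<Rightarrow> 'a \<Rightarrow> real"
  assumes m: "(\<lambda>(x, s). \<Phi> s x) \<in> borel_measurable (borel \<Otimes>\<^sub>M borel)" and U: "U \<in> sets borel" and h: "h > 0"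
    and nn: "\<And>s x. \<Phi> s x \<ge> 0"
    and int: "\<And>s. norm s \<le> h \<Longrightarrow> integrable lborel (\<lambda>x. indicator U x * \<Phi> s x)"
    and le: "\<And>s. norm s \<le> h \<Longrightarrow> (\<integral>x. indicator U x * \<Phi> s x \<partial>lborel) \<le> \<omega>"
  shows "(\<integral>\<^sup>+x. (\<integral>\<^sup>+y. ennreal (\<Phi> (h *\<^sub>R y) x) * indicator (ball 0 1) y \<partial>lborel) * indicator U x \<partial>lborel)
    \<le> ennreal \<omega> * emeasure lborel (ball (0::'a) 1)"
proof -
  have [measurable]: "U \<in> sets borel" "ball (0::'a) 1 \<in> sets borel" using U by auto
  have [measurable]: "(\<lambda>p. \<Phi> (h *\<^sub>R snd p) (fst p)) \<in> borel_measurable (borel \<Otimes>\<^sub>M borel)"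
  proof -
    have "(\<lambda>p::'a\<times>'a. (fst p, h *\<^sub>R snd p)) \<in> borel \<Otimes>\<^sub>M borel \<rightarrow>\<^sub>M borel \<Otimes>\<^sub>M borel" by measurable
    from measurable_compose[OF this m] show ?thesis by simp
  qed
  have [measurable]: "(\<lambda>y. \<Phi> (h *\<^sub>R y) x) \<in> borel_measurable borel" for x
  proof -
    have "(\<lambda>y::'a. (x, h *\<^sub>R y)) \<in> borel \<rightarrow>\<^sub>M borel \<Otimes>\<^sub>M borel" by measurable
    from measurable_compose[OF this m] show ?thesis by simp
  qed
  have "(\<integral>\<^sup>+x. (\<integral>\<^sup>+y. ennreal (\<Phi> (h *\<^sub>R y) x) * indicator (ball 0 1) y \<partial>lborel) * indicator U x \<partial>lborel)
    = (\<integral>\<^sup>+x. (\<integral>\<^sup>+y. ennreal (\<Phi> (h *\<^sub>R y) x) * indicator (ball 0 1) y * indicator U x \<partial>lborel) \<partial>lborel)"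
    by (intro nn_integral_cong nn_integral_multc[symmetric]) measurable
  also have "\<dots> = (\<integral>\<^sup>+y. (\<integral>\<^sup>+x. ennreal (\<Phi> (h *\<^sub>R y) x) * indicator (ball 0 1) y * indicator U x \<partial>lborel) \<partial>lborel)"
    by (rule lborel_pair.Fubini'[symmetric]) measurable
  also have "\<dots> \<le> (\<integral>\<^sup>+y. ennreal \<omega> * indicator (ball (0::'a) 1) y \<partial>lborel)"
  proof (rule nn_integral_mono)
    fix y :: 'a
    show "(\<integral>\<^sup>+x. ennreal (\<Phi> (h *\<^sub>R y) x) * indicator (ball 0 1) y * indicator U x \<partial>lborel) \<le> ennreal \<omega> * indicator (ball 0 1) y"
    proof (cases "y \<in> ball 0 1")
      case True
      then have s: "norm (h *\<^sub>R y) \<le> h" using h by (simp add: mult_left_le)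
      have "(\<integral>\<^sup>+x. ennreal (\<Phi> (h *\<^sub>R y) x) * indicator (ball 0 1) y * indicator U x \<partial>lborel)
         = (\<integral>\<^sup>+x. ennreal (indicator U x * \<Phi> (h *\<^sub>R y) x) \<partial>lborel)"
        using True by (intro nn_integral_cong) (auto simp: indicator_def)
      also have "\<dots> = ennreal (\<integral>x. indicator U x * \<Phi> (h *\<^sub>R y) x \<partial>lborel)"
        by (rule nn_integral_eq_integral[OF int[OF s]]) (simp add: nn)
      also have "\<dots> \<le> ennreal \<omega>" by (rule ennreal_leI[OF le[OF s]])
      finally show ?thesis using True by simp
    qed simp
  qed
  also have "\<dots> = ennreal \<omega> * emeasure lborel (ball (0::'a) 1)" by (simp add: nn_integral_cmult)
  finally show ?thesis .
qed

text \<open>Up to the constant volume of the unit ball this is the mean of the Taylor remainder over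
  the ball of radius h at x, divided by h. As an \<open>ennreal\<close> it is meaningful at every x,
  with no integrability to check.\<close>

definition taylor_err :: "real \<Rightarrow> (real^'n \<Rightarrow> real) \<Rightarrow> (real^'n \<Rightarrow> real^'n) \<Rightarrow> real^'n \<Rightarrow> ennreal" where
  "taylor_err h f G x =
     (\<integral>\<^sup>+y. ennreal (\<bar>f (x + h *\<^sub>R y) - f x - G x \<bullet> (h *\<^sub>R y)\<bar> / h) * indicator (ball 0 1) y \<partial>lborel)"

text \<open>Applied to the squares of the coordinates, for the part of the stationarity equation
  that is quadratic in the gradient.\<close>

definition osc :: "real \<Rightarrow> (real^'n \<Rightarrow> real) \<Rightarrow> real^'n \<Rightarrow> ennreal" where
  "osc h q x = (\<integral>\<^sup>+y. ennreal \<bar>q (x + h *\<^sub>R y) - q x\<bar> * indicator (ball 0 1) y \<partial>lborel)"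

lemma borel_measurable_taylor_err:
  assumes [measurable]: "f \<in> borel_measurable borel" "G \<in> borel_measurable borel"
  shows "taylor_err h f G \<in> borel_measurable borel"
  unfolding taylor_err_def[abs_def] by measurable

lemma borel_measurable_osc:
  assumes [measurable]: "q \<in> borel_measurable borel"
  shows "osc h q \<in> borel_measurable borel"
  unfolding osc_def[abs_def] by measurable

lemma nn_integral_taylor_err_le:
  fixes f :: "real^'n \<Rightarrow> real"
  assumes f: "integrable lborel f" and G: "integrable lborel G" and w: "weak_gradient (ball x0 R) f G"
    and r: "0 < r" "0 < h" "h \<le> R - r" and \<omega>0: "\<omega> \<ge> 0"
    and \<omega>: "\<And>s. norm s \<le> h \<Longrightarrow> (\<integral>x. norm (G (x + s) - G x) \<partial>lborel) \<le> \<omega>"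
  shows "(\<integral>\<^sup>+x. taylor_err h f G x * indicator (ball x0 r) x \<partial>lborel) \<le> ennreal \<omega> * emeasure lborel (ball (0::real^'n) 1)"
proof -
  have [measurable]: "f \<in> borel_measurable borel" "G \<in> borel_measurable borel" using f G by auto
  show ?thesis
    unfolding taylor_err_def
  proof (rule nn_integral_average_le[where \<Phi> = "\<lambda>s x. \<bar>f (x + s) - f x - G x \<bullet> s\<bar> / h"])
    fix s :: "real^'n" assume s: "norm s \<le> h"
    have i: "integrable lborel (\<lambda>x. \<bar>f (x + s) - f x - G x \<bullet> s\<bar> / h)"
      using f integrable_translate[OF f, of s] G by auto
    have "integrable lborel (\<lambda>x. (\<bar>f (x + s) - f x - G x \<bullet> s\<bar> / h) * indicator (ball x0 r) x)"
      by (rule integrable_real_mult_indicator[OF _ i]) auto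
    then show "integrable lborel (\<lambda>x. indicator (ball x0 r) x * (\<bar>f (x + s) - f x - G x \<bullet> s\<bar> / h))"
      by (simp only: mult.commute)
    have "(\<integral>x. indicator (ball x0 r) x * \<bar>f (x + s) - f x - G x \<bullet> s\<bar> \<partial>lborel) \<le> norm s * \<omega>"
    proof (rule weak_gradient_taylor[OF f G w r(1)])
      fix t :: real assume t: "0 \<le> t" "t \<le> 1"
      then have "norm (t *\<^sub>R s) \<le> norm s" by (simp add: mult_left_le_one_le)
      then show "(\<integral>x. norm (G (x + t *\<^sub>R s) - G x) \<partial>lborel) \<le> \<omega>" using s by (intro \<omega>) auto
    qed (use s r in auto)
    \<comment> \<open>The length of the shift is at most h, which cancels the division by h in
      \<open>taylor_err\<close>.\<close>
    also have "\<dots> \<le> h * \<omega>" using s \<omega>0 by (rule mult_right_mono)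
    finally show "(\<integral>x. indicator (ball x0 r) x * (\<bar>f (x + s) - f x - G x \<bullet> s\<bar> / h) \<partial>lborel) \<le> \<omega>"
      using r by (simp add: field_simps)
  qed (use r in auto)
qed

lemma nn_integral_osc_le:
  fixes q :: "real^'n \<Rightarrow> real"
  assumes q: "integrable lborel q" and r: "0 < h"
    and \<omega>: "\<And>s. norm s \<le> h \<Longrightarrow> (\<integral>x. norm (q (x + s) - q x) \<partial>lborel) \<le> \<omega>"
  shows "(\<integral>\<^sup>+x. osc h q x * indicator (ball x0 r) x \<partial>lborel) \<le> ennreal \<omega> * emeasure lborel (ball (0::real^'n) 1)"
proof -
  have [measurable]: "q \<in> borel_measurable borel" using q by auto
  have [measurable]: "ball x0 r \<in> sets borel" by auto
  show ?thesis
    unfolding osc_def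
  proof (rule nn_integral_average_le[where \<Phi> = "\<lambda>s x. \<bar>q (x + s) - q x\<bar>"])
    fix s :: "real^'n" assume s: "norm s \<le> h"
    have i: "integrable lborel (\<lambda>x. \<bar>q (x + s) - q x\<bar>)"
      using q integrable_translate[OF q, of s] by auto
    have "integrable lborel (\<lambda>x. \<bar>q (x + s) - q x\<bar> * indicator (ball x0 r) x)"
      by (rule integrable_real_mult_indicator[OF _ i]) auto
    then show i2: "integrable lborel (\<lambda>x. indicator (ball x0 r) x * \<bar>q (x + s) - q x\<bar>)"
      by (simp only: mult.commute)
    have "(\<integral>x. indicator (ball x0 r) x * \<bar>q (x + s) - q x\<bar> \<partial>lborel) \<le> (\<integral>x. \<bar>q (x + s) - q x\<bar> \<partial>lborel)"
      by (rule integral_mono[OF i2 i]) (auto simp: indicator_def)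
    then show "(\<integral>x. indicator (ball x0 r) x * \<bar>q (x + s) - q x\<bar> \<partial>lborel) \<le> \<omega>" using \<omega>[OF s] by simp
  qed (use r in auto)
qed

lemma suminf_ennreal_tendsto_0:
  fixes e :: "nat \<Rightarrow> ennreal"
  assumes "(\<Sum>k. e k) \<noteq> \<infinity>"
  shows "e \<longlonglongrightarrow> 0"
proof -
  have fin: "e k < top" for k
    using assms ennreal_suminf_lessD[of e top k] by (simp add: less_top)
  then have e: "e k = ennreal (enn2real (e k))" for k by simp
  have "summable (\<lambda>k. enn2real (e k))"
    by (rule summable_suminf_not_top) (use assms e in auto)
  then have "(\<lambda>k. ennreal (enn2real (e k))) \<longlonglongrightarrow> ennreal 0"
    by (intro tendsto_ennrealI summable_LIMSEQ_zero)
  then show ?thesis using e by simp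
qed

text \<open>Put as an eventuality in h, so that finitely many functions can be given a common
  scale.\<close>

lemma L1_translate_uniform:
  fixes f :: "'a::euclidean_space \<Rightarrow> 'b::{banach, second_countable_topology}"
  assumes "integrable lborel f" "\<delta> > 0"
  shows "\<forall>\<^sub>F h in at_right 0. \<forall>s. norm s \<le> h \<longrightarrow> (\<integral>x. norm (f (x + s) - f x) \<partial>lborel) \<le> \<delta>"
proof -
  have "\<forall>\<^sub>F s in at 0. (\<integral>x. norm (f (x + s) - f x) \<partial>lborel) < \<delta>"
    using order_tendstoD(2)[OF L1_translate_continuous[OF assms(1)] assms(2)] .
  then obtain d where d: "d > 0" "\<And>s. s \<noteq> 0 \<Longrightarrow> norm s < d \<Longrightarrow> (\<integral>x. norm (f (x + s) - f x) \<partial>lborel) < \<delta>"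
    by (auto simp: eventually_at)
  have "(\<integral>x. norm (f (x + s) - f x) \<partial>lborel) \<le> \<delta>" if "norm s < d" for s
    using d(2)[of s] that assms(2) by (cases "s = 0") auto
  then show ?thesis
    unfolding eventually_at_right_field using d(1) by (intro exI[of _ d]) auto
qed

text \<open>One sequence of scales serves finitely many Sobolev functions at once. Choosing it so that the
  mean errors are summable yields both the pointwise convergence and the integrable majorant E.\<close>

lemma taylor_sequence:
  fixes f :: "'i \<Rightarrow> real^'n \<Rightarrow> real"
  assumes I: "finite I" and r: "0 < r" "r < R"
    and f: "\<And>i. i \<in> I \<Longrightarrow> integrable lborel (f i)" and f2: "\<And>i. i \<in> I \<Longrightarrow> integrable lborel (\<lambda>x. (f i x)\<^sup>2)"
    and G: "\<And>i. i \<in> I \<Longrightarrow> integrable lborel (G i)" and w: "\<And>i. i \<in> I \<Longrightarrow> weak_gradient (ball x0 R) (f i) (G i)"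
  obtains h :: "nat \<Rightarrow> real" and E where "\<And>k. 0 < h k" "h \<longlonglongrightarrow> 0" "E \<in> borel_measurable borel"
    "(\<integral>\<^sup>+x. E x * indicator (ball x0 r) x \<partial>lborel) < \<infinity>"
    "\<And>i k x. i \<in> I \<Longrightarrow> taylor_err (h k) (f i) (G i) x \<le> E x"
    "AE x in lborel. x \<in> ball x0 r \<longrightarrow> (\<forall>i\<in>I. (\<lambda>k. taylor_err (h k) (f i) (G i) x) \<longlonglongrightarrow> 0
        \<and> (\<lambda>k. osc (h k) (\<lambda>x. (f i x)\<^sup>2) x) \<longlonglongrightarrow> 0)"
proof -
  define \<beta> where "\<beta> = emeasure lborel (ball (0::real^'n) 1)"
  have \<beta>: "\<beta> < \<infinity>" unfolding \<beta>_def using emeasure_bounded_finite[OF bounded_ball] by auto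
  define M where "M = enn2real \<beta> + 1"
  have M: "\<beta> \<le> ennreal M" "M > 0"
  proof -
    have "\<beta> = ennreal (enn2real \<beta>)" using \<beta> by simp
    also have "\<dots> \<le> ennreal M" unfolding M_def by (rule ennreal_leI) simp
    finally show "\<beta> \<le> ennreal M" .
    show "M > 0" unfolding M_def by (simp add: add_nonneg_pos)
  qed
  \<comment> \<open>Each index contributes two errors of at most \<open>\<delta> k * M\<close>; this
    choice makes their total at most \<open>(1/2)^k\<close>. The summand 1 covers the empty index
    set.\<close>
  define \<delta> where "\<delta> = (\<lambda>k. (1/2)^k / (M * 2 * (real (card I) + 1)))"
  have \<delta>: "\<delta> k > 0" for k using M by (simp add: \<delta>_def add_nonneg_pos)
  define e where "e = (\<lambda>h x. \<Sum>i\<in>I. taylor_err h (f i) (G i) x + osc h (\<lambda>x. (f i x)\<^sup>2) x)"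
  have meas[measurable]: "f i \<in> borel_measurable borel" "G i \<in> borel_measurable borel"
    "taylor_err h (f i) (G i) \<in> borel_measurable borel" "osc h (\<lambda>x. (f i x)\<^sup>2) \<in> borel_measurable borel" if "i \<in> I" for i h
    using f[OF that] f2[OF that] G[OF that] by (auto intro!: borel_measurable_taylor_err borel_measurable_osc)
  have em[measurable]: "e h \<in> borel_measurable borel" for h unfolding e_def by measurable
  have [measurable]: "ball x0 r \<in> sets borel" by simp
  \<comment> \<open>The bound \<open>1 / real (Suc k)\<close> forces the scales to tend to
    0.\<close>
  have ex: "\<exists>h. 0 < h \<and> h < 1 / real (Suc k) \<and> (\<integral>\<^sup>+x. e h x * indicator (ball x0 r) x \<partial>lborel) \<le> ennreal ((1/2)^k)" for k
  proof -
    have "\<forall>\<^sub>F h in at_right 0. \<forall>i\<in>I. \<forall>s. norm s \<le> h \<longrightarrow> (\<integral>x. norm (G i (x + s) - G i x) \<partial>lborel) \<le> \<delta> k"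
      by (intro eventually_ball_finite I ballI L1_translate_uniform G \<delta>)
    moreover have "\<forall>\<^sub>F h in at_right 0. \<forall>i\<in>I. \<forall>s. norm s \<le> h \<longrightarrow> (\<integral>x. norm ((f i (x + s))\<^sup>2 - (f i x)\<^sup>2) \<partial>lborel) \<le> \<delta> k"
      by (intro eventually_ball_finite I ballI L1_translate_uniform f2 \<delta>)
    moreover have "\<forall>\<^sub>F h in at_right 0. 0 < h \<and> h < min (R - r) (1 / real (Suc k))"
      using r by (intro eventually_conj eventually_at_right_less eventually_at_rightI[of 0 "min (R - r) (1 / real (Suc k))"]) auto
    ultimately have "\<forall>\<^sub>F h in at_right 0. 0 < h \<and> h < 1 / real (Suc k) \<and> (\<integral>\<^sup>+x. e h x * indicator (ball x0 r) x \<partial>lborel) \<le> ennreal ((1/2)^k)"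
    proof eventually_elim
      case (elim h)
      have "(\<integral>\<^sup>+x. e h x * indicator (ball x0 r) x \<partial>lborel)
        = (\<integral>\<^sup>+x. (\<Sum>i\<in>I. taylor_err h (f i) (G i) x * indicator (ball x0 r) x + osc h (\<lambda>x. (f i x)\<^sup>2) x * indicator (ball x0 r) x) \<partial>lborel)"
        unfolding e_def by (simp add: sum_distrib_right distrib_right)
      also have "\<dots> = (\<Sum>i\<in>I. (\<integral>\<^sup>+x. taylor_err h (f i) (G i) x * indicator (ball x0 r) x \<partial>lborel) + (\<integral>\<^sup>+x. osc h (\<lambda>x. (f i x)\<^sup>2) x * indicator (ball x0 r) x \<partial>lborel))"
        by (subst nn_integral_sum) (auto intro!: sum.cong nn_integral_add)
      also have "\<dots> \<le> (\<Sum>i\<in>I. ennreal (\<delta> k) * ennreal M + ennreal (\<delta> k) * ennreal M)"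
      proof (intro sum_mono add_mono)
        fix i assume i: "i \<in> I"
        have "(\<integral>\<^sup>+x. taylor_err h (f i) (G i) x * indicator (ball x0 r) x \<partial>lborel) \<le> ennreal (\<delta> k) * \<beta>"
          unfolding \<beta>_def by (rule nn_integral_taylor_err_le[OF f[OF i] G[OF i] w[OF i] r(1)]) (use elim i \<delta>[of k] in auto)
        also have "\<dots> \<le> ennreal (\<delta> k) * ennreal M" by (intro mult_left_mono M) auto
        finally show "(\<integral>\<^sup>+x. taylor_err h (f i) (G i) x * indicator (ball x0 r) x \<partial>lborel) \<le> ennreal (\<delta> k) * ennreal M" .
        have "(\<integral>\<^sup>+x. osc h (\<lambda>x. (f i x)\<^sup>2) x * indicator (ball x0 r) x \<partial>lborel) \<le> ennreal (\<delta> k) * \<beta>"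
          unfolding \<beta>_def by (rule nn_integral_osc_le[OF f2[OF i]]) (use elim i in auto)
        also have "\<dots> \<le> ennreal (\<delta> k) * ennreal M" by (intro mult_left_mono M) auto
        finally show "(\<integral>\<^sup>+x. osc h (\<lambda>x. (f i x)\<^sup>2) x * indicator (ball x0 r) x \<partial>lborel) \<le> ennreal (\<delta> k) * ennreal M" .
      qed
      also have "\<dots> = ennreal (real (card I) * (\<delta> k * M + \<delta> k * M))"
        using \<delta>[of k] M by (simp add: ennreal_mult ennreal_of_nat_eq_real_of_nat flip: ennreal_plus ennreal_mult)
      also have "\<dots> \<le> ennreal ((1/2)^k)"
      proof (rule ennreal_leI)
        have "real (card I) * (\<delta> k * M + \<delta> k * M) = (1/2)^k * (real (card I) / (real (card I) + 1))"
        proof -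
          have "a * (b / (M * 2 * c) * M + b / (M * 2 * c) * M) = b * (a / c)" if "c > 0" for a b c :: real
            using M that by (simp add: field_simps)
          then show ?thesis unfolding \<delta>_def by (simp add: add_nonneg_pos)
        qed
        also have "\<dots> \<le> (1/2)^k * 1" by (intro mult_left_mono) (auto simp: field_simps)
        finally show "real (card I) * (\<delta> k * M + \<delta> k * M) \<le> (1/2)^k" by simp
      qed
      finally show ?case using elim by auto
    qed
    then show ?thesis using eventually_happens by force
  qed
  then obtain h where h: "\<And>k. 0 < h k" "\<And>k. h k < 1 / real (Suc k)"
    "\<And>k. (\<integral>\<^sup>+x. e (h k) x * indicator (ball x0 r) x \<partial>lborel) \<le> ennreal ((1/2)^k)" by metis
  define E where "E = (\<lambda>x. \<Sum>k. e (h k) x)"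
  have Em[measurable]: "E \<in> borel_measurable borel" unfolding E_def by measurable
  have "(\<integral>\<^sup>+x. E x * indicator (ball x0 r) x \<partial>lborel) = (\<integral>\<^sup>+x. (\<Sum>k. e (h k) x * indicator (ball x0 r) x) \<partial>lborel)"
    unfolding E_def by simp
  also have "\<dots> = (\<Sum>k. \<integral>\<^sup>+x. e (h k) x * indicator (ball x0 r) x \<partial>lborel)"
    by (rule nn_integral_suminf) measurable
  also have "\<dots> \<le> (\<Sum>k. ennreal ((1/2)^k))" by (intro suminf_le h) auto
  also have "\<dots> < \<infinity>" unfolding infinity_ennreal_def less_top[symmetric]
    by (rule ennreal_suminf_neq_top) (auto intro: summable_geometric)
  finally have Ef: "(\<integral>\<^sup>+x. E x * indicator (ball x0 r) x \<partial>lborel) < \<infinity>" .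
  have le: "taylor_err (h k) (f i) (G i) x \<le> e (h k) x" "osc (h k) (\<lambda>x. (f i x)\<^sup>2) x \<le> e (h k) x" if "i \<in> I" for i k x
    unfolding e_def by (rule order_trans[OF _ member_le_sum[OF that]]; use I in auto)+
  show ?thesis
  proof (rule that[OF h(1) _ Em Ef])
    show "h \<longlonglongrightarrow> 0"
    proof (rule Lim_null_comparison)
      show "\<forall>\<^sub>F k in sequentially. norm (h k) \<le> 1 / real (Suc k)"
        using h(1,2) by (auto simp: less_imp_le)
      show "(\<lambda>k. 1 / real (Suc k)) \<longlonglongrightarrow> 0" using LIMSEQ_inverse_real_of_nat by (simp add: inverse_eq_divide)
    qed
    show "taylor_err (h k) (f i) (G i) x \<le> E x" if "i \<in> I" for i k x
    proof -
      have "e (h k) x \<le> E x" unfolding E_def using sum_le_suminf[of "\<lambda>k. e (h k) x" "{k}"] by auto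
      then show ?thesis using le(1)[OF that] order_trans by blast
    qed
    have "AE x in lborel. E x * indicator (ball x0 r) x \<noteq> \<infinity>"
      by (rule nn_integral_PInf_AE) (use Ef in auto)
    then show "AE x in lborel. x \<in> ball x0 r \<longrightarrow> (\<forall>i\<in>I. (\<lambda>k. taylor_err (h k) (f i) (G i) x) \<longlonglongrightarrow> 0
        \<and> (\<lambda>k. osc (h k) (\<lambda>x. (f i x)\<^sup>2) x) \<longlonglongrightarrow> 0)"
    proof eventually_elim
      case (elim x)
      show ?case
      proof (intro impI ballI)
        fix i assume x: "x \<in> ball x0 r" and i: "i \<in> I"
        have "E x \<noteq> \<infinity>" using elim x by auto
        then have z: "(\<lambda>k. e (h k) x) \<longlonglongrightarrow> 0" unfolding E_def by (rule suminf_ennreal_tendsto_0)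
        show "(\<lambda>k. taylor_err (h k) (f i) (G i) x) \<longlonglongrightarrow> 0 \<and> (\<lambda>k. osc (h k) (\<lambda>x. (f i x)\<^sup>2) x) \<longlonglongrightarrow> 0"
          using le[OF i] by (intro conjI tendsto_sandwich[OF _ _ tendsto_const z]) auto
      qed
    qed
  qed
qed

section \<open>Approximate derivatives and mollification\<close>

lemma measurable_ident_lebesgue: "(\<lambda>x. x) \<in> borel_measurable lebesgue"
  by (rule measurable_completion) simp

text \<open>Both sides carry the completed \<sigma>-algebra, so null sets have to be pulled back to
  null sets; this is where \<open>h\<close> must be nonzero.\<close>

lemma measurable_affine_lebesgue:
  fixes x :: "'a::euclidean_space"
  assumes "h \<noteq> 0"
  shows "(\<lambda>y. x + h *\<^sub>R y) \<in> lebesgue \<rightarrow>\<^sub>M lebesgue"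
proof -
  have "(\<lambda>y. x + (\<Sum>j\<in>Basis. (h * (y \<bullet> j)) *\<^sub>R j)) = (\<lambda>y::'a. x + h *\<^sub>R y)"
    unfolding scaleR_scaleR[symmetric] scaleR_sum_right[symmetric] euclidean_representation ..
  then show ?thesis using lebesgue_affine_measurable[of "\<lambda>_. h" x] assms by simp
qed

lemma lebesgue_affine_density:
  fixes x :: "'a::euclidean_space"
  assumes "h \<noteq> 0"
  shows "lebesgue = density (distr lebesgue lebesgue (\<lambda>y. x + h *\<^sub>R y)) (\<lambda>_. ennreal (\<bar>h\<bar> ^ DIM('a)))"
proof -
  have "(\<lambda>y. x + (\<Sum>j\<in>Basis. (h * (y \<bullet> j)) *\<^sub>R j)) = (\<lambda>y::'a. x + h *\<^sub>R y)"
    unfolding scaleR_scaleR[symmetric] scaleR_sum_right[symmetric] euclidean_representation ..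
  then show ?thesis using lebesgue_affine_euclidean[of "\<lambda>_. h" x] assms by (simp add: prod_constant)
qed

lemma AE_affine_lebesgue:
  fixes x :: "'a::euclidean_space"
  assumes "h \<noteq> 0" "AE z in lebesgue. P z"
  shows "AE y in lebesgue. P (x + h *\<^sub>R y)"
proof -
  note m = measurable_affine_lebesgue[OF assms(1), of x]
  obtain N where N: "N \<in> null_sets lebesgue" "\<And>z. z \<notin> N \<Longrightarrow> P z"
    using assms(2) by (auto simp: eventually_ae_filter)
  have "AE z in density (distr lebesgue lebesgue (\<lambda>y. x + h *\<^sub>R y)) (\<lambda>_. ennreal (\<bar>h\<bar> ^ DIM('a))). z \<notin> N"
    by (subst lebesgue_affine_density[OF assms(1), of x, symmetric]) (rule AE_not_in[OF N(1)])
  then have "AE z in distr lebesgue lebesgue (\<lambda>y. x + h *\<^sub>R y). z \<notin> N"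
    using assms(1) by (subst (asm) AE_density) auto
  then have "AE y in lebesgue. x + h *\<^sub>R y \<notin> N"
  proof (subst (asm) AE_distr_iff[OF m])
    show "{z \<in> space lebesgue. z \<notin> N} \<in> sets lebesgue"
      using sets.compl_sets[OF null_setsD2[OF N(1)]] by (simp add: Compl_eq_Diff_UNIV[symmetric] Compl_eq)
  qed
  then show ?thesis by eventually_elim (rule N(2))
qed

text \<open>Measurability of F is enough: if F is not integrable, neither is its rescaling, and both
  integrals are 0 by convention.\<close>

lemma integral_affine_lebesgue:
  fixes x :: "'a::euclidean_space" and F :: "'a \<Rightarrow> real"
  assumes "h \<noteq> 0" and F: "F \<in> borel_measurable lebesgue"
  shows "(\<integral>z. F z \<partial>lebesgue) = \<bar>h\<bar> ^ DIM('a) * (\<integral>y. F (x + h *\<^sub>R y) \<partial>lebesgue)"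
proof -
  note m = measurable_affine_lebesgue[OF assms(1), of x]
  have "(\<integral>z. F z \<partial>lebesgue) = (\<integral>z. F z \<partial>density (distr lebesgue lebesgue (\<lambda>y. x + h *\<^sub>R y)) (\<lambda>_. ennreal (\<bar>h\<bar> ^ DIM('a))))"
    using lebesgue_affine_density[OF assms(1), of x] by simp
  also have "\<dots> = (\<integral>z. \<bar>h\<bar> ^ DIM('a) *\<^sub>R F z \<partial>distr lebesgue lebesgue (\<lambda>y. x + h *\<^sub>R y))"
    by (rule integral_density) (use F in auto)
  also have "\<dots> = \<bar>h\<bar> ^ DIM('a) * (\<integral>y. F (x + h *\<^sub>R y) \<partial>lebesgue)"
    by (subst integral_distr[OF m]) (use F in auto)
  finally show ?thesis .
qed

lemma ennreal_tendsto_0I: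
  fixes N :: "nat \<Rightarrow> ennreal"
  assumes "\<And>\<epsilon>. \<epsilon> > 0 \<Longrightarrow> \<forall>\<^sub>F k in sequentially. N k \<le> ennreal \<epsilon>"
  shows "N \<longlonglongrightarrow> 0"
proof (rule order_tendstoI)
  fix a :: ennreal assume "0 < a"
  then obtain b where b: "0 < b" "b < a" using dense by blast
  then have "b = ennreal (enn2real b)" "enn2real b > 0"
    using order_less_trans[OF b(2)] by (auto simp: enn2real_positive_iff less_top le_less_trans top.not_eq_extremum)
      (metis b(2) ennreal_enn2real order_less_le_trans top_greatest)+
  then have "\<forall>\<^sub>F k in sequentially. N k \<le> b" using assms[of "enn2real b"] by simp
  then show "\<forall>\<^sub>F k in sequentially. N k < a" by eventually_elim (use b(2) in auto)
qed auto

text \<open>Blow-up at x: under \<open>\<lambda>y. x + h k *\<^sub>R y\<close> all volumes scale by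
  one common factor, so the rescaled complement of F has the volume of the unit ball times 1 minus
  the density quotient.\<close>

lemma density_one_emeasure:
  fixes x :: "'a::euclidean_space"
  assumes F: "density_one F x" and h: "\<And>k. 0 < h k" "h \<longlonglongrightarrow> 0"
  shows "(\<lambda>k. emeasure lebesgue {y \<in> ball 0 1. x + h k *\<^sub>R y \<notin> F}) \<longlonglongrightarrow> 0"
    and "{y \<in> ball 0 1. x + h k *\<^sub>R y \<notin> F} \<in> sets lebesgue"
proof -
  define B where "B = (\<lambda>k. {y \<in> ball 0 1. x + h k *\<^sub>R y \<notin> F})"
  have Fm: "F \<in> sets lebesgue" using F by (simp add: density_one_def)
  have im: "(\<lambda>y. h k *\<^sub>R y + x) ` B k = ball x (h k) - F" for k
  proof -
    have "z \<in> (\<lambda>y. h k *\<^sub>R y + x) ` B k" if "z \<in> ball x (h k) - F" for z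
    proof (rule image_eqI)
      show "z = h k *\<^sub>R ((1 / h k) *\<^sub>R (z - x)) + x" using h(1)[of k] by simp
      show "(1 / h k) *\<^sub>R (z - x) \<in> B k"
        using that h(1)[of k] by (auto simp: B_def dist_norm norm_minus_commute)
    qed
    moreover have "h k *\<^sub>R y + x \<in> ball x (h k) - F" if "y \<in> B k" for y
      using that h(1)[of k] by (auto simp: B_def dist_norm add.commute)
    ultimately show ?thesis by blast
  qed
  have Bm: "B k \<in> sets lebesgue" for k
  proof -
    have "B k = ball 0 1 \<inter> ((\<lambda>y. x + h k *\<^sub>R y) -` (- F) \<inter> space lebesgue)" by (auto simp: B_def)
    moreover have "(\<lambda>y. x + h k *\<^sub>R y) -` (- F) \<inter> space lebesgue \<in> sets lebesgue"
      using measurable_affine_lebesgue[of "h k" x] h(1)[of k] Fm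
      by (intro measurable_sets[where A = lebesgue]) (auto simp: Compl_in_sets_lebesgue)
    ultimately show ?thesis by (auto intro!: sets.Int)
  qed
  have fin: "emeasure lebesgue (ball x r - F) < \<infinity>" for r
    using emeasure_mono[of "ball x r - F" "ball x r" lebesgue] emeasure_bounded_finite[of "ball x r"]
    by (auto simp: less_top)
  have m1: "measure lebesgue (ball x r - F) = measure lebesgue (ball x r) - measure lebesgue (F \<inter> ball x r)" for r
  proof -
    have "ball x r - F = ball x r - (F \<inter> ball x r)" by auto
    moreover have "measure lebesgue (ball x r - (F \<inter> ball x r)) = measure lebesgue (ball x r) - measure lebesgue (F \<inter> ball x r)"
      by (rule measure_Diff) (use Fm emeasure_bounded_finite[of "ball x r"] in auto)
    ultimately show ?thesis by simp
  qed
  have pos: "measure lebesgue (ball x r) > 0" if "r > 0" for r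
    using that content_ball_pos[of r x] by simp
  have sc: "\<bar>h k\<bar> ^ DIM('a) * measure lebesgue (B k) = measure lebesgue (ball x (h k) - F)" for k
    using measure_lebesgue_affine[of "h k" x "B k"] im[of k] by simp
  have sc1: "\<bar>h k\<bar> ^ DIM('a) * measure lebesgue (ball (0::'a) 1) = measure lebesgue (ball x (h k))" for k
  proof -
    have "(\<lambda>y. h k *\<^sub>R y + x) ` ball 0 1 = (\<lambda>z. x + z) ` ((*\<^sub>R) (h k) ` ball 0 1)"
      by (simp only: image_image add.commute)
    also have "\<dots> = ball x (h k)"
    proof -
      have "(*\<^sub>R) (h k) ` ball (0::'a) 1 = ball 0 (h k)" using h(1)[of k] ball_scale[of "h k" 0 1] by simp
      then show ?thesis by (simp only: ball_translation[symmetric] add_0_right)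
    qed
    finally have "(\<lambda>y. h k *\<^sub>R y + x) ` ball 0 1 = ball x (h k)" .
    then show ?thesis using measure_lebesgue_affine[of "h k" x "ball 0 1"] by simp
  qed
  have eq: "measure lebesgue (B k) = measure lebesgue (ball (0::'a) 1) * (1 - measure lebesgue (F \<inter> ball x (h k)) / measure lebesgue (ball x (h k)))" for k
  proof -
    have p: "\<bar>h k\<bar> ^ DIM('a) > 0" using h(1)[of k] by simp
    have "\<bar>h k\<bar> ^ DIM('a) * measure lebesgue (B k) = measure lebesgue (ball x (h k)) * (1 - measure lebesgue (F \<inter> ball x (h k)) / measure lebesgue (ball x (h k)))"
    proof -
      have "a = c * (1 - b / c)" if "a = c - b" "c > 0" for a b c :: real
        using that by (simp add: right_diff_distrib)
      from this[OF _ pos[OF h(1)[of k]]] show ?thesis using sc[of k] m1[of "h k"] by simp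
    qed
    also have "\<dots> = \<bar>h k\<bar> ^ DIM('a) * (measure lebesgue (ball (0::'a) 1) * (1 - measure lebesgue (F \<inter> ball x (h k)) / measure lebesgue (ball x (h k))))"
      using sc1[of k] by simp
    finally show ?thesis using p by (simp only: mult_cancel_left) auto
  qed
  have "h k \<noteq> 0" for k using h(1)[of k] by simp
  then have hr: "filterlim h (at_right 0) sequentially" using h by (simp add: filterlim_at)
  have "((\<lambda>r. measure lebesgue (F \<inter> ball x r) / measure lebesgue (ball x r)) \<longlongrightarrow> 1) (at_right 0)"
    using F by (simp add: density_one_def)
  from filterlim_compose[OF this hr]
  have "(\<lambda>k. measure lebesgue (F \<inter> ball x (h k)) / measure lebesgue (ball x (h k))) \<longlonglongrightarrow> 1" .
  then have "(\<lambda>k. measure lebesgue (B k)) \<longlonglongrightarrow> measure lebesgue (ball (0::'a) 1) * (1 - 1)"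
    unfolding eq by (intro tendsto_intros)
  then have "(\<lambda>k. ennreal (measure lebesgue (B k))) \<longlonglongrightarrow> ennreal 0" by (intro tendsto_ennrealI) simp
  moreover have "ennreal (measure lebesgue (B k)) = emeasure lebesgue (B k)" for k
  proof -
    have "emeasure lebesgue (B k) \<le> emeasure lebesgue (ball (0::'a) 1)"
      by (rule emeasure_mono) (auto simp: B_def)
    then have "emeasure lebesgue (B k) < \<infinity>" using emeasure_bounded_finite[of "ball (0::'a) 1"] by (auto intro: le_less_trans)
    then show ?thesis by (simp add: emeasure_eq_ennreal_measure)
  qed
  ultimately show "(\<lambda>k. emeasure lebesgue {y \<in> ball 0 1. x + h k *\<^sub>R y \<notin> F}) \<longlonglongrightarrow> 0"
    by (simp add: B_def)
  show "{y \<in> ball 0 1. x + h k *\<^sub>R y \<notin> F} \<in> sets lebesgue" using Bm[of k] by (simp add: B_def)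
qed

section \<open>Convergence of difference quotients in the mean\<close>

definition approx_derivative :: "(real^'n \<Rightarrow> real) \<Rightarrow> real^'n \<Rightarrow> (real^'n \<Rightarrow> real) \<Rightarrow> bool" where
  "approx_derivative u x L \<longleftrightarrow> bounded_linear L \<and> (\<exists>F. density_one F x \<and>
     ((\<lambda>s. (u (x + s) - u x - L s) / norm s) \<longlongrightarrow> 0) (at 0 within {s. x + s \<in> F}))"

text \<open>Where \<open>x + h k *\<^sub>R y\<close> lies in F the quotient is uniformly close to
  \<open>L y\<close>. Elsewhere the growth bound replaces u by the functions \<open>f i\<close>,
  whose quotients are at most a Taylor error plus \<open>norm (G i x)\<close>. The Taylor errors are
  small in the mean over the whole ball; the constant part is small because the exceptional set has
  small measure.\<close>

lemma approx_derivative_L1: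
  fixes u :: "real^'n \<Rightarrow> real"
  assumes I: "finite I" and h: "\<And>k. 0 < h k" "h \<longlonglongrightarrow> 0"
    and err: "\<And>i. i \<in> I \<Longrightarrow> (\<lambda>k. taylor_err (h k) (f i) (G i) x) \<longlonglongrightarrow> 0"
    and f: "\<And>i. i \<in> I \<Longrightarrow> f i \<in> borel_measurable borel"
    and d: "\<delta> > 0" and C: "C \<ge> 0"
    and growth: "AE z in lebesgue. z \<in> ball x \<delta> \<longrightarrow> \<bar>u z - u x\<bar> \<le> C * (\<Sum>i\<in>I. \<bar>f i z - f i x\<bar>)"
    and L: "approx_derivative u x L"
  shows "(\<lambda>k. \<integral>\<^sup>+y. ennreal \<bar>(u (x + h k *\<^sub>R y) - u x) / h k - L y\<bar> * indicator (ball 0 1) y \<partial>lebesgue) \<longlonglongrightarrow> 0"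
proof (rule ennreal_tendsto_0I)
  fix \<epsilon>' :: real assume "\<epsilon>' > 0"
  obtain F where bl: "bounded_linear L" and F: "density_one F x"
    and lim: "((\<lambda>s. (u (x + s) - u x - L s) / norm s) \<longlongrightarrow> 0) (at 0 within {s. x + s \<in> F})"
    using L unfolding approx_derivative_def by auto
  define \<beta> where "\<beta> = enn2real (emeasure lebesgue (ball (0::real^'n) 1))"
  have \<beta>: "emeasure lebesgue (ball (0::real^'n) 1) = ennreal \<beta>"
    unfolding \<beta>_def using emeasure_bounded_finite[of "ball (0::real^'n) 1"] by simp
  have \<beta>0: "\<beta> \<ge> 0" by (simp add: \<beta>_def)
  \<comment> \<open>Half of \<epsilon>' is spent on the points of F, the other half on the rest of
    the ball.\<close>
  define \<epsilon> where "\<epsilon> = \<epsilon>' / (2 * (\<beta> + 1))"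
  have \<epsilon>: "\<epsilon> > 0" "\<epsilon> * \<beta> \<le> \<epsilon>' / 2" using \<open>\<epsilon>' > 0\<close> \<beta>0 by (auto simp: \<epsilon>_def field_simps)
  obtain K where K: "\<And>y. norm (L y) \<le> norm y * K" "K \<ge> 0" using bounded_linear.nonneg_bounded[OF bl] by blast
  \<comment> \<open>The constant part of the bound off F: the gradients at x, and the bound K for L
    on the unit ball.\<close>
  define K' where "K' = C * (\<Sum>i\<in>I. norm (G i x)) + K"
  have K': "K' \<ge> 0" using C K by (auto simp: K'_def intro!: add_nonneg_nonneg mult_nonneg_nonneg sum_nonneg)
  obtain \<eta> where \<eta>: "\<eta> > 0" "\<And>s. x + s \<in> F \<Longrightarrow> s \<noteq> 0 \<Longrightarrow> norm s < \<eta> \<Longrightarrow> \<bar>u (x + s) - u x - L s\<bar> / norm s < \<epsilon>"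
    using tendstoD[OF lim \<epsilon>(1)] by (auto simp: eventually_at)
  define B where "B = (\<lambda>k. {y \<in> ball 0 1. x + h k *\<^sub>R y \<notin> F})"
  have B: "(\<lambda>k. emeasure lebesgue (B k)) \<longlonglongrightarrow> 0" "B k \<in> sets lebesgue" for k
    using density_one_emeasure[OF F h] unfolding B_def by auto
  define A where "A = (\<lambda>k. ennreal C * (\<Sum>i\<in>I. taylor_err (h k) (f i) (G i) x) + ennreal K' * emeasure lebesgue (B k))"
  have A0: "A \<longlonglongrightarrow> ennreal C * (\<Sum>i\<in>I. 0) + ennreal K' * 0"
    unfolding A_def by (intro tendsto_add ennreal_tendsto_cmult tendsto_sum err B) auto
  have "\<forall>\<^sub>F k in sequentially. A k < ennreal (\<epsilon>' / 2)"
    using order_tendstoD(2)[OF A0, of "ennreal (\<epsilon>'/2)"] \<open>\<epsilon>' > 0\<close> by simp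
  moreover have "\<forall>\<^sub>F k in sequentially. h k < min \<delta> \<eta>"
    using order_tendstoD(2)[OF h(2), of "min \<delta> \<eta>"] d \<eta> by simp
  ultimately show "\<forall>\<^sub>F k in sequentially. (\<integral>\<^sup>+y. ennreal \<bar>(u (x + h k *\<^sub>R y) - u x) / h k - L y\<bar> * indicator (ball 0 1) y \<partial>lebesgue) \<le> ennreal \<epsilon>'"
  proof eventually_elim
    case (elim k)
    have hk: "h k > 0" by (rule h)
    then have hk0: "h k \<noteq> 0" by simp
    let ?T = "\<lambda>i y. \<bar>f i (x + h k *\<^sub>R y) - f i x - G i x \<bullet> (h k *\<^sub>R y)\<bar> / h k"
    have "(\<integral>\<^sup>+y. ennreal \<bar>(u (x + h k *\<^sub>R y) - u x) / h k - L y\<bar> * indicator (ball 0 1) y \<partial>lebesgue)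
      \<le> (\<integral>\<^sup>+y. ennreal \<epsilon> * indicator (ball 0 1) y + (ennreal C * (\<Sum>i\<in>I. ennreal (?T i y) * indicator (ball 0 1) y) + ennreal K' * indicator (B k) y) \<partial>lebesgue)"
    proof (rule nn_integral_mono_AE)
      show "AE y in lebesgue. ennreal \<bar>(u (x + h k *\<^sub>R y) - u x) / h k - L y\<bar> * indicator (ball 0 1) y
         \<le> ennreal \<epsilon> * indicator (ball 0 1) y + (ennreal C * (\<Sum>i\<in>I. ennreal (?T i y) * indicator (ball 0 1) y) + ennreal K' * indicator (B k) y)"
        using AE_affine_lebesgue[OF hk0 growth, of x]
      proof eventually_elim
        case (elim y)
        show ?case
        proof (cases "y \<in> ball 0 1")
          case True
          then have y1: "norm y < 1" by simp
          have hy: "norm (h k *\<^sub>R y) < h k" using y1 hk by simp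
          have LL: "L (h k *\<^sub>R y) = h k * L y" using bl by (simp add: linear_simps(5) bounded_linear.linear)
          show ?thesis
          proof (cases "x + h k *\<^sub>R y \<in> F")
            case good: True
            have "\<bar>(u (x + h k *\<^sub>R y) - u x) / h k - L y\<bar> \<le> \<epsilon>"
            proof (cases "y = 0")
              case True
              then show ?thesis using \<epsilon> bl by (simp add: linear_simps bounded_linear.linear)
            next
              case False
              have "\<bar>u (x + h k *\<^sub>R y) - u x - L (h k *\<^sub>R y)\<bar> / norm (h k *\<^sub>R y) < \<epsilon>"
                using False hk order_less_le_trans[OF hy, of \<eta>] \<open>h k < min \<delta> \<eta>\<close>
                by (intro \<eta>(2)[OF good]) auto
              then have "\<bar>u (x + h k *\<^sub>R y) - u x - L (h k *\<^sub>R y)\<bar> \<le> \<epsilon> * norm (h k *\<^sub>R y)"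
                using False hk by (simp add: field_simps)
              also have "\<dots> \<le> \<epsilon> * h k" using \<epsilon> hy by (intro mult_left_mono) auto
              finally have "\<bar>u (x + h k *\<^sub>R y) - u x - h k * L y\<bar> / h k \<le> \<epsilon>" using hk LL by (simp add: field_simps)
              moreover have "(u (x + h k *\<^sub>R y) - u x) / h k - L y = (u (x + h k *\<^sub>R y) - u x - h k * L y) / h k"
                using hk by (simp add: field_simps)
              ultimately show ?thesis using hk by simp
            qed
            then show ?thesis using True by (auto intro!: add_increasing2 ennreal_leI)
          next
            case bad: False
            have "x + h k *\<^sub>R y \<in> ball x \<delta>" using hy \<open>h k < min \<delta> \<eta>\<close> by (simp add: dist_norm)
            then have g: "\<bar>u (x + h k *\<^sub>R y) - u x\<bar> \<le> C * (\<Sum>i\<in>I. \<bar>f i (x + h k *\<^sub>R y) - f i x\<bar>)" using elim by blast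
            have fi: "\<bar>f i (x + h k *\<^sub>R y) - f i x\<bar> \<le> h k * (?T i y + norm (G i x))" for i
            proof -
              have "\<bar>G i x \<bullet> (h k *\<^sub>R y)\<bar> \<le> norm (G i x) * norm (h k *\<^sub>R y)" by (rule Cauchy_Schwarz_ineq2)
              also have "\<dots> \<le> norm (G i x) * h k" using hy by (intro mult_left_mono) auto
              finally have "\<bar>f i (x + h k *\<^sub>R y) - f i x\<bar> \<le> \<bar>f i (x + h k *\<^sub>R y) - f i x - G i x \<bullet> (h k *\<^sub>R y)\<bar> + norm (G i x) * h k" by linarith
              also have "\<dots> = h k * (?T i y + norm (G i x))" using hk by (simp add: field_simps)
              finally show ?thesis .
            qed
            have "\<bar>u (x + h k *\<^sub>R y) - u x\<bar> \<le> C * (\<Sum>i\<in>I. h k * (?T i y + norm (G i x)))"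
              using g C by (meson fi mult_left_mono order_trans sum_mono)
            also have "\<dots> = h k * (C * (\<Sum>i\<in>I. ?T i y) + C * (\<Sum>i\<in>I. norm (G i x)))"
              by (simp only: sum_distrib_left[symmetric] sum.distrib distrib_left mult.left_commute)
            finally have "\<bar>u (x + h k *\<^sub>R y) - u x\<bar> / h k \<le> C * (\<Sum>i\<in>I. ?T i y) + C * (\<Sum>i\<in>I. norm (G i x))"
              using hk by (simp add: field_simps)
            moreover have "\<bar>L y\<bar> \<le> K"
            proof -
              have "\<bar>L y\<bar> \<le> norm y * K" using K(1)[of y] by simp
              also have "\<dots> \<le> 1 * K" using y1 K(2) by (intro mult_right_mono) auto
              finally show ?thesis by simp
            qed
            moreover have "\<bar>(u (x + h k *\<^sub>R y) - u x) / h k\<bar> = \<bar>u (x + h k *\<^sub>R y) - u x\<bar> / h k" using hk by simp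
            ultimately have "\<bar>(u (x + h k *\<^sub>R y) - u x) / h k - L y\<bar> \<le> C * (\<Sum>i\<in>I. ?T i y) + K'"
              unfolding K'_def by linarith
            then have "ennreal \<bar>(u (x + h k *\<^sub>R y) - u x) / h k - L y\<bar> \<le> ennreal (C * (\<Sum>i\<in>I. ?T i y) + K')" by (rule ennreal_leI)
            also have "\<dots> = ennreal C * (\<Sum>i\<in>I. ennreal (?T i y)) + ennreal K'"
            proof -
              have "(\<Sum>i\<in>I. ennreal (?T i y)) = ennreal (\<Sum>i\<in>I. ?T i y)" using hk by (intro sum_ennreal) auto
              moreover have "(\<Sum>i\<in>I. ?T i y) \<ge> 0" using hk by (intro sum_nonneg) auto
              ultimately show ?thesis using C K' by (simp add: ennreal_mult ennreal_plus)
            qed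
            finally show ?thesis using True bad by (auto simp: B_def intro: add_increasing)
          qed
        qed (auto simp: B_def)
      qed
    qed
    also have "\<dots> = ennreal \<epsilon> * ennreal \<beta> + A k"
    proof -
      have m[measurable]: "(\<lambda>y. ennreal (?T i y) * indicator (ball 0 1) y) \<in> borel_measurable lebesgue" if "i \<in> I" for i
      proof (rule measurable_completion)
        have [measurable]: "f i \<in> borel_measurable borel" by (rule f[OF that])
        show "(\<lambda>y. ennreal (?T i y) * indicator (ball 0 1) y) \<in> borel_measurable lborel" by measurable
      qed
      have t: "(\<integral>\<^sup>+y. ennreal (?T i y) * indicator (ball 0 1) y \<partial>lebesgue) = taylor_err (h k) (f i) (G i) x" for i
        by (simp add: taylor_err_def nn_integral_completion)
      have mA: "(\<lambda>y. ennreal \<epsilon> * indicator (ball (0::real^'n) 1) y) \<in> borel_measurable lebesgue"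
        by (rule measurable_completion) measurable
      have mS: "(\<lambda>y. \<Sum>i\<in>I. ennreal (?T i y) * indicator (ball 0 1) y) \<in> borel_measurable lebesgue"
        by (intro borel_measurable_sum m)
      then have mB: "(\<lambda>y. ennreal C * (\<Sum>i\<in>I. ennreal (?T i y) * indicator (ball 0 1) y)) \<in> borel_measurable lebesgue"
        by (intro borel_measurable_times_ennreal borel_measurable_const)
      have mC: "(\<lambda>y. ennreal K' * indicator (B k) y) \<in> borel_measurable lebesgue"
        by (intro borel_measurable_times_ennreal borel_measurable_const borel_measurable_indicator B)
      have iA: "(\<integral>\<^sup>+y. ennreal \<epsilon> * indicator (ball (0::real^'n) 1) y \<partial>lebesgue) = ennreal \<epsilon> * ennreal \<beta>"
        unfolding \<beta>[symmetric] by (rule nn_integral_cmult_indicator) simp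
      have iC: "(\<integral>\<^sup>+y. ennreal K' * indicator (B k) y \<partial>lebesgue) = ennreal K' * emeasure lebesgue (B k)"
        by (rule nn_integral_cmult_indicator) (rule B)
      have iB: "(\<integral>\<^sup>+y. ennreal C * (\<Sum>i\<in>I. ennreal (?T i y) * indicator (ball 0 1) y) \<partial>lebesgue) = ennreal C * (\<Sum>i\<in>I. taylor_err (h k) (f i) (G i) x)"
        unfolding nn_integral_cmult[OF mS] t[symmetric]
        by (rule arg_cong[where f = "(*) (ennreal C)"], rule nn_integral_sum) (rule m)
      show ?thesis
        unfolding A_def iA[symmetric] iB[symmetric] iC[symmetric]
        by (subst nn_integral_add[OF mA borel_measurable_add[OF mB mC]], subst nn_integral_add[OF mB mC]) (rule refl)
    qed
    also have "\<dots> \<le> ennreal (\<epsilon>' / 2) + ennreal (\<epsilon>' / 2)"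
      using elim \<epsilon> \<beta>0 by (intro add_mono) (auto simp: less_imp_le ennreal_leI simp flip: ennreal_mult)
    also have "\<dots> = ennreal \<epsilon>'" using \<open>\<epsilon>' > 0\<close> by (simp flip: ennreal_plus)
    finally show ?case .
  qed
qed

text \<open>The kernel is bounded and lives on the unit ball, so mean convergence passes to the
  integrals. Integrability holds only eventually, since early mean errors may be infinite; it is
  recorded because integrals can be split only where it holds.\<close>

lemma integral_kernel_tendsto:
  fixes D :: "nat \<Rightarrow> 'a::euclidean_space \<Rightarrow> real" and \<kappa> L :: "'a \<Rightarrow> real"
  assumes lim: "(\<lambda>k. \<integral>\<^sup>+y. ennreal \<bar>D k y - L y\<bar> * indicator (ball 0 1) y \<partial>lebesgue) \<longlonglongrightarrow> 0"
    and Dm: "\<And>k. D k \<in> borel_measurable lebesgue" and L: "L \<in> borel_measurable borel" "\<And>y. y \<in> ball 0 1 \<Longrightarrow> \<bar>L y\<bar> \<le> K"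
    and \<kappa>: "\<kappa> \<in> borel_measurable borel" "\<And>y. \<bar>\<kappa> y\<bar> \<le> M * indicator (ball 0 1) y"
  shows "(\<lambda>k. \<integral>y. \<kappa> y * D k y \<partial>lebesgue) \<longlonglongrightarrow> (\<integral>y. \<kappa> y * L y \<partial>lebesgue)"
    and "\<forall>\<^sub>F k in sequentially. integrable lebesgue (\<lambda>y. \<kappa> y * D k y)"
proof -
  have M: "M \<ge> 0" using \<kappa>(2)[of 0] abs_ge_zero[of "\<kappa> 0"] by (simp del: abs_ge_zero)
  have [measurable]: "\<kappa> \<in> borel_measurable lebesgue" "L \<in> borel_measurable lebesgue"
    using \<kappa>(1) L(1) by (auto intro: measurable_completion)
  note Dm[measurable] measurable_ident_lebesgue[measurable]
  have iB: "integrable lebesgue (indicator (ball (0::'a) 1) :: _ \<Rightarrow> real)"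
    using emeasure_bounded_finite[of "ball (0::'a) 1"] by (intro integrable_real_indicator) auto
  have iL: "integrable lebesgue (\<lambda>y. \<kappa> y * L y)"
  proof (rule Bochner_Integration.integrable_bound[OF integrable_mult_right[OF iB, of "M * K"]])
    show "AE y in lebesgue. norm (\<kappa> y * L y) \<le> norm (M * K * indicator (ball 0 1) y)"
    proof (intro always_eventually allI)
      fix y show "norm (\<kappa> y * L y) \<le> norm (M * K * indicator (ball 0 1) y)"
      proof (cases "y \<in> ball 0 1")
        case True
        then have "\<bar>\<kappa> y\<bar> * \<bar>L y\<bar> \<le> M * K" using \<kappa>(2)[of y] L(2)[of y] M by (intro mult_mono) auto
        then show ?thesis using True abs_ge_self[of "M * K"] by (simp add: abs_mult)
      qed (use \<kappa>(2)[of y] in auto)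
    qed
  qed measurable
  let ?N = "\<lambda>k. \<integral>\<^sup>+y. ennreal \<bar>D k y - L y\<bar> * indicator (ball 0 1) y \<partial>lebesgue"
  have bound: "(\<integral>\<^sup>+y. ennreal (norm (\<kappa> y * D k y - \<kappa> y * L y)) \<partial>lebesgue) \<le> ennreal M * ?N k" for k
  proof -
    have "(\<integral>\<^sup>+y. ennreal (norm (\<kappa> y * D k y - \<kappa> y * L y)) \<partial>lebesgue) \<le> (\<integral>\<^sup>+y. ennreal M * (ennreal \<bar>D k y - L y\<bar> * indicator (ball 0 1) y) \<partial>lebesgue)"
    proof (rule nn_integral_mono)
      fix y
      have "norm (\<kappa> y * D k y - \<kappa> y * L y) = \<bar>\<kappa> y\<bar> * \<bar>D k y - L y\<bar>"
        by (simp add: right_diff_distrib[symmetric] abs_mult)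
      also have "\<dots> \<le> (M * indicator (ball 0 1) y) * \<bar>D k y - L y\<bar>" by (intro mult_right_mono \<kappa>) auto
      finally show "ennreal (norm (\<kappa> y * D k y - \<kappa> y * L y)) \<le> ennreal M * (ennreal \<bar>D k y - L y\<bar> * indicator (ball 0 1) y)"
        using M by (cases "y \<in> ball 0 1") (auto simp: ennreal_leI simp flip: ennreal_mult)
    qed
    also have "\<dots> = ennreal M * ?N k" by (rule nn_integral_cmult) measurable
    finally show ?thesis .
  qed
  have MN: "(\<lambda>k. ennreal M * ?N k) \<longlonglongrightarrow> 0"
    using ennreal_tendsto_cmult[OF _ lim, of "ennreal M"] by simp
  have int: "integrable lebesgue (\<lambda>y. \<kappa> y * D k y - \<kappa> y * L y)" if "ennreal M * ?N k < 1" for k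
    using le_less_trans[OF bound that] order_less_trans[OF _ ennreal_one_less_top] by (intro integrableI_bounded) auto
  have ev: "\<forall>\<^sub>F k in sequentially. ennreal M * ?N k < 1" using order_tendstoD(2)[OF MN, of 1] by simp
  then show "\<forall>\<^sub>F k in sequentially. integrable lebesgue (\<lambda>y. \<kappa> y * D k y)"
  proof eventually_elim
    case (elim k)
    from Bochner_Integration.integrable_add[OF int[OF elim] iL] show ?case by simp
  qed
  have "(\<lambda>k. (\<integral>y. \<kappa> y * D k y \<partial>lebesgue) - (\<integral>y. \<kappa> y * L y \<partial>lebesgue)) \<longlonglongrightarrow> 0"
  proof (rule Lim_null_comparison)
    show "\<forall>\<^sub>F k in sequentially. norm ((\<integral>y. \<kappa> y * D k y \<partial>lebesgue) - (\<integral>y. \<kappa> y * L y \<partial>lebesgue)) \<le> enn2real (ennreal M * ?N k)"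
      using ev
    proof eventually_elim
      case (elim k)
      have iD: "integrable lebesgue (\<lambda>y. \<kappa> y * D k y)"
        using Bochner_Integration.integrable_add[OF int[OF elim] iL] by simp
      have "ennreal (norm (\<integral>y. \<kappa> y * D k y - \<kappa> y * L y \<partial>lebesgue)) \<le> (\<integral>\<^sup>+y. ennreal (norm (\<kappa> y * D k y - \<kappa> y * L y)) \<partial>lebesgue)"
        by (rule integral_norm_bound_ennreal[OF int[OF elim]])
      also have "\<dots> \<le> ennreal M * ?N k" by (rule bound)
      finally have "ennreal (norm (\<integral>y. \<kappa> y * D k y - \<kappa> y * L y \<partial>lebesgue)) \<le> ennreal (enn2real (ennreal M * ?N k))"
        using elim order_less_trans[OF elim ennreal_one_less_top] by (simp add: less_top)
      then have "norm (\<integral>y. \<kappa> y * D k y - \<kappa> y * L y \<partial>lebesgue) \<le> enn2real (ennreal M * ?N k)" by (simp add: ennreal_le_iff)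
      then show ?case using iD iL by simp
    qed
    show "(\<lambda>k. enn2real (ennreal M * ?N k)) \<longlonglongrightarrow> 0"
      by (rule tendsto_enn2real) (use MN in simp_all)
  qed
  then show "(\<lambda>k. \<integral>y. \<kappa> y * D k y \<partial>lebesgue) \<longlonglongrightarrow> (\<integral>y. \<kappa> y * L y \<partial>lebesgue)"
    by (rule LIM_zero_cancel)
qed

text \<open>The j-th partial derivative of \<open>bump 3 1\<close>; the factor is 3 times -2. The
  exponent 3 leaves \<open>kap\<close> itself continuously differentiable, so that its rescalings
  can serve as test functions.\<close>

definition kap :: "'n::finite \<Rightarrow> real^'n \<Rightarrow> real" where
  "kap j y = - 6 * bump 2 1 y * y $ j"

text \<open>The positive factor that occurs in all limits below and is divided out at the
  end.\<close>

definition bump_mass :: "('n::finite) itself \<Rightarrow> real" where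
  "bump_mass _ = (\<integral>y. bump 3 1 (y::real^'n) \<partial>lborel)"

lemma has_derivative_bump3: "(bump 3 c has_derivative (\<lambda>v. - 6 * bump 2 c z * (z \<bullet> v))) (at z)"
  using has_derivative_bump[of 1 c z] by (simp add: numeral_2_eq_2 numeral_3_eq_3)

lemma C1_c_bump3: "C1_c UNIV (bump 3 1 :: 'a::euclidean_space \<Rightarrow> real)"
proof (rule C1_cI[OF has_derivative_bump3, of _ "cball 0 1"])
  show "continuous_on UNIV (\<lambda>x. - 6 * bump 2 1 x * (x \<bullet> b))" for b :: 'a
    by (intro continuous_intros)
  show "bump 3 1 x = 0" if "x \<notin> cball 0 1" for x :: 'a
    using that bump_eq_0[of 1 x 3] by auto
qed auto

lemma kap_eq: "frechet_derivative (bump 3 1) (at y) (axis j 1) = kap j y"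
  using frechet_derivative_at[OF has_derivative_bump3[of 1 y]]
  by (simp add: kap_def inner_axis fun_eq_iff) (metis inner_axis inner_real_def mult.right_neutral)

lemma borel_measurable_kap [measurable]: "kap j \<in> borel_measurable borel"
  unfolding kap_def[abs_def] by measurable

lemma kap_bound: "\<bar>kap j y\<bar> \<le> 6 * indicator (ball 0 1) y"
proof (cases "y \<in> ball 0 1")
  case True
  have "bump 2 1 y \<le> 1" using bump_le[of 1 2 y] by simp
  moreover have "\<bar>y $ j\<bar> \<le> 1" using component_le_norm_cart[of y j] True by simp
  ultimately have "bump 2 1 y * \<bar>y $ j\<bar> \<le> 1 * 1" by (intro mult_mono) (auto simp: bump_nonneg)
  then show ?thesis using True by (simp add: kap_def abs_mult bump_nonneg)
next
  case False
  then show ?thesis using bump_eq_0[of 1 y 2] by (simp add: kap_def)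
qed

lemma integrable_ball1: "integrable lborel (indicator (ball (0::'a::euclidean_space) 1) :: _ \<Rightarrow> real)"
  using emeasure_bounded_finite[of "ball (0::'a) 1"] by (intro integrable_real_indicator) auto

lemma integrable_kap_mult:
  assumes [measurable]: "L \<in> borel_measurable borel" and L: "\<And>y. y \<in> ball 0 1 \<Longrightarrow> \<bar>L y\<bar> \<le> K"
  shows "integrable lborel (\<lambda>y. kap j y * L y)"
proof (rule Bochner_Integration.integrable_bound[OF integrable_mult_right[OF integrable_ball1, of "6 * K"]])
  show "AE y in lborel. norm (kap j y * L y) \<le> norm (6 * K * indicator (ball 0 1) y)"
  proof (intro always_eventually allI)
    fix y show "norm (kap j y * L y) \<le> norm (6 * K * indicator (ball 0 1) y)"
    proof (cases "y \<in> ball 0 1")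
      case True
      then have "\<bar>kap j y\<bar> * \<bar>L y\<bar> \<le> 6 * K" using kap_bound[of j y] L[of y] by (intro mult_mono) auto
      then show ?thesis using True abs_ge_self[of "6 * K"] by (simp add: abs_mult)
    qed (use kap_bound[of j y] in auto)
  qed
qed measurable

lemma integrable_kap: "integrable lborel (kap j)"
  using integrable_kap_mult[of "\<lambda>_. 1" 1 j] by simp

lemma integral_kap: "(\<integral>y. kap j y \<partial>lborel) = 0"
  using integral_frechet_derivative_C1_c[OF C1_c_bump3, of "axis j (1::real)"] unfolding kap_eq .

text \<open>Integration by parts: the derivative of \<open>bump 3 1 y * y $ i\<close> in direction j
  has integral 0.\<close>

lemma integral_kap_component:
  "(\<integral>y. kap j (y::real^'n) * y $ i \<partial>lborel) = (if i = j then - bump_mass TYPE('n) else 0)"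
proof -
  let ?\<phi> = "\<lambda>y::real^'n. bump 3 1 y * y $ i"
  let ?\<phi>' = "\<lambda>y v::real^'n. bump 3 1 y * v $ i + (- 6 * bump 2 1 y * (y \<bullet> v)) * y $ i"
  have d: "(?\<phi> has_derivative ?\<phi>' y) (at y)" for y
    by (rule has_derivative_mult[OF has_derivative_bump3]) (rule bounded_linear_imp_has_derivative, rule bounded_linear_vec_nth)
  have C: "C1_c UNIV ?\<phi>"
  proof (rule C1_cI[OF d, of "cball 0 1"])
    show "continuous_on UNIV (\<lambda>y. ?\<phi>' y b)" for b by (intro continuous_intros)
    show "?\<phi> x = 0" if "x \<notin> cball 0 1" for x using that bump_eq_0[of 1 x 3] by auto
  qed auto
  have "0 = (\<integral>y. ?\<phi>' y (axis j 1) \<partial>lborel)"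
    using integral_frechet_derivative_C1_c[OF C, of "axis j 1"] by (simp add: frechet_derivative_at[OF d, symmetric])
  also have "\<dots> = (\<integral>y. (if i = j then 1 else 0) * bump 3 1 y + kap j y * y $ i \<partial>lborel)"
  proof (rule Bochner_Integration.integral_cong)
    have "axis j (1::real) $ i = (if i = j then 1 else 0)" by (simp add: axis_def)
    then show "?\<phi>' y (axis j 1) = (if i = j then 1 else 0) * bump 3 1 y + kap j y * y $ i" for y
      by (simp add: kap_def inner_axis)
  qed simp
  also have "\<dots> = (\<integral>y. (if i = j then 1 else 0) * bump 3 1 (y::real^'n) \<partial>lborel) + (\<integral>y. kap j y * y $ i \<partial>lborel)"
  proof (rule Bochner_Integration.integral_add)
    show "integrable lborel (\<lambda>y::real^'n. (if i = j then 1 else 0) * bump 3 1 y)"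
      using C1_c_integrable(1)[OF C1_c_bump3] by (intro integrable_mult_right)
    show "integrable lborel (\<lambda>y. kap j y * y $ i)"
    proof (rule integrable_kap_mult)
      show "\<bar>y $ i\<bar> \<le> 1" if "y \<in> ball 0 1" for y :: "real^'n" using component_le_norm_cart[of y i] that by simp
    qed measurable
  qed
  finally show ?thesis by (auto simp: bump_mass_def)
qed

lemma bump_mass_pos: "bump_mass TYPE('n::finite) > 0"
proof -
  have i: "integrable lborel (bump 3 1 :: real^'n \<Rightarrow> real)" by (rule C1_c_integrable(1)[OF C1_c_bump3])
  have "bump_mass TYPE('n) \<ge> 0" unfolding bump_mass_def by (intro integral_nonneg_AE) (auto simp: bump_nonneg)
  moreover have "bump_mass TYPE('n) \<noteq> 0"
  proof
    assume "bump_mass TYPE('n) = 0"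
    then have "AE y in lborel. bump 3 1 (y::real^'n) = 0"
      unfolding bump_mass_def by (subst (asm) integral_nonneg_eq_0_iff_AE[OF i]) (auto simp: bump_nonneg)
    then have "AE y in lborel. (y::real^'n) \<notin> ball 0 1"
    proof eventually_elim
      case (elim y)
      show ?case
      proof
        assume "y \<in> ball 0 1"
        then have "y \<bullet> y < 1" using power_strict_mono[of "norm y" 1 2] by (simp add: dot_square_norm)
        then show False using elim by (simp add: bump_def)
      qed
    qed
    then have "emeasure lborel (ball (0::real^'n) 1) = 0"
      by (subst (asm) AE_iff_null_sets[symmetric]) (auto simp: null_sets_def)
    moreover have "emeasure lborel (ball (0::real^'n) 1) \<noteq> 0"
      using content_ball_pos[of 1 "0::real^'n"] by (auto simp: measure_def)
    ultimately show False by simp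
  qed
  ultimately show ?thesis by simp
qed

lemma bounded_linear_bound_ball:
  fixes L :: "real^'n \<Rightarrow> real"
  assumes "bounded_linear L"
  shows "L \<in> borel_measurable borel" "\<exists>K. \<forall>y\<in>ball 0 1. \<bar>L y\<bar> \<le> K"
proof -
  show "L \<in> borel_measurable borel"
    using assms by (intro borel_measurable_continuous_onI linear_continuous_on)
  obtain K where K: "\<And>y. norm (L y) \<le> norm y * K" "K \<ge> 0" using bounded_linear.nonneg_bounded[OF assms] by blast
  have "\<bar>L y\<bar> \<le> K" if "y \<in> ball 0 1" for y
    using K(1)[of y] mult_right_mono[of "norm y" 1 K] K(2) that by simp
  then show "\<exists>K. \<forall>y\<in>ball 0 1. \<bar>L y\<bar> \<le> K" by blast
qed

lemma integral_kap_linear: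
  fixes L :: "real^'n \<Rightarrow> real"
  assumes L: "bounded_linear L"
  shows "(\<integral>y. kap j y * L y \<partial>lborel) = - bump_mass TYPE('n) * L (axis j 1)"
proof -
  have lin: "linear L" using L by (rule bounded_linear.linear)
  have Ly: "L y = (\<Sum>i\<in>UNIV. y $ i * L (axis i 1))" for y
    using basis_expansion[of y] linear_sum[OF lin, of "\<lambda>i. y $ i *\<^sub>R axis i 1" UNIV] linear_scale[OF lin]
    by (simp add: scalar_mult_eq_scaleR)
  have int: "integrable lborel (\<lambda>y. kap j y * y $ i)" for i
  proof (rule integrable_kap_mult)
    show "\<bar>y $ i\<bar> \<le> 1" if "y \<in> ball 0 1" for y :: "real^'n" using component_le_norm_cart[of y i] that by simp
  qed measurable
  have "(\<integral>y. kap j y * L y \<partial>lborel) = (\<integral>y. (\<Sum>i\<in>UNIV. L (axis i 1) * (kap j y * y $ i)) \<partial>lborel)"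
    by (subst Ly) (simp add: sum_distrib_left algebra_simps)
  also have "\<dots> = (\<Sum>i\<in>UNIV. L (axis i 1) * (\<integral>y. kap j y * y $ i \<partial>lborel))"
    using int by (subst Bochner_Integration.integral_sum) auto
  also have "\<dots> = - bump_mass TYPE('n) * L (axis j 1)"
    by (simp add: integral_kap_component if_distrib[of "\<lambda>x. _ * x"] cong: if_cong)
  finally show ?thesis .
qed

lemma integral_kap_quotient_tendsto:
  fixes u :: "real^'n \<Rightarrow> real"
  assumes I: "finite I" and h: "\<And>k. 0 < h k" "h \<longlonglongrightarrow> 0"
    and err: "\<And>i. i \<in> I \<Longrightarrow> (\<lambda>k. taylor_err (h k) (f i) (G i) x) \<longlonglongrightarrow> 0"
    and f: "\<And>i. i \<in> I \<Longrightarrow> f i \<in> borel_measurable borel"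
    and d: "\<delta> > 0" and C: "C \<ge> 0" and u: "u \<in> borel_measurable lebesgue"
    and growth: "AE z in lebesgue. z \<in> ball x \<delta> \<longrightarrow> \<bar>u z - u x\<bar> \<le> C * (\<Sum>i\<in>I. \<bar>f i z - f i x\<bar>)"
    and L: "approx_derivative u x L"
  shows "(\<lambda>k. \<integral>y. kap j y * ((u (x + h k *\<^sub>R y) - u x) / h k) \<partial>lebesgue) \<longlonglongrightarrow> - bump_mass TYPE('n) * L (axis j 1)"
    and "\<forall>\<^sub>F k in sequentially. integrable lebesgue (\<lambda>y. kap j y * ((u (x + h k *\<^sub>R y) - u x) / h k))"
proof -
  have bl: "bounded_linear L" using L by (simp add: approx_derivative_def)
  obtain K where K: "\<And>y. y \<in> ball 0 1 \<Longrightarrow> \<bar>L y\<bar> \<le> K" using bounded_linear_bound_ball(2)[OF bl] by blast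
  have m: "(\<lambda>y. (u (x + h k *\<^sub>R y) - u x) / h k) \<in> borel_measurable lebesgue" for k
    using measurable_compose[OF measurable_affine_lebesgue u, of "h k" x] h(1)[of k]
    by (intro borel_measurable_divide borel_measurable_diff borel_measurable_const) auto
  have e: "(\<integral>y. kap j y * L y \<partial>lebesgue) = - bump_mass TYPE('n) * L (axis j 1)"
    using integral_kap_linear[OF bl, of j] bounded_linear_bound_ball(1)[OF bl] by (subst integral_completion) auto
  note l = integral_kernel_tendsto[OF approx_derivative_L1[OF I h err f d C growth L] m bounded_linear_bound_ball(1)[OF bl] K borel_measurable_kap[of j] kap_bound]
  show "(\<lambda>k. \<integral>y. kap j y * ((u (x + h k *\<^sub>R y) - u x) / h k) \<partial>lebesgue) \<longlonglongrightarrow> - bump_mass TYPE('n) * L (axis j 1)"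
    using l(1) e by simp
  show "\<forall>\<^sub>F k in sequentially. integrable lebesgue (\<lambda>y. kap j y * ((u (x + h k *\<^sub>R y) - u x) / h k))"
    using l(2) by simp
qed

section \<open>Weak derivatives from approximate derivatives\<close>

lemma nn_integral_abs_le_taylor_err:
  fixes f :: "real^'n \<Rightarrow> real"
  assumes h: "h > 0" and f: "f \<in> borel_measurable borel"
  shows "(\<integral>\<^sup>+y. ennreal (\<bar>f (x + h *\<^sub>R y) - f x\<bar> / h) * indicator (ball 0 1) y \<partial>lebesgue)
    \<le> taylor_err h f G x + ennreal (norm (G x)) * emeasure lborel (ball (0::real^'n) 1)"
proof -
  note [measurable] = f
  have "(\<integral>\<^sup>+y. ennreal (\<bar>f (x + h *\<^sub>R y) - f x\<bar> / h) * indicator (ball 0 1) y \<partial>lborel)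
    \<le> (\<integral>\<^sup>+y. ennreal (\<bar>f (x + h *\<^sub>R y) - f x - G x \<bullet> (h *\<^sub>R y)\<bar> / h) * indicator (ball 0 1) y + ennreal (norm (G x)) * indicator (ball 0 1) y \<partial>lborel)"
  proof (rule nn_integral_mono)
    fix y
    show "ennreal (\<bar>f (x + h *\<^sub>R y) - f x\<bar> / h) * indicator (ball 0 1) y
      \<le> ennreal (\<bar>f (x + h *\<^sub>R y) - f x - G x \<bullet> (h *\<^sub>R y)\<bar> / h) * indicator (ball 0 1) y + ennreal (norm (G x)) * indicator (ball 0 1) y"
    proof (cases "y \<in> ball 0 1")
      case True
      have "\<bar>G x \<bullet> (h *\<^sub>R y)\<bar> \<le> norm (G x) * norm (h *\<^sub>R y)" by (rule Cauchy_Schwarz_ineq2)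
      also have "\<dots> \<le> norm (G x) * h" using True h by (intro mult_left_mono) (auto simp: mult_left_le)
      finally have "\<bar>f (x + h *\<^sub>R y) - f x\<bar> \<le> \<bar>f (x + h *\<^sub>R y) - f x - G x \<bullet> (h *\<^sub>R y)\<bar> + norm (G x) * h" by linarith
      then have "\<bar>f (x + h *\<^sub>R y) - f x\<bar> / h \<le> \<bar>f (x + h *\<^sub>R y) - f x - G x \<bullet> (h *\<^sub>R y)\<bar> / h + norm (G x)"
        using h by (simp add: field_simps)
      then have "ennreal (\<bar>f (x + h *\<^sub>R y) - f x\<bar> / h) \<le> ennreal (\<bar>f (x + h *\<^sub>R y) - f x - G x \<bullet> (h *\<^sub>R y)\<bar> / h + norm (G x))"
        by (rule ennreal_leI)
      then show ?thesis using True h by (simp add: ennreal_plus)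
    qed simp
  qed
  also have "\<dots> = taylor_err h f G x + ennreal (norm (G x)) * emeasure lborel (ball (0::real^'n) 1)"
    unfolding taylor_err_def by (subst nn_integral_add) (auto simp: nn_integral_cmult_indicator)
  finally show ?thesis by (simp add: nn_integral_completion)
qed

text \<open>The bound is free of h, so the quotients at all scales get a common majorant in x. The
  number 6 is the bound of \<open>kap\<close>.\<close>

lemma integral_kap_quotient_le:
  fixes u :: "real^'n \<Rightarrow> real"
  assumes I: "finite I" and h: "0 < h" "h \<le> \<delta>"
    and err: "\<And>i. i \<in> I \<Longrightarrow> taylor_err h (f i) (G i) x \<le> ennreal e" and e: "e \<ge> 0"
    and f: "\<And>i. i \<in> I \<Longrightarrow> f i \<in> borel_measurable borel"
    and C: "C \<ge> 0" and u: "u \<in> borel_measurable lebesgue"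
    and growth: "AE z in lebesgue. z \<in> ball x \<delta> \<longrightarrow> \<bar>u z - u x\<bar> \<le> C * (\<Sum>i\<in>I. \<bar>f i z - f i x\<bar>)"
  shows "\<bar>\<integral>y. kap j y * ((u (x + h *\<^sub>R y) - u x) / h) \<partial>lebesgue\<bar>
     \<le> 6 * C * (\<Sum>i\<in>I. e + norm (G i x) * measure lborel (ball (0::real^'n) 1))"
proof -
  define \<beta> where "\<beta> = measure lborel (ball (0::real^'n) 1)"
  have \<beta>: "emeasure lborel (ball (0::real^'n) 1) = ennreal \<beta>"
    unfolding \<beta>_def using emeasure_bounded_finite[of "ball (0::real^'n) 1"] by (simp add: emeasure_eq_ennreal_measure)
  let ?D = "\<lambda>y. kap j y * ((u (x + h *\<^sub>R y) - u x) / h)"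
  let ?T = "\<lambda>i y. \<bar>f i (x + h *\<^sub>R y) - f i x\<bar> / h"
  have h0: "h \<noteq> 0" using h by simp
  have m: "(\<lambda>y. ennreal (?T i y) * indicator (ball 0 1) y) \<in> borel_measurable lebesgue" if "i \<in> I" for i
  proof (rule measurable_completion)
    have [measurable]: "f i \<in> borel_measurable borel" by (rule f[OF that])
    show "(\<lambda>y. ennreal (?T i y) * indicator (ball 0 1) y) \<in> borel_measurable lborel" by measurable
  qed
  have mS: "(\<lambda>y. \<Sum>i\<in>I. ennreal (?T i y) * indicator (ball 0 1) y) \<in> borel_measurable lebesgue"
    by (intro borel_measurable_sum m)
  have "(\<integral>\<^sup>+y. ennreal (norm (?D y)) \<partial>lebesgue) \<le> (\<integral>\<^sup>+y. ennreal (6 * C) * (\<Sum>i\<in>I. ennreal (?T i y) * indicator (ball 0 1) y) \<partial>lebesgue)"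
  proof (rule nn_integral_mono_AE)
    show "AE y in lebesgue. ennreal (norm (?D y)) \<le> ennreal (6 * C) * (\<Sum>i\<in>I. ennreal (?T i y) * indicator (ball 0 1) y)"
      using AE_affine_lebesgue[OF h0 growth, of x]
    proof eventually_elim
      case (elim y)
      show ?case
      proof (cases "y \<in> ball 0 1")
        case True
        then have "x + h *\<^sub>R y \<in> ball x \<delta>" using h order_less_le_trans[of "h * norm y" h \<delta>] mult_strict_left_mono[of "norm y" 1 h] by (simp add: dist_norm)
        then have g: "\<bar>u (x + h *\<^sub>R y) - u x\<bar> \<le> C * (\<Sum>i\<in>I. \<bar>f i (x + h *\<^sub>R y) - f i x\<bar>)" using elim by blast
        have "norm (?D y) = \<bar>kap j y\<bar> * (\<bar>u (x + h *\<^sub>R y) - u x\<bar> / h)" using h by (simp add: abs_mult)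
        also have "\<dots> \<le> 6 * (C * (\<Sum>i\<in>I. \<bar>f i (x + h *\<^sub>R y) - f i x\<bar>) / h)"
          using kap_bound[of j y] True h g by (intro mult_mono divide_right_mono) auto
        also have "\<dots> = 6 * C * (\<Sum>i\<in>I. ?T i y)" by (simp add: sum_divide_distrib[symmetric])
        finally have "ennreal (norm (?D y)) \<le> ennreal (6 * C * (\<Sum>i\<in>I. ?T i y))" by (rule ennreal_leI)
        also have "\<dots> = ennreal (6 * C) * (\<Sum>i\<in>I. ennreal (?T i y))"
          using C h by (subst sum_ennreal, simp, intro ennreal_mult) (auto intro!: sum_nonneg)
        finally show ?thesis using True by simp
      qed (use kap_bound[of j y] in auto)
    qed
  qed
  also have "\<dots> = ennreal (6 * C) * (\<Sum>i\<in>I. \<integral>\<^sup>+y. ennreal (?T i y) * indicator (ball 0 1) y \<partial>lebesgue)"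
    unfolding nn_integral_cmult[OF mS] by (rule arg_cong[where f = "(*) (ennreal (6 * C))"], rule nn_integral_sum) (rule m)
  also have "\<dots> \<le> ennreal (6 * C) * (\<Sum>i\<in>I. ennreal (e + norm (G i x) * \<beta>))"
  proof (intro mult_left_mono sum_mono)
    fix i assume i: "i \<in> I"
    have "(\<integral>\<^sup>+y. ennreal (?T i y) * indicator (ball 0 1) y \<partial>lebesgue) \<le> taylor_err h (f i) (G i) x + ennreal (norm (G i x)) * ennreal \<beta>"
      using nn_integral_abs_le_taylor_err[OF h(1) f[OF i], of x "G i"] by (simp add: \<beta>)
    also have "\<dots> \<le> ennreal e + ennreal (norm (G i x)) * ennreal \<beta>" by (intro add_right_mono err i)
    also have "\<dots> = ennreal (e + norm (G i x) * \<beta>)" using e by (simp add: \<beta>_def ennreal_plus ennreal_mult)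
    finally show "(\<integral>\<^sup>+y. ennreal (?T i y) * indicator (ball 0 1) y \<partial>lebesgue) \<le> ennreal (e + norm (G i x) * \<beta>)" .
  qed simp
  also have "\<dots> = ennreal (6 * C * (\<Sum>i\<in>I. e + norm (G i x) * \<beta>))"
    using C e by (subst sum_ennreal, simp add: \<beta>_def, intro ennreal_mult[symmetric]) (auto simp: \<beta>_def intro!: sum_nonneg)
  finally have le: "(\<integral>\<^sup>+y. ennreal (norm (?D y)) \<partial>lebesgue) \<le> ennreal (6 * C * (\<Sum>i\<in>I. e + norm (G i x) * \<beta>))" .
  have nn: "6 * C * (\<Sum>i\<in>I. e + norm (G i x) * \<beta>) \<ge> 0"
    using C e by (auto simp: \<beta>_def intro!: mult_nonneg_nonneg sum_nonneg)
  \<comment> \<open>The case split covers a quotient that is not integrable: its integral is 0 by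
    convention and the bound trivial.\<close>
  show ?thesis
  proof (cases "integrable lebesgue ?D")
    case True
    have "ennreal (norm (integral\<^sup>L lebesgue ?D)) \<le> ennreal (6 * C * (\<Sum>i\<in>I. e + norm (G i x) * \<beta>))"
      using integral_norm_bound_ennreal[OF True] le by (rule order_trans)
    then show ?thesis using nn by (simp add: \<beta>_def ennreal_le_iff)
  next
    case False
    then show ?thesis using nn unfolding not_integrable_integral_eq[OF False] by (simp add: \<beta>_def)
  qed
qed

text \<open>The integral of \<open>W k x * \<psi> x\<close> is computed in two ways. Pointwise,
  \<open>W k x\<close> tends to \<open>- c0 * w x\<close> under an integrable majorant. By Fubini
  the shift moves from u to \<psi>, and the difference quotients of \<psi> produce the weak
  derivative of u with the same factor. The majorant is integrable because C is one constant for all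
  x.\<close>

lemma weak_derivative_of_approx:
  fixes u w :: "real^'n \<Rightarrow> real"
  assumes I: "finite I" and r: "0 < r" "r < R"
    and h: "\<And>k. 0 < h k" "h \<longlonglongrightarrow> 0"
    and E: "E \<in> borel_measurable borel" "(\<integral>\<^sup>+x. E x * indicator (ball x0 r) x \<partial>lborel) < \<infinity>"
      "\<And>i k x. i \<in> I \<Longrightarrow> taylor_err (h k) (f i) (G i) x \<le> E x"
    and lim: "AE x in lebesgue. x \<in> ball x0 r \<longrightarrow> (\<forall>i\<in>I. (\<lambda>k. taylor_err (h k) (f i) (G i) x) \<longlonglongrightarrow> 0)"
    and f: "\<And>i. i \<in> I \<Longrightarrow> f i \<in> borel_measurable borel" and G: "\<And>i. i \<in> I \<Longrightarrow> integrable lborel (G i)"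
    and C: "C \<ge> 0" and u: "u \<in> borel_measurable lebesgue" "\<And>x. \<bar>u x\<bar> \<le> M" "\<And>x. x \<notin> ball x0 R \<Longrightarrow> u x = 0"
    and growth: "AE x in lebesgue. x \<in> ball x0 R \<longrightarrow>
       (AE z in lebesgue. z \<in> ball x0 R \<longrightarrow> \<bar>u z - u x\<bar> \<le> C * (\<Sum>i\<in>I. \<bar>f i z - f i x\<bar>))"
    and w: "w \<in> borel_measurable lebesgue"
    and jet: "AE x in lebesgue. x \<in> ball x0 r \<longrightarrow> (\<exists>L. approx_derivative u x L \<and> L (axis j 1) = w x)"
    and \<psi>: "C1_c (ball x0 r) \<psi>"
  shows "(\<integral>x. u x * frechet_derivative \<psi> (at x) (axis j 1) \<partial>lebesgue) = - (\<integral>x. w x * \<psi> x \<partial>lebesgue)"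
proof -
  define c0 where "c0 = bump_mass TYPE('n)"
  have c0: "c0 > 0" unfolding c0_def by (rule bump_mass_pos)
  have M: "M \<ge> 0" using u(2)[of x0] by linarith
  obtain C\<psi> where C\<psi>: "C\<psi> \<ge> 0" "\<And>x. norm (\<psi> x) \<le> C\<psi>" "\<And>x y. norm (\<psi> x - \<psi> y) \<le> C\<psi> * norm (x - y)"
    "\<And>x v. norm (frechet_derivative \<psi> (at x) v) \<le> C\<psi> * norm v"
    using C1_c_bounds[OF \<psi>] by metis
  have \<psi>0: "\<psi> x = 0" if "x \<notin> ball x0 r" for x
    using C1_c_support[OF \<psi>] that by (metis subsetD)
  have [measurable]: "\<psi> \<in> borel_measurable borel" "(\<lambda>x. frechet_derivative \<psi> (at x) v) \<in> borel_measurable borel" for v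
    using C1_c_borel_measurable[OF \<psi>] by auto

  \<comment> \<open>Fubini is applied to Borel functions on the product: u is replaced by a Borel
    representative, clipped and cut off so that its bound and support hold everywhere.\<close>
  obtain u1 where u1: "u1 \<in> borel_measurable borel" "AE x in lborel. u x = u1 x"
    using completion_ex_borel_measurable_real[OF u(1)] by auto
  define u' where "u' = (\<lambda>x. indicator (ball x0 R) x * max (- M) (min M (u1 x)))"
  have u'm[measurable]: "u' \<in> borel_measurable borel" unfolding u'_def using u1(1) by measurable
  have u'b: "\<bar>u' x\<bar> \<le> M" for x using M by (auto simp: u'_def indicator_def)
  have uu': "AE x in lebesgue. u x = u' x"
  proof (rule AE_completion)
    show "AE x in lborel. u x = u' x"
      using u1(2)
    proof eventually_elim
      case (elim x)
      then show ?case
        using u(2)[of x] u(3)[of x] M by (cases "x \<in> ball x0 R") (auto simp: u'_def max_def min_def)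
    qed
  qed
  have u'i: "integrable lborel u'"
  proof (rule Bochner_Integration.integrable_bound[of lborel "\<lambda>x. M * indicator (ball x0 R) x"])
    show "integrable lborel (\<lambda>x. M * indicator (ball x0 R) x :: real)"
      using emeasure_bounded_finite[of "ball x0 R"] by (intro integrable_mult_right integrable_real_indicator) auto
    show "AE x in lborel. norm (u' x) \<le> norm (M * indicator (ball x0 R) x)"
      using u'b M by (auto simp: u'_def indicator_def)
  qed measurable

  have "\<forall>\<^sub>F k in sequentially. h k < R - r" using order_tendstoD(2)[OF h(2), of "R - r"] r by simp
  then obtain K0 where K0: "\<And>k. k \<ge> K0 \<Longrightarrow> h k < R - r" by (auto simp: eventually_sequentially)
  \<comment> \<open>The early scales are dropped, so that points of the smaller ball remain in the
    larger one after a shift of length less than \<open>h' k\<close>.\<close>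
  define h' where "h' = (\<lambda>k. h (k + K0))"
  have h': "\<And>k. 0 < h' k" "h' \<longlonglongrightarrow> 0" "\<And>k. h' k \<le> R - r"
    using h(1) LIMSEQ_ignore_initial_segment[OF h(2)] K0 by (auto simp: h'_def less_imp_le)
  have h'0: "h' k \<noteq> 0" for k using h'(1)[of k] by simp

  define W where "W = (\<lambda>k x. \<integral>y. kap j y * ((u' (x + h' k *\<^sub>R y) - u' x) / h' k) \<partial>lborel)"
  have Wm: "W k \<in> borel_measurable lborel" for k
    unfolding W_def by (rule lborel.borel_measurable_lebesgue_integral) measurable
  define \<beta> where "\<beta> = measure lborel (ball (0::real^'n) 1)"
  \<comment> \<open>The majorant of \<open>integral_kap_quotient_le\<close>, with E as common bound
    of the Taylor errors; \<open>enn2real\<close> loses nothing a.e. on the ball, where E is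
    finite.\<close>
  define b where "b = (\<lambda>x. 6 * C * (\<Sum>i\<in>I. enn2real (E x) + norm (G i x) * \<beta>))"
  have Efin: "AE x in lebesgue. x \<in> ball x0 r \<longrightarrow> E x < \<infinity>"
  proof (rule AE_completion)
    have "AE x in lborel. E x * indicator (ball x0 r) x \<noteq> \<infinity>"
      by (rule nn_integral_PInf_AE) (use E in auto)
    then show "AE x in lborel. x \<in> ball x0 r \<longrightarrow> E x < \<infinity>"
      by eventually_elim (auto simp: less_top)
  qed
  have bi: "integrable lborel (\<lambda>x. indicator (ball x0 r) x * b x)"
  proof -
    have iE: "integrable lborel (\<lambda>x. enn2real (E x) * indicator (ball x0 r) x)"
    proof (rule integrableI_bounded)
      show "(\<lambda>x. enn2real (E x) * indicator (ball x0 r) x) \<in> borel_measurable lborel" using E(1) by measurable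
      have "(\<integral>\<^sup>+x. ennreal (norm (enn2real (E x) * indicator (ball x0 r) x)) \<partial>lborel) \<le> (\<integral>\<^sup>+x. E x * indicator (ball x0 r) x \<partial>lborel)"
        by (intro nn_integral_mono) (auto simp: indicator_def ennreal_enn2real_if)
      then show "(\<integral>\<^sup>+x. ennreal (norm (enn2real (E x) * indicator (ball x0 r) x)) \<partial>lborel) < \<infinity>" using E(2) by (rule le_less_trans)
    qed
    have iG: "integrable lborel (\<lambda>x. (norm (G i x) * \<beta>) * indicator (ball x0 r) x)" if "i \<in> I" for i
      by (rule integrable_real_mult_indicator) (use G[OF that] in auto)
    have "integrable lborel (\<lambda>x. 6 * C * (\<Sum>i\<in>I. enn2real (E x) * indicator (ball x0 r) x + (norm (G i x) * \<beta>) * indicator (ball x0 r) x))"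
      by (intro integrable_mult_right Bochner_Integration.integrable_sum Bochner_Integration.integrable_add iE iG)
    then show ?thesis unfolding b_def by (simp only: sum_distrib_right[symmetric] distrib_right[symmetric]) (simp add: mult_ac)
  qed

  have good: "AE x in lebesgue. x \<in> ball x0 r \<longrightarrow> (\<lambda>k. W k x) \<longlonglongrightarrow> - c0 * w x \<and> (\<forall>k. \<bar>W k x\<bar> \<le> b x)"
    using growth jet lim uu' Efin
  proof eventually_elim
    case (elim x)
    show ?case
    proof
      assume x: "x \<in> ball x0 r"
      then have xR: "x \<in> ball x0 R" using r by auto
      define \<delta> where "\<delta> = R - r"
      have \<delta>: "\<delta> > 0" using r by (simp add: \<delta>_def)
      have sub: "ball x \<delta> \<subseteq> ball x0 R"
      proof
        fix z assume "z \<in> ball x \<delta>"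
        then show "z \<in> ball x0 R" using x dist_triangle[of x0 z x] by (simp add: \<delta>_def)
      qed
      have gr: "AE z in lebesgue. z \<in> ball x \<delta> \<longrightarrow> \<bar>u z - u x\<bar> \<le> C * (\<Sum>i\<in>I. \<bar>f i z - f i x\<bar>)"
        using mp[OF elim(1) xR] by eventually_elim (use sub in auto)
      obtain L where L: "approx_derivative u x L" "L (axis j 1) = w x" using elim(2) x by blast
      have le: "taylor_err (h' k) (f i) (G i) x \<le> ennreal (enn2real (E x))" if "i \<in> I" for i k
        using E(3)[OF that, of "k + K0" x] elim(5) x by (simp add: h'_def)
      have l0: "(\<lambda>k. taylor_err (h' k) (f i) (G i) x) \<longlonglongrightarrow> 0" if "i \<in> I" for i
      proof -
        have "(\<lambda>k. taylor_err (h k) (f i) (G i) x) \<longlonglongrightarrow> 0" using elim(3) x that by blast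
        from LIMSEQ_ignore_initial_segment[OF this, of K0] show ?thesis by (simp add: h'_def)
      qed
      \<comment> \<open>\<open>W\<close> is built from u' to make it measurable in x; at the points
        considered it agrees with the quotient integral of u itself.\<close>
      have WW: "W k x = (\<integral>y. kap j y * ((u (x + h' k *\<^sub>R y) - u x) / h' k) \<partial>lebesgue)" for k
      proof -
        have "W k x = (\<integral>y. kap j y * ((u' (x + h' k *\<^sub>R y) - u' x) / h' k) \<partial>lebesgue)"
          unfolding W_def by (rule integral_completion[symmetric]) measurable
        also have "\<dots> = (\<integral>y. kap j y * ((u (x + h' k *\<^sub>R y) - u x) / h' k) \<partial>lebesgue)"
        proof (rule integral_cong_AE)
          show "(\<lambda>y. kap j y * ((u' (x + h' k *\<^sub>R y) - u' x) / h' k)) \<in> borel_measurable lebesgue"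
            by (rule measurable_completion) measurable
          show "(\<lambda>y. kap j y * ((u (x + h' k *\<^sub>R y) - u x) / h' k)) \<in> borel_measurable lebesgue"
            using measurable_compose[OF measurable_affine_lebesgue[OF h'0] u(1), of x k]
            by (intro borel_measurable_times borel_measurable_divide borel_measurable_diff borel_measurable_const measurable_completion[of "kap j"]) auto
          show "AE y in lebesgue. kap j y * ((u' (x + h' k *\<^sub>R y) - u' x) / h' k) = kap j y * ((u (x + h' k *\<^sub>R y) - u x) / h' k)"
            using AE_affine_lebesgue[OF h'0 uu', of x k] by eventually_elim (use elim(4) in simp)
        qed
        finally show ?thesis .
      qed
      have "(\<lambda>k. W k x) \<longlonglongrightarrow> - c0 * w x"
        using integral_kap_quotient_tendsto(1)[OF I h'(1,2) l0 f \<delta> C u(1) gr L(1), of j] L(2) by (simp add: WW c0_def)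
      moreover have "\<bar>W k x\<bar> \<le> b x" for k
        using integral_kap_quotient_le[OF I h'(1) _ le enn2real_nonneg f C u(1) gr, of k j] h'(3)[of k]
        by (simp add: WW b_def \<beta>_def \<delta>_def)
      ultimately show "(\<lambda>k. W k x) \<longlonglongrightarrow> - c0 * w x \<and> (\<forall>k. \<bar>W k x\<bar> \<le> b x)" by blast
    qed
  qed

  have lim1: "(\<lambda>k. \<integral>x. W k x * \<psi> x \<partial>lebesgue) \<longlonglongrightarrow> (\<integral>x. - c0 * w x * \<psi> x \<partial>lebesgue)"
  proof (rule integral_dominated_convergence[where w = "\<lambda>x. C\<psi> * (indicator (ball x0 r) x * b x)"])
    show "(\<lambda>x. - c0 * w x * \<psi> x) \<in> borel_measurable lebesgue"
      using w by (intro borel_measurable_times borel_measurable_const measurable_completion[of \<psi>]) auto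
    show "(\<lambda>x. W k x * \<psi> x) \<in> borel_measurable lebesgue" for k
      using Wm by (intro measurable_completion borel_measurable_times) auto
    show "integrable lebesgue (\<lambda>x. C\<psi> * (indicator (ball x0 r) x * b x))"
      using bi borel_measurable_integrable[OF bi] by (intro integrable_mult_right) (simp add: integrable_completion)
    show "AE x in lebesgue. (\<lambda>k. W k x * \<psi> x) \<longlonglongrightarrow> - c0 * w x * \<psi> x"
      using good
    proof eventually_elim
      case (elim x)
      show ?case
      proof (cases "x \<in> ball x0 r")
        case True
        with elim have "(\<lambda>k. W k x) \<longlonglongrightarrow> - c0 * w x" by blast
        then show ?thesis by (rule tendsto_mult_right)
      qed (simp add: \<psi>0)
    qed
    show "AE x in lebesgue. norm (W k x * \<psi> x) \<le> C\<psi> * (indicator (ball x0 r) x * b x)" for k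
      using good
    proof eventually_elim
      case (elim x)
      show ?case
      proof (cases "x \<in> ball x0 r")
        case True
        then have "\<bar>W k x\<bar> * \<bar>\<psi> x\<bar> \<le> b x * C\<psi>" using elim C\<psi>(2)[of x] by (intro mult_mono) (auto intro: order_trans[OF abs_ge_zero])
        then show ?thesis using True by (simp add: abs_mult mult.commute)
      qed (simp add: \<psi>0)
    qed
  qed

  \<comment> \<open>\<open>Lq s\<close> is the derivative at t = 0 of the integral of u' against
    \<open>\<psi> (x - t *\<^sub>R s)\<close>; \<open>q k y\<close> is the corresponding difference
    quotient in direction y with step \<open>h' k\<close>.\<close>
  define Lq where "Lq = (\<lambda>s. - (\<integral>x. u' x * frechet_derivative \<psi> (at x) s \<partial>lborel))"
  define q where "q = (\<lambda>k y. (\<integral>x. u' x * ((\<psi> (x - h' k *\<^sub>R y) - \<psi> x) / h' k) \<partial>lborel))"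
  have iu\<psi>: "integrable lborel (\<lambda>x. u' x * \<psi> (x - s))" for s
  proof (rule integrable_mult_C1_c(1)[OF u'i])
    show "C1_c UNIV (\<lambda>x. \<psi> (x - s))" by (rule C1_c_translate(1)[OF \<psi>]) auto
  qed
  have Fub: "(\<integral>x. W k x * \<psi> x \<partial>lborel) = (\<integral>y. kap j y * q k y \<partial>lborel)" for k
  proof -
    let ?g = "\<lambda>x y. (kap j y * ((u' (x + h' k *\<^sub>R y) - u' x) / h' k)) * \<psi> x"
    have int: "integrable (lborel \<Otimes>\<^sub>M lborel) (\<lambda>(x, y). ?g x y)"
    proof (rule Bochner_Integration.integrable_bound)
      show "integrable (lborel \<Otimes>\<^sub>M lborel) (\<lambda>(x, y). (2 * M / h' k) * (\<psi> x * kap j y))"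
      proof (rule lborel_pair.Fubini_integrable)
        show "integrable lborel (\<lambda>x. \<integral>y. norm (case (x, y) of (x, y) \<Rightarrow> (2 * M / h' k) * (\<psi> x * kap j y)) \<partial>lborel)"
          using C1_c_integrable(1)[OF \<psi>] by (simp add: abs_mult)
        show "AE x in lborel. integrable lborel (\<lambda>y. case (x, y) of (x, y) \<Rightarrow> (2 * M / h' k) * (\<psi> x * kap j y))"
          unfolding prod.case by (intro always_eventually allI integrable_mult_right integrable_kap)
      qed measurable
      show "(\<lambda>(x, y). ?g x y) \<in> borel_measurable (lborel \<Otimes>\<^sub>M lborel)" by measurable
      show "AE p in lborel \<Otimes>\<^sub>M lborel. norm (case p of (x, y) \<Rightarrow> ?g x y) \<le> norm (case p of (x, y) \<Rightarrow> (2 * M / h' k) * (\<psi> x * kap j y))"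
      proof (intro always_eventually allI)
        fix p :: "(real^'n) \<times> (real^'n)"
        obtain x y where p: "p = (x, y)" by (cases p)
        have "\<bar>u' (x + h' k *\<^sub>R y) - u' x\<bar> \<le> 2 * M" using u'b[of "x + h' k *\<^sub>R y"] u'b[of x] by linarith
        then have "\<bar>u' (x + h' k *\<^sub>R y) - u' x\<bar> / h' k \<le> 2 * M / h' k" using h'(1)[of k] by (intro divide_right_mono) auto
        then have "(\<bar>kap j y\<bar> * \<bar>\<psi> x\<bar>) * (\<bar>u' (x + h' k *\<^sub>R y) - u' x\<bar> / h' k) \<le> (\<bar>kap j y\<bar> * \<bar>\<psi> x\<bar>) * (2 * M / h' k)" by (intro mult_left_mono) auto
        then show "norm (case p of (x, y) \<Rightarrow> ?g x y) \<le> norm (case p of (x, y) \<Rightarrow> (2 * M / h' k) * (\<psi> x * kap j y))"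
          using h'(1)[of k] M by (simp add: p abs_mult mult_ac)
      qed
    qed
    have "(\<integral>x. W k x * \<psi> x \<partial>lborel) = (\<integral>x. (\<integral>y. ?g x y \<partial>lborel) \<partial>lborel)"
      unfolding W_def by simp
    also have "\<dots> = (\<integral>y. (\<integral>x. ?g x y \<partial>lborel) \<partial>lborel)"
      by (rule lborel_pair.Fubini_integral[symmetric]) (rule int)
    also have "\<dots> = (\<integral>y. kap j y * q k y \<partial>lborel)"
    proof (rule Bochner_Integration.integral_cong[OF refl])
      fix y
      have i1: "integrable lborel (\<lambda>x. u' (x + h' k *\<^sub>R y) * \<psi> x)"
        by (rule integrable_mult_C1_c(1)[OF integrable_translate[OF u'i] \<psi>])
      have i2: "integrable lborel (\<lambda>x. u' x * \<psi> x)" using iu\<psi>[of 0] by simp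
      have "(\<integral>x. u' x * \<psi> (x - h' k *\<^sub>R y) \<partial>lborel) = (\<integral>x. u' (x + h' k *\<^sub>R y) * \<psi> (x + h' k *\<^sub>R y - h' k *\<^sub>R y) \<partial>lborel)"
        by (rule lborel_integral_translate(1)[symmetric]) measurable
      then have tr: "(\<integral>x. u' x * \<psi> (x - h' k *\<^sub>R y) \<partial>lborel) = (\<integral>x. u' (x + h' k *\<^sub>R y) * \<psi> x \<partial>lborel)" by simp
      have "(\<integral>x. ?g x y \<partial>lborel) = (\<integral>x. (kap j y / h' k) * (u' (x + h' k *\<^sub>R y) * \<psi> x - u' x * \<psi> x) \<partial>lborel)"
        by (intro Bochner_Integration.integral_cong) (auto simp: field_simps)
      also have "\<dots> = (kap j y / h' k) * ((\<integral>x. u' (x + h' k *\<^sub>R y) * \<psi> x \<partial>lborel) - (\<integral>x. u' x * \<psi> x \<partial>lborel))"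
        using i1 i2 by simp
      also have "\<dots> = (kap j y / h' k) * (\<integral>x. u' x * \<psi> (x - h' k *\<^sub>R y) - u' x * \<psi> x \<partial>lborel)"
        using iu\<psi>[of "h' k *\<^sub>R y"] i2 tr by simp
      also have "\<dots> = kap j y * ((\<integral>x. u' x * \<psi> (x - h' k *\<^sub>R y) - u' x * \<psi> x \<partial>lborel) / h' k)" by simp
      also have "(\<integral>x. u' x * \<psi> (x - h' k *\<^sub>R y) - u' x * \<psi> x \<partial>lborel) / h' k = q k y"
        unfolding q_def by (subst integral_divide_zero[symmetric]) (simp add: field_simps)
      finally show "(\<integral>x. ?g x y \<partial>lborel) = kap j y * q k y" .
    qed
    finally show ?thesis .
  qed
  have qlim: "(\<lambda>k. q k y) \<longlonglongrightarrow> Lq y" for y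
  proof -
    have "((\<lambda>t. ((\<integral>x. u' x * \<psi> (x - (0 + t) *\<^sub>R y) \<partial>lborel) - (\<integral>x. u' x * \<psi> (x - 0 *\<^sub>R y) \<partial>lborel)) / t) \<longlongrightarrow> Lq y) (at 0)"
      using has_real_derivative_integral_translate[OF u'i \<psi>, of y 0] unfolding DERIV_def Lq_def by simp
    moreover have "filterlim h' (at 0) sequentially" using h' h'0 by (simp add: filterlim_at)
    ultimately have "(\<lambda>k. ((\<integral>x. u' x * \<psi> (x - (0 + h' k) *\<^sub>R y) \<partial>lborel) - (\<integral>x. u' x * \<psi> (x - 0 *\<^sub>R y) \<partial>lborel)) / h' k) \<longlonglongrightarrow> Lq y"
      by (rule filterlim_compose)
    moreover have "((\<integral>x. u' x * \<psi> (x - (0 + h' k) *\<^sub>R y) \<partial>lborel) - (\<integral>x. u' x * \<psi> (x - 0 *\<^sub>R y) \<partial>lborel)) / h' k = q k y" for k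
    proof -
      have "q k y = (\<integral>x. (u' x * \<psi> (x - h' k *\<^sub>R y) - u' x * \<psi> x) / h' k \<partial>lborel)"
        unfolding q_def by (simp only: right_diff_distrib times_divide_eq_right)
      also have "\<dots> = (\<integral>x. u' x * \<psi> (x - h' k *\<^sub>R y) - u' x * \<psi> x \<partial>lborel) / h' k"
        by (rule integral_divide_zero)
      finally show ?thesis using iu\<psi>[of "h' k *\<^sub>R y"] iu\<psi>[of 0] by simp
    qed
    ultimately show ?thesis by simp
  qed
  define N where "N = (\<integral>x. \<bar>u' x\<bar> \<partial>lborel)"
  have qb: "\<bar>q k y\<bar> \<le> C\<psi> * N * norm y" for k y
  proof -
    have "norm (q k y) \<le> (\<integral>x. (C\<psi> * norm y) * \<bar>u' x\<bar> \<partial>lborel)"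
      unfolding q_def
    proof (rule Bochner_Integration.integral_norm_bound_integral)
      show "integrable lborel (\<lambda>x. u' x * ((\<psi> (x - h' k *\<^sub>R y) - \<psi> x) / h' k))"
        using Bochner_Integration.integrable_diff[OF iu\<psi>[of "h' k *\<^sub>R y"] iu\<psi>[of 0]] by (simp add: right_diff_distrib)
      show "integrable lborel (\<lambda>x. (C\<psi> * norm y) * \<bar>u' x\<bar>)" using u'i by simp
      fix x
      have "\<bar>\<psi> (x - h' k *\<^sub>R y) - \<psi> x\<bar> \<le> C\<psi> * norm (h' k *\<^sub>R y)" using C\<psi>(3)[of "x - h' k *\<^sub>R y" x] by simp
      then have "\<bar>\<psi> (x - h' k *\<^sub>R y) - \<psi> x\<bar> / h' k \<le> C\<psi> * norm y" using h'(1)[of k] by (simp add: field_simps)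
      then show "norm (u' x * ((\<psi> (x - h' k *\<^sub>R y) - \<psi> x) / h' k)) \<le> (C\<psi> * norm y) * \<bar>u' x\<bar>"
        using h'(1)[of k] mult_left_mono[of "\<bar>\<psi> (x - h' k *\<^sub>R y) - \<psi> x\<bar> / h' k" "C\<psi> * norm y" "\<bar>u' x\<bar>"]
        by (simp add: abs_mult mult.commute[of "\<bar>u' x\<bar>"])
    qed
    then show ?thesis by (simp add: N_def mult_ac)
  qed
  have qm: "q k \<in> borel_measurable lborel" for k
    unfolding q_def by (rule lborel.borel_measurable_lebesgue_integral) measurable
  \<comment> \<open>The limit inherits the bound of the quotients. This makes \<open>Lq\<close> a
    bounded linear map, which the kernel evaluates at the j-th basis vector.\<close>
  have Lb: "\<bar>Lq y\<bar> \<le> C\<psi> * N * norm y" for y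
    by (rule LIMSEQ_le_const2[OF tendsto_rabs[OF qlim]]) (use qb in auto)
  have iu\<psi>': "integrable lborel (\<lambda>x. u' x * frechet_derivative \<psi> (at x) s)" for s
    by (rule integrable_mult_C1_c(2)[OF u'i \<psi>])
  have lin: "linear (frechet_derivative \<psi> (at x))" for x
    using C1_c_has_derivative[OF \<psi>] has_derivative_linear by blast
  have L: "bounded_linear Lq"
  proof (rule bounded_linear_intro[of _ "C\<psi> * N"])
    show "Lq (x + y) = Lq x + Lq y" for x y
      using iu\<psi>' by (simp add: Lq_def linear_add[OF lin] distrib_left)
    show "Lq (a *\<^sub>R x) = a *\<^sub>R Lq x" for a x
      by (simp add: Lq_def linear_scale[OF lin] mult.left_commute)
    show "norm (Lq x) \<le> norm x * (C\<psi> * N)" for x using Lb[of x] by (simp add: mult.commute)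
  qed
  have "(\<lambda>k. \<integral>y. kap j y * q k y \<partial>lborel) \<longlonglongrightarrow> (\<integral>y. kap j y * Lq y \<partial>lborel)"
  proof (rule integral_dominated_convergence[where w = "\<lambda>y. (C\<psi> * N) * \<bar>kap j y\<bar>"])
    show "(\<lambda>y. kap j y * Lq y) \<in> borel_measurable lborel" using bounded_linear_bound_ball(1)[OF L] by measurable
    show "(\<lambda>y. kap j y * q k y) \<in> borel_measurable lborel" for k using qm by measurable
    show "integrable lborel (\<lambda>y. (C\<psi> * N) * \<bar>kap j y\<bar>)" by (intro integrable_mult_right integrable_abs integrable_kap)
    show "AE y in lborel. (\<lambda>k. kap j y * q k y) \<longlonglongrightarrow> kap j y * Lq y"
      by (intro always_eventually allI tendsto_intros qlim)
    show "AE y in lborel. norm (kap j y * q k y) \<le> (C\<psi> * N) * \<bar>kap j y\<bar>" for k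
    proof (intro always_eventually allI)
      fix y show "norm (kap j y * q k y) \<le> (C\<psi> * N) * \<bar>kap j y\<bar>"
      proof (cases "y \<in> ball 0 1")
        case True
        have N0: "C\<psi> * N \<ge> 0" using C\<psi>(1) by (simp add: N_def)
        have "\<bar>q k y\<bar> \<le> C\<psi> * N" using qb[of k y] mult_left_mono[of "norm y" 1 "C\<psi> * N"] True N0 by simp
        then show ?thesis by (simp add: abs_mult mult.commute[of "\<bar>kap j y\<bar>"] mult_right_mono)
      qed (use kap_bound[of j y] in auto)
    qed
  qed
  moreover have "(\<integral>x. W k x * \<psi> x \<partial>lebesgue) = (\<integral>y. kap j y * q k y \<partial>lborel)" for k
    unfolding Fub[symmetric] using Wm[of k] by (intro integral_completion borel_measurable_times) auto
  ultimately have "(\<lambda>k. \<integral>x. W k x * \<psi> x \<partial>lebesgue) \<longlonglongrightarrow> - c0 * Lq (axis j 1)"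
    using integral_kap_linear[OF L, of j] by (simp add: c0_def)
  then have "(\<integral>x. - c0 * w x * \<psi> x \<partial>lebesgue) = - c0 * Lq (axis j 1)" using lim1 LIMSEQ_unique by blast
  moreover have "(\<integral>x. - c0 * w x * \<psi> x \<partial>lebesgue) = - c0 * (\<integral>x. w x * \<psi> x \<partial>lebesgue)"
    by (simp only: mult.assoc integral_mult_right_zero)
  ultimately have "(\<integral>x. w x * \<psi> x \<partial>lebesgue) = Lq (axis j 1)" using c0 by simp
  moreover have "(\<integral>x. u x * frechet_derivative \<psi> (at x) (axis j 1) \<partial>lebesgue) = (\<integral>x. u' x * frechet_derivative \<psi> (at x) (axis j 1) \<partial>lborel)"
  proof -
    have "(\<integral>x. u x * frechet_derivative \<psi> (at x) (axis j 1) \<partial>lebesgue) = (\<integral>x. u' x * frechet_derivative \<psi> (at x) (axis j 1) \<partial>lebesgue)"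
    proof (rule integral_cong_AE)
      show "(\<lambda>x. u x * frechet_derivative \<psi> (at x) (axis j 1)) \<in> borel_measurable lebesgue"
        using u(1) by (intro borel_measurable_times measurable_completion[of "\<lambda>x. frechet_derivative \<psi> (at x) (axis j 1)"]) auto
      show "(\<lambda>x. u' x * frechet_derivative \<psi> (at x) (axis j 1)) \<in> borel_measurable lebesgue"
        by (rule measurable_completion) measurable
      show "AE x in lebesgue. u x * frechet_derivative \<psi> (at x) (axis j 1) = u' x * frechet_derivative \<psi> (at x) (axis j 1)"
        using uu' by eventually_elim simp
    qed
    also have "\<dots> = (\<integral>x. u' x * frechet_derivative \<psi> (at x) (axis j 1) \<partial>lborel)" by (rule integral_completion) measurable
    finally show ?thesis .
  qed
  ultimately show ?thesis by (simp add: Lq_def)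
qed

section \<open>Q-points\<close>

text \<open>Completeness of Lebesgue measure: the preimages under f and g differ by a null
  set.\<close>

lemma borel_measurable_cong_AE_lebesgue:
  fixes f g :: "'a::euclidean_space \<Rightarrow> real"
  assumes "f \<in> borel_measurable lebesgue" "AE x in lebesgue. f x = g x"
  shows "g \<in> borel_measurable lebesgue"
proof (rule measurableI)
  fix B :: "real set" assume B: "B \<in> sets borel"
  show "g -` B \<inter> space lebesgue \<in> sets lebesgue"
  proof (rule completion.in_sets_AE)
    show "f -` B \<inter> space lebesgue \<in> sets lebesgue" by (rule measurable_sets[OF assms(1) B])
    show "AE x in lebesgue. (x \<in> f -` B \<inter> space lebesgue) = (x \<in> g -` B \<inter> space lebesgue)"
      using assms(2) by eventually_elim auto
  qed auto
qed auto

lemma integral_cong_AE_lebesgue: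
  fixes f g :: "'a::euclidean_space \<Rightarrow> real"
  assumes "f \<in> borel_measurable lebesgue" "AE x in lebesgue. f x = g x"
  shows "integral\<^sup>L lebesgue f = integral\<^sup>L lebesgue g"
  by (rule integral_cong_AE[OF assms(1) borel_measurable_cong_AE_lebesgue[OF assms] assms(2)])

text \<open>Thus a matching with the affine values of a jet lifts to a matching with the sheets of
  the jet.\<close>

lemma mset_eq_image_mset:
  "mset ys = image_mset f J \<Longrightarrow> \<exists>js. mset js = J \<and> ys = map f js"
proof (induction ys arbitrary: J)
  case (Cons y ys)
  then have "image_mset f J = add_mset y (mset ys)" by simp
  from msed_map_invR[OF this] obtain M1 a where M: "J = add_mset a M1" "f a = y" "image_mset f M1 = mset ys" by auto
  from Cons.IH[OF M(3)[symmetric]] obtain js where "mset js = M1" "ys = map f js" by auto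
  then show ?case using M by (intro exI[of _ "a # js"]) auto
qed auto

lemma sum_mset_eq_sum_nth:
  fixes \<phi> :: "'a \<Rightarrow> real"
  assumes "mset xs = T"
  shows "(\<Sum>x\<in>#T. \<phi> x) = (\<Sum>l<size T. \<phi> (xs ! l))"
proof -
  have "(\<Sum>x\<in>#T. \<phi> x) = sum_list (map \<phi> xs)" by (simp add: assms[symmetric] flip: mset_map sum_mset_sum_list)
  also have "\<dots> = (\<Sum>l<size T. \<phi> (xs ! l))" by (simp add: sum_list_sum_nth assms[symmetric] atLeast0LessThan)
  finally show ?thesis .
qed

text \<open>The minimum runs over finitely many enumerations, so it is attained, and a single
  squared distance is at most the whole sum.\<close>

lemma Gdist_matching:
  fixes T S :: "'e::euclidean_space multiset"
  assumes "size T = size S"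
  obtains xs ys where "mset xs = T" "mset ys = S" "0 \<le> Gdist T S"
    "\<And>l. l < size T \<Longrightarrow> norm (xs ! l - ys ! l) \<le> Gdist T S"
proof -
  let ?c = "\<lambda>xs ys. sqrt (\<Sum>l<size T. (norm (xs ! l - ys ! l))\<^sup>2)"
  define D where "D = {?c xs ys | xs ys. mset xs = T \<and> mset ys = S}"
  have fin: "finite {xs. mset xs = M}" for M :: "'e multiset"
    by (rule finite_subset[OF _ finite_lists_length_eq[of "set_mset M" "size M"]]) auto
  have "D = (\<lambda>(xs, ys). ?c xs ys) ` ({xs. mset xs = T} \<times> {ys. mset ys = S})" by (auto simp: D_def)
  then have "finite D" using fin by simp
  moreover have "D \<noteq> {}" using ex_mset[of T] ex_mset[of S] by (auto simp: D_def)
  ultimately have "Gdist T S \<in> D" unfolding Gdist_def D_def[symmetric] by (rule Min_in)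
  then obtain xs ys where xy: "Gdist T S = ?c xs ys" "mset xs = T" "mset ys = S" by (auto simp: D_def)
  have "norm (xs ! l - ys ! l) \<le> Gdist T S" if "l < size T" for l
  proof -
    have "(norm (xs ! l - ys ! l))\<^sup>2 \<le> (\<Sum>l<size T. (norm (xs ! l - ys ! l))\<^sup>2)"
      using that by (intro member_le_sum) auto
    then show ?thesis unfolding xy(1) by (rule real_le_rsqrt)
  qed
  moreover have "0 \<le> Gdist T S" unfolding xy(1) by (intro real_sqrt_ge_zero sum_nonneg) auto
  ultimately show ?thesis using that xy by blast
qed

text \<open>The modulus is required only at the points p of S, with q arbitrary, so it may depend on
  S: the pairings below have constants that grow with p. A general b serves both linear and
  quadratic growth.\<close>

lemma sum_mset_diff_le_Gdist:
  fixes T S :: "'e::euclidean_space multiset" and \<phi> :: "'e \<Rightarrow> real"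
  assumes s: "size T = size S" and b: "\<And>p q. p \<in># S \<Longrightarrow> \<bar>\<phi> q - \<phi> p\<bar> \<le> b (norm (q - p))"
    and mono: "\<And>s t. 0 \<le> s \<Longrightarrow> s \<le> t \<Longrightarrow> b s \<le> b t"
  shows "\<bar>(\<Sum>x\<in>#T. \<phi> x) - (\<Sum>x\<in>#S. \<phi> x)\<bar> \<le> real (size S) * b (Gdist T S)"
proof -
  obtain xs ys where xy: "mset xs = T" "mset ys = S" "0 \<le> Gdist T S"
    "\<And>l. l < size T \<Longrightarrow> norm (xs ! l - ys ! l) \<le> Gdist T S" using Gdist_matching[OF s] by blast
  have "\<bar>(\<Sum>x\<in>#T. \<phi> x) - (\<Sum>x\<in>#S. \<phi> x)\<bar> = \<bar>\<Sum>l<size S. \<phi> (xs ! l) - \<phi> (ys ! l)\<bar>"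
    by (simp add: sum_mset_eq_sum_nth[OF xy(1)] sum_mset_eq_sum_nth[OF xy(2)] s sum_subtractf)
  also have "\<dots> \<le> (\<Sum>l<size S. \<bar>\<phi> (xs ! l) - \<phi> (ys ! l)\<bar>)" by (rule sum_abs)
  also have "\<dots> \<le> (\<Sum>l<size S. b (Gdist T S))"
  proof (rule sum_mono)
    fix l assume "l \<in> {..<size S}"
    then have l: "l < size S" by simp
    then have "ys ! l \<in># S" using xy(2) by (metis nth_mem set_mset_mset size_mset)
    then have "\<bar>\<phi> (xs ! l) - \<phi> (ys ! l)\<bar> \<le> b (norm (xs ! l - ys ! l))" by (rule b)
    also have "\<dots> \<le> b (Gdist T S)" using xy(4) l s by (intro mono) auto
    finally show "\<bar>\<phi> (xs ! l) - \<phi> (ys ! l)\<bar> \<le> b (Gdist T S)" .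
  qed
  also have "\<dots> = real (size S) * b (Gdist T S)" by simp
  finally show ?thesis .
qed

text \<open>One \<delta> works for the finitely many points of S. This continuity serves to prove
  measurability of sums over sheets.\<close>

lemma sum_mset_continuous_Gdist:
  fixes S :: "'e::euclidean_space multiset" and \<phi> :: "'e \<Rightarrow> real"
  assumes \<phi>: "continuous_on UNIV \<phi>" and e: "e > 0"
  obtains \<delta> where "\<delta> > 0" "\<And>T. size T = size S \<Longrightarrow> Gdist T S < \<delta> \<Longrightarrow> \<bar>(\<Sum>x\<in>#T. \<phi> x) - (\<Sum>x\<in>#S. \<phi> x)\<bar> < e"
proof -
  define e' where "e' = e / (real (size S) + 1)"
  have e': "e' > 0" using e by (simp add: e'_def add_nonneg_pos)
  have "\<forall>p\<in>set_mset S. \<forall>\<^sub>F \<delta> in at_right 0. \<forall>q. norm (q - p) \<le> \<delta> \<longrightarrow> \<bar>\<phi> q - \<phi> p\<bar> \<le> e'"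
  proof
    fix p assume "p \<in># S"
    obtain d where d: "d > 0" "\<And>q. dist q p < d \<Longrightarrow> dist (\<phi> q) (\<phi> p) < e'"
      using \<phi> e' unfolding continuous_on_iff by (metis UNIV_I)
    have "\<bar>\<phi> q - \<phi> p\<bar> \<le> e'" if "norm (q - p) < d" for q
      using d(2)[of q] that by (simp add: dist_norm)
    then show "\<forall>\<^sub>F \<delta> in at_right 0. \<forall>q. norm (q - p) \<le> \<delta> \<longrightarrow> \<bar>\<phi> q - \<phi> p\<bar> \<le> e'"
      unfolding eventually_at_right_field using d(1) by (intro exI[of _ d]) auto
  qed
  then have "\<forall>\<^sub>F \<delta> in at_right 0. \<forall>p\<in>set_mset S. \<forall>q. norm (q - p) \<le> \<delta> \<longrightarrow> \<bar>\<phi> q - \<phi> p\<bar> \<le> e'"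
    by (intro eventually_ball_finite) auto
  then obtain d where d: "d > 0" "\<And>\<delta>. 0 < \<delta> \<Longrightarrow> \<delta> < d \<Longrightarrow> \<forall>p\<in>set_mset S. \<forall>q. norm (q - p) \<le> \<delta> \<longrightarrow> \<bar>\<phi> q - \<phi> p\<bar> \<le> e'"
    unfolding eventually_at_right_field by auto
  show ?thesis
  proof (rule that[of "d / 2"])
    show "d / 2 > 0" using d by simp
    fix T assume T: "size T = size S" "Gdist T S < d / 2"
    obtain xs ys where xy: "mset xs = T" "mset ys = S"
      "\<And>l. l < size T \<Longrightarrow> norm (xs ! l - ys ! l) \<le> Gdist T S" using Gdist_matching[OF T(1)] by blast
    have "\<bar>(\<Sum>x\<in>#T. \<phi> x) - (\<Sum>x\<in>#S. \<phi> x)\<bar> = \<bar>\<Sum>l<size S. \<phi> (xs ! l) - \<phi> (ys ! l)\<bar>"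
      by (simp add: sum_mset_eq_sum_nth[OF xy(1)] sum_mset_eq_sum_nth[OF xy(2)] T(1) sum_subtractf)
    also have "\<dots> \<le> (\<Sum>l<size S. \<bar>\<phi> (xs ! l) - \<phi> (ys ! l)\<bar>)" by (rule sum_abs)
    also have "\<dots> \<le> (\<Sum>l<size S. e')"
    proof (rule sum_mono)
      fix l assume "l \<in> {..<size S}"
      then have l: "l < size S" by simp
      then have "ys ! l \<in># S" using xy(2) by (metis nth_mem set_mset_mset size_mset)
      moreover have "norm (xs ! l - ys ! l) \<le> d / 2" using xy(3)[of l] l T by simp
      ultimately show "\<bar>\<phi> (xs ! l) - \<phi> (ys ! l)\<bar> \<le> e'" using d(2)[of "d / 2"] d(1) by auto
    qed
    also have "\<dots> = e * (real (size S) / (real (size S) + 1))" by (simp add: e'_def)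
    also have "\<dots> < e" using e by (simp add: field_simps)
    finally show "\<bar>(\<Sum>x\<in>#T. \<phi> x) - (\<Sum>x\<in>#S. \<phi> x)\<bar> < e" .
  qed
qed

section \<open>A chain rule at an approximate jet\<close>

lemma density_one_AE:
  assumes F: "density_one F x" and d: "\<delta> > 0" and P: "AE z in lebesgue. z \<in> ball x \<delta> \<longrightarrow> P z"
  obtains F' where "density_one F' x" "F' \<subseteq> F" "\<And>z. z \<in> F' \<Longrightarrow> P z"
proof -
  obtain N where N: "N \<in> null_sets lebesgue" "\<And>z. z \<notin> N \<Longrightarrow> z \<in> ball x \<delta> \<longrightarrow> P z"
    using P by (auto simp: eventually_ae_filter)
  define F' where "F' = (F - N) \<inter> ball x \<delta>"
  have Fm: "F \<in> sets lebesgue" using F by (simp add: density_one_def)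
  have F'm: "F' \<in> sets lebesgue" unfolding F'_def using Fm null_setsD2[OF N(1)] by (intro sets.Int sets.Diff) auto
  have eq: "measure lebesgue (F' \<inter> ball x r) = measure lebesgue (F \<inter> ball x r)" if "r < \<delta>" for r
  proof -
    have "F' \<inter> ball x r = (F \<inter> ball x r) - N" using that by (auto simp: F'_def)
    moreover have "F \<inter> ball x r \<in> sets lebesgue" using Fm by (intro sets.Int) auto
    ultimately show ?thesis using measure_Diff_null_set[OF _ N(1), of "F \<inter> ball x r"] by simp
  qed
  have "((\<lambda>r. measure lebesgue (F' \<inter> ball x r) / measure lebesgue (ball x r)) \<longlongrightarrow> 1) (at_right 0)"
  proof (rule Lim_transform_eventually)
    show "((\<lambda>r. measure lebesgue (F \<inter> ball x r) / measure lebesgue (ball x r)) \<longlongrightarrow> 1) (at_right 0)"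
      using F by (simp add: density_one_def)
    show "\<forall>\<^sub>F r in at_right 0. measure lebesgue (F \<inter> ball x r) / measure lebesgue (ball x r) = measure lebesgue (F' \<inter> ball x r) / measure lebesgue (ball x r)"
      unfolding eventually_at_right_field using d eq by (intro exI[of _ \<delta>]) auto
  qed
  then have "density_one F' x" using F'm by (simp add: density_one_def)
  then show ?thesis using N(2) by (intro that[of F']) (auto simp: F'_def)
qed

lemma bounded_linear_hom_apply: "bounded_linear (hom_apply A)"
proof -
  have "bounded_linear (\<lambda>h. \<Sum>i\<in>UNIV. (h $ i) *\<^sub>R (A $ i))"
    by (intro bounded_linear_sum bounded_linear_scaleR_const bounded_linear_vec_nth)
  then show ?thesis by (simp add: hom_apply_def[abs_def])
qed

lemma hom_apply_axis: "hom_apply A (axis i 1) = A $ i"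
proof -
  have "hom_apply A (axis i 1) = (\<Sum>j\<in>UNIV. if j = i then A $ j else 0)"
    unfolding hom_apply_def by (intro sum.cong) (auto simp: axis_def)
  then show ?thesis by simp
qed

text \<open>The same \<epsilon> bounds \<open>norm s\<close> and the relative deviation from the
  affine value. As an eventuality in \<epsilon>, the estimate can be intersected over the finitely
  many sheets.\<close>

lemma differentiable_jet_remainder:
  fixes \<phi> :: "'e::euclidean_space \<Rightarrow> real" and A :: "'e^'n"
  assumes d: "(\<phi> has_derivative \<phi>') (at a)" and e: "e > 0"
  shows "\<forall>\<^sub>F \<epsilon> in at_right 0. \<forall>s z. 0 < norm s \<longrightarrow> norm s < \<epsilon> \<longrightarrow> norm (z - (a + hom_apply A s)) \<le> \<epsilon> * norm s \<longrightarrow>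
     \<bar>\<phi> z - \<phi> a - \<phi>' (hom_apply A s)\<bar> \<le> e * norm s"
proof -
  have bl: "bounded_linear \<phi>'" using d by (rule has_derivative_bounded_linear)
  obtain K where K: "K \<ge> 0" "\<And>y. norm (\<phi>' y) \<le> norm y * K" using bounded_linear.nonneg_bounded[OF bl] by blast
  obtain B where B: "B \<ge> 0" "\<And>s. norm (hom_apply A s) \<le> norm s * B" using bounded_linear.nonneg_bounded[OF bounded_linear_hom_apply] by blast
  \<comment> \<open>Half of e goes to the remainder of \<phi> at z, where
    \<open>norm (z - a)\<close> is at most \<open>(1 + B) * norm s\<close>; the other half goes to
    \<phi>' of the deviation, at most \<open>\<epsilon> * K * norm s\<close>.\<close>
  define e' where "e' = e / (2 * (1 + B))"
  have e': "e' > 0" using e B by (simp add: e'_def add_pos_nonneg)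
  obtain \<eta> where \<eta>: "\<eta> > 0" "\<And>z. norm (z - a) < \<eta> \<Longrightarrow> norm (\<phi> z - \<phi> a - \<phi>' (z - a)) \<le> e' * norm (z - a)"
    using d e' unfolding has_derivative_at_alt by blast
  define \<epsilon>0 where "\<epsilon>0 = min 1 (min (\<eta> / (1 + B)) (e / (2 * (K + 1))))"
  have \<epsilon>0: "\<epsilon>0 > 0" using \<eta>(1) B e K by (simp add: \<epsilon>0_def add_pos_nonneg add_nonneg_pos)
  have "\<bar>\<phi> z - \<phi> a - \<phi>' (hom_apply A s)\<bar> \<le> e * norm s"
    if \<epsilon>: "0 < \<epsilon>" "\<epsilon> < \<epsilon>0" and s: "0 < norm s" "norm s < \<epsilon>" and z: "norm (z - (a + hom_apply A s)) \<le> \<epsilon> * norm s" for \<epsilon> s z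
  proof -
    have \<epsilon>': "\<epsilon> < 1" "\<epsilon> * (1 + B) < \<eta>" "\<epsilon> * (2 * (K + 1)) < e"
      using \<epsilon> B K by (auto simp: \<epsilon>0_def pos_less_divide_eq add_pos_nonneg add_nonneg_pos)
    have "norm (z - a) \<le> norm (z - (a + hom_apply A s)) + norm (hom_apply A s)"
      using norm_triangle_ineq[of "z - (a + hom_apply A s)" "hom_apply A s"] by (simp add: algebra_simps)
    also have "\<dots> \<le> \<epsilon> * norm s + norm s * B" using z B(2) by (intro add_mono)
    also have "\<dots> \<le> 1 * norm s + norm s * B" using \<epsilon>'(1) by (intro add_right_mono mult_right_mono) auto
    finally have za: "norm (z - a) \<le> (1 + B) * norm s" by (simp add: algebra_simps)
    also have "\<dots> \<le> (1 + B) * \<epsilon>" using s B by (intro mult_left_mono) auto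
    also have "\<dots> < \<eta>" using \<epsilon>'(2) by (simp add: mult.commute)
    finally have "norm (\<phi> z - \<phi> a - \<phi>' (z - a)) \<le> e' * norm (z - a)" by (rule \<eta>(2))
    also have "\<dots> \<le> e' * ((1 + B) * norm s)" using za e' by (intro mult_left_mono) auto
    also have "\<dots> = e / 2 * norm s" using B by (simp add: e'_def field_simps)
    finally have 1: "\<bar>\<phi> z - \<phi> a - \<phi>' (z - a)\<bar> \<le> e / 2 * norm s" by simp
    have "\<phi>' (z - a) - \<phi>' (hom_apply A s) = \<phi>' (z - (a + hom_apply A s))"
      using bounded_linear.linear[OF bl] by (simp add: linear_diff[symmetric] algebra_simps)
    moreover have "norm (\<phi>' (z - (a + hom_apply A s))) \<le> norm (z - (a + hom_apply A s)) * K" by (rule K(2))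
    ultimately have "\<bar>\<phi>' (z - a) - \<phi>' (hom_apply A s)\<bar> \<le> (\<epsilon> * norm s) * K"
      using mult_right_mono[OF z K(1)] by simp
    also have "\<dots> \<le> e / 2 * norm s"
    proof -
      have "\<epsilon> * K \<le> e / 2" using \<epsilon>'(3) \<epsilon>(1) by (simp add: algebra_simps)
      then show ?thesis using mult_right_mono[of "\<epsilon> * K" "e / 2" "norm s"] by (simp add: mult_ac)
    qed
    finally show ?thesis using 1 by linarith
  qed
  then show ?thesis unfolding eventually_at_right_field using \<epsilon>0 by (intro exI[of _ \<epsilon>0]) auto
qed

text \<open>Near x the values of W are matched with the affine values of J up to a small multiple of
  \<open>norm s\<close>, the matching lifts to the sheets, and the first-order expansions of \<phi>
  are summed. It is applied both to v with its first jet and to \<open>j1 v\<close> with the jet of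
  \<open>j1 v\<close>.\<close>

lemma approx_derivative_sum_mset:
  fixes W :: "real^'n \<Rightarrow> 'e::euclidean_space multiset" and \<phi> :: "'e \<Rightarrow> real" and t :: "real^'n \<Rightarrow> real"
  assumes J: "is_approx_jet W x J" and Q: "size J = Q" and d: "\<delta> > 0"
    and ae: "AE z in lebesgue. z \<in> ball x \<delta> \<longrightarrow> size (W z) = Q \<and> t z = (\<Sum>a\<in>#W z. \<phi> a)"
    and tx: "t x = (\<Sum>a\<in>#W x. \<phi> a)"
    and \<phi>: "\<And>p. p \<in># J \<Longrightarrow> (\<phi> has_derivative \<phi>' (fst p)) (at (fst p))"
  shows "approx_derivative t x (\<lambda>s. \<Sum>p\<in>#J. \<phi>' (fst p) (hom_apply (snd p) s))"
proof -
  let ?m = "\<lambda>s. image_mset (\<lambda>(a, A). a + hom_apply A s) J"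
  obtain F0 where F0: "density_one F0 x" and W: "W x = image_mset fst J"
    and lim0: "((\<lambda>h. Gdist (W (x + h)) (?m h) / norm h) \<longlongrightarrow> 0) (at 0 within {h. x + h \<in> F0})"
    using J unfolding is_approx_jet_def by auto
  \<comment> \<open>The set is thinned by a null set and cut to a small ball, so that the size and
    the formula for t hold at each of its points.\<close>
  obtain F where F: "density_one F x" "F \<subseteq> F0" and FP: "\<And>z. z \<in> F \<Longrightarrow> size (W z) = Q \<and> t z = (\<Sum>a\<in>#W z. \<phi> a)"
    using density_one_AE[OF F0 d ae] by blast
  have lim: "((\<lambda>h. Gdist (W (x + h)) (?m h) / norm h) \<longlongrightarrow> 0) (at 0 within {h. x + h \<in> F})"
    by (rule tendsto_within_subset[OF lim0]) (use F(2) in auto)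
  obtain js where js: "mset js = J" using ex_mset by blast
  let ?L = "\<lambda>s. \<Sum>p\<in>#J. \<phi>' (fst p) (hom_apply (snd p) s)"
  have bl: "bounded_linear ?L"
  proof -
    have "bounded_linear (\<lambda>s. \<Sum>l<size J. \<phi>' (fst (js ! l)) (hom_apply (snd (js ! l)) s))"
    proof (intro bounded_linear_sum)
      fix l assume "l \<in> {..<size J}"
      then have "js ! l \<in># J" using js by (metis lessThan_iff nth_mem set_mset_mset size_mset)
      from bounded_linear_compose[OF has_derivative_bounded_linear[OF \<phi>[OF this]] bounded_linear_hom_apply]
      show "bounded_linear (\<lambda>s. \<phi>' (fst (js ! l)) (hom_apply (snd (js ! l)) s))" .
    qed
    then show ?thesis by (simp add: sum_mset_eq_sum_nth[OF js])
  qed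
  have "((\<lambda>s. (t (x + s) - t x - ?L s) / norm s) \<longlongrightarrow> 0) (at 0 within {s. x + s \<in> F})"
  proof (rule tendstoI)
    fix e :: real assume "e > 0"
    define e' where "e' = e / (real Q + 1)"
    have e': "e' > 0" using \<open>e > 0\<close> by (simp add: e'_def add_nonneg_pos)
    have "\<forall>\<^sub>F \<epsilon> in at_right 0. \<forall>p\<in>set_mset J. \<forall>s z. 0 < norm s \<longrightarrow> norm s < \<epsilon> \<longrightarrow> norm (z - (fst p + hom_apply (snd p) s)) \<le> \<epsilon> * norm s \<longrightarrow>
       \<bar>\<phi> z - \<phi> (fst p) - \<phi>' (fst p) (hom_apply (snd p) s)\<bar> \<le> e' * norm s"
      by (intro eventually_ball_finite ballI differentiable_jet_remainder \<phi> e') auto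
    moreover have "\<forall>\<^sub>F \<epsilon> in at_right 0. (0::real) < \<epsilon>" by (rule eventually_at_right_less)
    ultimately obtain \<epsilon> where \<epsilon>: "\<epsilon> > 0" and rem: "\<And>p s z. p \<in># J \<Longrightarrow> 0 < norm s \<Longrightarrow> norm s < \<epsilon> \<Longrightarrow>
       norm (z - (fst p + hom_apply (snd p) s)) \<le> \<epsilon> * norm s \<Longrightarrow> \<bar>\<phi> z - \<phi> (fst p) - \<phi>' (fst p) (hom_apply (snd p) s)\<bar> \<le> e' * norm s"
      using eventually_happens[OF eventually_conj] trivial_limit_at_right_real by (metis (mono_tags, lifting))
    have "\<forall>\<^sub>F s in at 0 within {s. x + s \<in> F}. Gdist (W (x + s)) (?m s) / norm s < \<epsilon>"
      using order_tendstoD(2)[OF lim \<epsilon>] .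
    moreover have "\<forall>\<^sub>F s in at 0 within {s. x + s \<in> F}. s \<noteq> 0 \<and> x + s \<in> F \<and> norm s < \<epsilon>"
      using \<epsilon> by (auto simp: eventually_at intro!: exI[of _ \<epsilon>])
    ultimately show "\<forall>\<^sub>F s in at 0 within {s. x + s \<in> F}. dist ((t (x + s) - t x - ?L s) / norm s) 0 < e"
    proof eventually_elim
      case (elim s)
      have sF: "x + s \<in> F" and s0: "norm s > 0" "norm s < \<epsilon>" using elim by auto
      have sz: "size (W (x + s)) = size (?m s)" using FP[OF sF] Q by simp
      obtain zs ys where zy: "mset zs = W (x + s)" "mset ys = ?m s" 
        "\<And>l. l < size (W (x + s)) \<Longrightarrow> norm (zs ! l - ys ! l) \<le> Gdist (W (x + s)) (?m s)"
        using Gdist_matching[OF sz] by blast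
      \<comment> \<open>Here the matching with affine values becomes an enumeration of the
        sheets.\<close>
      obtain ps where ps: "mset ps = J" "ys = map (\<lambda>(a, A). a + hom_apply A s) ps"
        using mset_eq_image_mset[OF zy(2)] by blast
      have len: "length ps = Q" using ps(1) Q by auto
      have tz: "t (x + s) = (\<Sum>l<Q. \<phi> (zs ! l))" using FP[OF sF] sum_mset_eq_sum_nth[OF zy(1), of \<phi>] by simp
      have tx': "t x = (\<Sum>l<Q. \<phi> (fst (ps ! l)))"
        using tx sum_mset_eq_sum_nth[OF ps(1), of "\<lambda>p. \<phi> (fst p)"] Q by (simp add: W image_mset.compositionality o_def)
      have Ls: "?L s = (\<Sum>l<Q. \<phi>' (fst (ps ! l)) (hom_apply (snd (ps ! l)) s))"
        using sum_mset_eq_sum_nth[OF ps(1)] Q by simp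
      have "\<bar>t (x + s) - t x - ?L s\<bar> = \<bar>\<Sum>l<Q. \<phi> (zs ! l) - \<phi> (fst (ps ! l)) - \<phi>' (fst (ps ! l)) (hom_apply (snd (ps ! l)) s)\<bar>"
        unfolding tz tx' Ls by (simp add: sum_subtractf)
      also have "\<dots> \<le> (\<Sum>l<Q. \<bar>\<phi> (zs ! l) - \<phi> (fst (ps ! l)) - \<phi>' (fst (ps ! l)) (hom_apply (snd (ps ! l)) s)\<bar>)" by (rule sum_abs)
      also have "\<dots> \<le> (\<Sum>l<Q. e' * norm s)"
      proof (intro sum_mono rem s0)
        fix l assume "l \<in> {..<Q}"
        then have l: "l < Q" by simp
        show "ps ! l \<in># J" using ps(1) len l by (metis nth_mem set_mset_mset)
        have "ys ! l = fst (ps ! l) + hom_apply (snd (ps ! l)) s" using ps(2) len l by (simp add: case_prod_beta)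
        moreover have "norm (zs ! l - ys ! l) \<le> Gdist (W (x + s)) (?m s)" using zy(3)[of l] FP[OF sF] l by simp
        moreover have "Gdist (W (x + s)) (?m s) \<le> \<epsilon> * norm s" using elim(1) s0 by (simp add: field_simps)
        ultimately show "norm (zs ! l - (fst (ps ! l) + hom_apply (snd (ps ! l)) s)) \<le> \<epsilon> * norm s" by simp
      qed
      also have "\<dots> = (e * (real Q / (real Q + 1))) * norm s" by (simp add: e'_def)
      also have "\<dots> < e * norm s" using \<open>e > 0\<close> s0 by (intro mult_strict_right_mono) (auto simp: field_simps)
      finally show ?case using s0 by (simp add: dist_norm field_simps)
    qed
  qed
  then show ?thesis unfolding approx_derivative_def using bl F(1) by (intro conjI exI[of _ F])
qed

text \<open>A sum over sheets is continuous in the coordinates, but Q-points carry no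
  \<sigma>-algebra here. The coordinates are discretised on a grid of mesh
  \<open>1 / real (Suc m)\<close>, and each cell receives the value of t at one point of A in it.
  These step functions are measurable and converge to t on A.\<close>

lemma borel_measurable_continuous_coordinates:
  fixes f :: "nat \<Rightarrow> 'a \<Rightarrow> real" and t :: "'a \<Rightarrow> real"
  assumes A: "A \<in> sets M" and f: "\<And>j. j < N \<Longrightarrow> f j \<in> borel_measurable M"
    and c: "\<And>z e. z \<in> A \<Longrightarrow> e > 0 \<Longrightarrow> \<exists>\<delta>>0. \<forall>z'\<in>A. (\<forall>j<N. \<bar>f j z' - f j z\<bar> < \<delta>) \<longrightarrow> \<bar>t z' - t z\<bar> < e"
  shows "(\<lambda>z. indicator A z * t z) \<in> borel_measurable M"
proof -
  define code where "code = (\<lambda>m z. map (\<lambda>j. \<lfloor>real (Suc m) * f j z\<rfloor>) [0..<N])"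
  define t' where "t' = (\<lambda>m c. t (SOME z'. z' \<in> A \<and> code m z' = c))"
  \<comment> \<open>Codes lie in the countable set of integer lists, so measurability reduces to
    single codes, and any choice of representatives is measurable.\<close>
  have codem: "code m \<in> M \<rightarrow>\<^sub>M count_space UNIV" for m
    unfolding measurable_count_space_eq2_countable
  proof safe
    fix c :: "int list"
    show "code m -` {c} \<inter> space M \<in> sets M"
    proof (cases "length c = N")
      case True
      have "code m -` {c} \<inter> space M = {z \<in> space M. \<forall>j\<in>{..<N}. \<lfloor>real (Suc m) * f j z\<rfloor> = c ! j}"
      proof -
        have "code m z = c \<longleftrightarrow> (\<forall>j<N. \<lfloor>real (Suc m) * f j z\<rfloor> = c ! j)" for z
          unfolding code_def list_eq_iff_nth_eq using True by (simp del: of_nat_Suc)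
        then show ?thesis by (simp del: of_nat_Suc add: set_eq_iff) blast
      qed
      moreover have "{z \<in> space M. \<forall>j\<in>{..<N}. \<lfloor>real (Suc m) * f j z\<rfloor> = c ! j} \<in> sets M"
      proof (rule sets.sets_Collect_finite_All)
        fix j assume "j \<in> {..<N}"
        then have [measurable]: "f j \<in> borel_measurable M" using f by simp
        show "{z \<in> space M. \<lfloor>real (Suc m) * f j z\<rfloor> = c ! j} \<in> sets M" by measurable
      qed simp
      ultimately show ?thesis by simp
    next
      case False
      then have "code m -` {c} \<inter> space M = {}" by (auto simp: code_def)
      then show ?thesis by simp
    qed
  qed auto
  have meas: "(\<lambda>z. indicator A z * t' m (code m z)) \<in> borel_measurable M" for m
    using A by (intro borel_measurable_times borel_measurable_indicator measurable_compose[OF codem]) auto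
  show ?thesis
  proof (rule borel_measurable_LIMSEQ_real[OF _ meas])
    fix z
    show "(\<lambda>m. indicator A z * t' m (code m z)) \<longlonglongrightarrow> indicator A z * t z"
    proof (cases "z \<in> A")
      case True
      have "(\<lambda>m. t' m (code m z)) \<longlonglongrightarrow> t z"
      proof (rule tendstoI)
        fix e :: real assume "e > 0"
        obtain \<delta> where \<delta>: "\<delta> > 0" "\<And>z'. z' \<in> A \<Longrightarrow> (\<forall>j<N. \<bar>f j z' - f j z\<bar> < \<delta>) \<Longrightarrow> \<bar>t z' - t z\<bar> < e"
          using c[OF True \<open>e > 0\<close>] by blast
        have "(\<lambda>m. 1 / real (Suc m)) \<longlonglongrightarrow> 0" using LIMSEQ_inverse_real_of_nat by (simp add: inverse_eq_divide)
        from order_tendstoD(2)[OF this \<delta>(1)]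
        show "\<forall>\<^sub>F m in sequentially. dist (t' m (code m z)) (t z) < e"
        proof eventually_elim
          case (elim m)
          define z' where "z' = (SOME z'. z' \<in> A \<and> code m z' = code m z)"
          have z': "z' \<in> A \<and> code m z' = code m z" unfolding z'_def by (rule someI[of _ z]) (use True in auto)
          have "\<bar>f j z' - f j z\<bar> < \<delta>" if "j < N" for j
          proof -
            have "code m z' ! j = code m z ! j" using z' by simp
            then have "\<lfloor>real (Suc m) * f j z'\<rfloor> = \<lfloor>real (Suc m) * f j z\<rfloor>" using that by (simp add: code_def)
            then have "\<bar>real (Suc m) * f j z' - real (Suc m) * f j z\<bar> < 1" by linarith
            then have "real (Suc m) * \<bar>f j z' - f j z\<bar> < 1" by (simp add: right_diff_distrib[symmetric] abs_mult)
            then have "\<bar>f j z' - f j z\<bar> < 1 / real (Suc m)" by (simp add: field_simps)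
            then show ?thesis using elim by linarith
          qed
          then have "\<bar>t z' - t z\<bar> < e" using \<delta>(2) z' by blast
          then show ?case by (simp add: t'_def z'_def dist_real_def)
        qed
      qed
      then show ?thesis using True by simp
    qed simp
  qed
qed

text \<open>The coordinates of the embedding get Borel representatives that vanish a.e. off the
  ball; A is the set of full measure where all of them agree with the coordinates and the size is Q.
  The distance bound is the lower half of the bi-Lipschitz estimate, with the Euclidean norm bounded
  by the sum of absolute values.\<close>

lemma W12_Q_coordinates:
  fixes W :: "real^'n \<Rightarrow> 'e::euclidean_space multiset"
  assumes W: "W12_Q Q (ball x0 R) W"
  obtains N f G c A where "c \<ge> 0"
    "\<And>j. j < N \<Longrightarrow> integrable lborel (f j)" "\<And>j. j < N \<Longrightarrow> integrable lborel (\<lambda>x. (f j x)\<^sup>2)"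
    "\<And>j. j < N \<Longrightarrow> integrable lborel (G j)" "\<And>j. j < N \<Longrightarrow> weak_gradient (ball x0 R) (f j) (G j)"
    "A \<in> sets lebesgue" "A \<subseteq> ball x0 R" "AE z in lebesgue. z \<in> ball x0 R \<longrightarrow> z \<in> A"
    "\<And>z. z \<in> A \<Longrightarrow> size (W z) = Q"
    "\<And>z z'. z \<in> A \<Longrightarrow> z' \<in> A \<Longrightarrow> Gdist (W z') (W z) \<le> c * (\<Sum>j\<in>{..<N::nat}. \<bar>f j z' - f j z\<bar>)"
proof -
  define \<Omega> where "\<Omega> = ball x0 R"
  have \<Omega>m: "\<Omega> \<in> sets lebesgue" "\<Omega> \<in> sets borel" "\<Omega> \<inter> space lebesgue \<in> sets lebesgue" by (auto simp: \<Omega>_def)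
  have \<Omega>f: "integrable lebesgue (indicator \<Omega> :: _ \<Rightarrow> real)"
    unfolding \<Omega>_def using emeasure_bounded_finite[of "ball x0 R"] by (intro integrable_real_indicator) auto
  obtain es where es: "almgren_embedding Q es" "\<And>j. j < length es * Q \<Longrightarrow> W12 \<Omega> (\<lambda>x. almgren_map es (W x) ! j)"
    and sz: "AE x in lebesgue_on \<Omega>. size (W x) = Q"
    using W unfolding W12_Q_def \<Omega>_def by blast
  define N where "N = length es * Q"
  define \<xi> where "\<xi> = (\<lambda>j T. almgren_map es T ! j)"
  obtain c where c: "c > 0" and cG: "\<And>T S. size T = Q \<Longrightarrow> size S = Q \<Longrightarrow> c * Gdist T S \<le> L2_set (\<lambda>j. \<xi> j T - \<xi> j S) {..<N}"
    using es(1) unfolding almgren_embedding_def N_def \<xi>_def by blast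
  have L2rep: "\<exists>u'. u' \<in> borel_measurable borel \<and> integrable lborel u' \<and> integrable lborel (\<lambda>x. (u' x)\<^sup>2) \<and>
      (AE x in lebesgue. u' x = indicator \<Omega> x * u x)" if u: "L2_on \<Omega> u" for u
  proof -
    have um: "(\<lambda>x. indicator \<Omega> x * u x) \<in> borel_measurable lebesgue"
    proof -
      have "(\<lambda>x. indicator \<Omega> x * u x) = (\<lambda>x. if x \<in> \<Omega> then u x else 0)" by (auto simp: indicator_def)
      then show ?thesis using u borel_measurable_if_I[of u \<Omega>] \<Omega>m(1) by (simp only: L2_on_def)
    qed
    have u2: "integrable lebesgue (\<lambda>x. indicator \<Omega> x * (u x)\<^sup>2)"
      using u \<Omega>m by (simp add: L2_on_def integrable_restrict_space)
    obtain u' where u': "u' \<in> borel_measurable lborel" "AE x in lborel. indicator \<Omega> x * u x = u' x"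
      using completion_ex_borel_measurable_real[OF um] by blast
    have ae: "AE x in lebesgue. u' x = indicator \<Omega> x * u x"
      by (rule AE_completion) (use u'(2) in eventually_elim, simp)
    have [measurable]: "u' \<in> borel_measurable borel" using u'(1) by simp
    have "integrable lebesgue (\<lambda>x. (u' x)\<^sup>2)"
    proof (rule Bochner_Integration.integrable_bound[OF u2])
      show "(\<lambda>x. (u' x)\<^sup>2) \<in> borel_measurable lebesgue" by (rule measurable_completion) measurable
      show "AE x in lebesgue. norm ((u' x)\<^sup>2) \<le> norm (indicator \<Omega> x * (u x)\<^sup>2)"
        using ae by eventually_elim (auto simp: indicator_def)
    qed
    \<comment> \<open>The ball has finite measure, so \<open>|u| \<le> 1 + u^2\<close> turns square
      integrability into integrability.\<close>
    moreover have "integrable lebesgue u'"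
    proof (rule Bochner_Integration.integrable_bound[OF Bochner_Integration.integrable_add[OF \<Omega>f u2]])
      show "u' \<in> borel_measurable lebesgue" by (rule measurable_completion) measurable
      show "AE x in lebesgue. norm (u' x) \<le> norm (indicator \<Omega> x + indicator \<Omega> x * (u x)\<^sup>2)"
        using ae
      proof eventually_elim
        case (elim x)
        have "\<bar>u x\<bar> \<le> 1 + (u x)\<^sup>2"
        proof -
          have "0 \<le> (\<bar>u x\<bar> - 1)\<^sup>2" by simp
          also have "(\<bar>u x\<bar> - 1)\<^sup>2 = (u x)\<^sup>2 - 2 * \<bar>u x\<bar> + 1" by (simp add: power2_diff)
          finally have "2 * \<bar>u x\<bar> \<le> 1 + (u x)\<^sup>2" by simp
          then show ?thesis by linarith
        qed
        then show ?case using elim by (auto simp: indicator_def)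
      qed
    qed
    ultimately show ?thesis using ae by (intro exI[of _ u']) (simp add: integrable_completion)
  qed
  define P0 where "P0 = (\<lambda>j f G. integrable lborel f \<and> integrable lborel (\<lambda>x. (f x)\<^sup>2) \<and> integrable lborel G \<and>
      weak_gradient \<Omega> f G \<and> (AE x in lebesgue. f x = indicator \<Omega> x * \<xi> j (W x)))"
  have "\<exists>f G. P0 j f G" if j: "j < N" for j
  proof -
    have w: "W12 \<Omega> (\<lambda>x. \<xi> j (W x))" using es(2) j by (simp add: N_def \<xi>_def)
    obtain f where f: "f \<in> borel_measurable borel" "integrable lborel f" "integrable lborel (\<lambda>x. (f x)\<^sup>2)"
      "AE x in lebesgue. f x = indicator \<Omega> x * \<xi> j (W x)" using L2rep w unfolding W12_def by blast
    have "\<forall>i. \<exists>g. L2_on \<Omega> g \<and> weak_pderiv \<Omega> i (\<lambda>x. \<xi> j (W x)) g" using w unfolding W12_def by blast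
    then obtain g where g: "\<And>i. L2_on \<Omega> (g i)" "\<And>i. weak_pderiv \<Omega> i (\<lambda>x. \<xi> j (W x)) (g i)" by metis
    have "\<forall>i. \<exists>g'. g' \<in> borel_measurable borel \<and> integrable lborel g' \<and> (AE x in lebesgue. g' x = indicator \<Omega> x * g i x)"
      using L2rep[OF g(1)] by blast
    then obtain g' where g': "\<And>i. g' i \<in> borel_measurable borel" "\<And>i. integrable lborel (g' i)"
      "\<And>i. AE x in lebesgue. g' i x = indicator \<Omega> x * g i x" by metis
    define G :: "real^'n \<Rightarrow> real^'n" where "G = (\<lambda>x. \<chi> i. g' i x)"
    have Gi: "integrable lborel G"
    proof -
      have "G = (\<lambda>x. \<Sum>i\<in>UNIV. g' i x *\<^sub>R axis i 1)"
        unfolding G_def by (auto simp: fun_eq_iff vec_eq_iff axis_def if_distrib cong: if_cong)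
      then show ?thesis using g'(2) by simp
    qed
    have eqs: "(\<integral>x. p x \<partial>lebesgue_on \<Omega>) = (\<integral>x. q x \<partial>lborel)"
      if "q \<in> borel_measurable borel" "AE x in lebesgue. q x = indicator \<Omega> x * p x" for p q :: "real^'n \<Rightarrow> real"
    proof -
      have "(\<integral>x. p x \<partial>lebesgue_on \<Omega>) = (\<integral>x. indicator \<Omega> x * p x \<partial>lebesgue)" using \<Omega>m by (simp add: integral_restrict_space)
      also have "\<dots> = (\<integral>x. q x \<partial>lebesgue)"
        using that by (intro integral_cong_AE_lebesgue[symmetric] measurable_completion) auto
      also have "\<dots> = (\<integral>x. q x \<partial>lborel)" using that by (simp add: integral_completion)
      finally show ?thesis .
    qed
    have "weak_gradient \<Omega> f G"
      unfolding weak_gradient_def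
    proof (intro allI impI)
      fix \<phi> :: "real^'n \<Rightarrow> real" and i assume \<phi>: "C1_c \<Omega> \<phi>"
      note [measurable] = C1_c_borel_measurable[OF \<phi>] f(1) g'(1)
      have "(\<integral>x. f x * frechet_derivative \<phi> (at x) (axis i 1) \<partial>lborel) = (\<integral>x. \<xi> j (W x) * frechet_derivative \<phi> (at x) (axis i 1) \<partial>lebesgue_on \<Omega>)"
        by (rule eqs[symmetric], measurable, use f(4) in eventually_elim, simp)
      also have "\<dots> = - (\<integral>x. g i x * \<phi> x \<partial>lebesgue_on \<Omega>)" using g(2)[of i] \<phi> by (simp add: weak_pderiv_def)
      also have "(\<integral>x. g i x * \<phi> x \<partial>lebesgue_on \<Omega>) = (\<integral>x. g' i x * \<phi> x \<partial>lborel)"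
        by (rule eqs, measurable, use g'(3)[of i] in eventually_elim, simp)
      finally show "(\<integral>x. f x * frechet_derivative \<phi> (at x) (axis i 1) \<partial>lborel) = - (\<integral>x. G x $ i * \<phi> x \<partial>lborel)"
        by (simp add: G_def)
    qed
    then have "P0 j f G" unfolding P0_def using f Gi by (intro conjI)
    then show ?thesis by blast
  qed
  then obtain f G where "\<And>j. j < N \<Longrightarrow> P0 j (f j) (G j)" by metis
  then have fG: "\<And>j. j < N \<Longrightarrow> integrable lborel (f j)" "\<And>j. j < N \<Longrightarrow> integrable lborel (\<lambda>x. (f j x)\<^sup>2)"
    "\<And>j. j < N \<Longrightarrow> integrable lborel (G j)" "\<And>j. j < N \<Longrightarrow> weak_gradient \<Omega> (f j) (G j)"
    "\<And>j. j < N \<Longrightarrow> AE x in lebesgue. f j x = indicator \<Omega> x * \<xi> j (W x)"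
    by (simp_all add: P0_def)
  define P where "P = (\<lambda>z. size (W z) = Q \<and> (\<forall>j<N. f j z = \<xi> j (W z)))"
  have "AE x in lebesgue. x \<in> \<Omega> \<longrightarrow> size (W x) = Q" using sz \<Omega>m by (simp add: AE_restrict_space_iff)
  moreover have "AE x in lebesgue. \<forall>j\<in>{..<N}. f j x = indicator \<Omega> x * \<xi> j (W x)"
    using fG(5) by (intro AE_finite_allI) auto
  ultimately have aeP: "AE x in lebesgue. x \<in> \<Omega> \<longrightarrow> P x"
    by eventually_elim (auto simp: P_def)
  define A where "A = {z \<in> \<Omega>. P z}"
  show ?thesis
  proof (rule that[of "1 / c" N f G A])
    show "A \<in> sets lebesgue"
    proof (rule completion.in_sets_AE[OF _ \<Omega>m(1)])
      show "AE x in lebesgue. (x \<in> \<Omega>) = (x \<in> A)" using aeP by eventually_elim (auto simp: A_def)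
    qed auto
    show "AE z in lebesgue. z \<in> ball x0 R \<longrightarrow> z \<in> A" using aeP by eventually_elim (auto simp: A_def \<Omega>_def)
    show "Gdist (W z') (W z) \<le> 1 / c * (\<Sum>j\<in>{..<N}. \<bar>f j z' - f j z\<bar>)" if "z \<in> A" "z' \<in> A" for z z'
    proof -
      have "c * Gdist (W z') (W z) \<le> L2_set (\<lambda>j. \<xi> j (W z') - \<xi> j (W z)) {..<N}"
        by (rule cG) (use that in \<open>auto simp: A_def P_def\<close>)
      also have "\<dots> \<le> (\<Sum>j\<in>{..<N}. \<bar>\<xi> j (W z') - \<xi> j (W z)\<bar>)" by (rule L2_set_le_sum_abs)
      also have "\<dots> = (\<Sum>j\<in>{..<N}. \<bar>f j z' - f j z\<bar>)" using that by (intro sum.cong) (auto simp: A_def P_def)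
      finally show ?thesis using c by (simp add: field_simps)
    qed
    show "0 \<le> 1 / c" using c by simp
    show "weak_gradient (ball x0 R) (f j) (G j)" if "j < N" for j using fG(4)[OF that] by (simp add: \<Omega>_def)
    show "A \<subseteq> ball x0 R" by (auto simp: A_def \<Omega>_def)
    show "size (W z) = Q" if "z \<in> A" for z using that by (simp add: A_def P_def)
  qed (fact fG(1-3))+
qed

section \<open>Scales and good points\<close>

lemma has_derivative_bump2: "(bump 2 c has_derivative (\<lambda>v. - 4 * bump 1 c z * (z \<bullet> v))) (at z)"
  using has_derivative_bump[of 0 c z] by (simp add: numeral_2_eq_2)

lemma C1_c_bump_times:
  fixes e :: "'a::euclidean_space"
  assumes "\<rho> \<ge> 0"
  shows "C1_c UNIV (\<lambda>z. bump 3 (\<rho>\<^sup>2) z *\<^sub>R e)"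
    and "frechet_derivative (\<lambda>z. bump 3 (\<rho>\<^sup>2) z *\<^sub>R e) (at z) v = (- 6 * bump 2 (\<rho>\<^sup>2) z * (z \<bullet> v)) *\<^sub>R e"
proof -
  have d: "((\<lambda>z. bump 3 (\<rho>\<^sup>2) z *\<^sub>R e) has_derivative (\<lambda>v. (- 6 * bump 2 (\<rho>\<^sup>2) z * (z \<bullet> v)) *\<^sub>R e)) (at z)" for z
    by (rule has_derivative_scaleR_left[OF has_derivative_bump3])
  show "C1_c UNIV (\<lambda>z. bump 3 (\<rho>\<^sup>2) z *\<^sub>R e)"
  proof (rule C1_cI[OF d, of "cball 0 \<rho>"])
    show "continuous_on UNIV (\<lambda>z. (- 6 * bump 2 (\<rho>\<^sup>2) z * (z \<bullet> b)) *\<^sub>R e)" for b by (intro continuous_intros)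
    show "bump 3 (\<rho>\<^sup>2) z *\<^sub>R e = 0" if "z \<notin> cball 0 \<rho>" for z using that assms bump_eq_0[of \<rho> z 3] by auto
  qed auto
  show "frechet_derivative (\<lambda>z. bump 3 (\<rho>\<^sup>2) z *\<^sub>R e) (at z) v = (- 6 * bump 2 (\<rho>\<^sup>2) z * (z \<bullet> v)) *\<^sub>R e"
    by (simp add: frechet_derivative_at[OF d, symmetric])
qed

text \<open>Up to the factor -6 this is the gradient of the cutoff
  \<open>bump 3 (\<rho>\<^sup>2)\<close>; its Lipschitz bound will control the drift term.\<close>

lemma C1_c_bump_times_ident:
  assumes "\<rho> \<ge> 0"
  shows "C1_c UNIV (\<lambda>z::'a::euclidean_space. bump 2 (\<rho>\<^sup>2) z *\<^sub>R z)"
proof (rule C1_cI[of _ "\<lambda>z v. bump 2 (\<rho>\<^sup>2) z *\<^sub>R v + (- 4 * bump 1 (\<rho>\<^sup>2) z * (z \<bullet> v)) *\<^sub>R z" "cball 0 \<rho>"])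
  show "((\<lambda>z. bump 2 (\<rho>\<^sup>2) z *\<^sub>R z) has_derivative (\<lambda>v. bump 2 (\<rho>\<^sup>2) z *\<^sub>R v + (- 4 * bump 1 (\<rho>\<^sup>2) z * (z \<bullet> v)) *\<^sub>R z)) (at z)" for z :: 'a
    by (rule has_derivative_scaleR[OF has_derivative_bump2 has_derivative_ident])
  show "continuous_on UNIV (\<lambda>z. bump 2 (\<rho>\<^sup>2) z *\<^sub>R b + (- 4 * bump 1 (\<rho>\<^sup>2) z * (z \<bullet> b)) *\<^sub>R z)" for b :: 'a
    by (intro continuous_intros)
  show "bump 2 (\<rho>\<^sup>2) z *\<^sub>R z = 0" if "z \<notin> cball 0 \<rho>" for z :: 'a using that assms bump_eq_0[of \<rho> z 2] by auto
qed auto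

text \<open>The gradient of \<open>(e \<bullet> z) * bump 3 (\<rho>\<^sup>2) z\<close>, a linear
  function cut off at radius \<rho>. Near 0 it equals the constant vector
  \<open>\<rho>^6 *\<^sub>R e\<close> up to second order.\<close>

definition bump_gradient :: "real \<Rightarrow> 'a \<Rightarrow> 'a \<Rightarrow> 'a::euclidean_space" where
  "bump_gradient \<rho> e z = bump 3 (\<rho>\<^sup>2) z *\<^sub>R e - (6 * (e \<bullet> z) * bump 2 (\<rho>\<^sup>2) z) *\<^sub>R z"

lemma C1_c_bump_linear:
  fixes e :: "'a::euclidean_space"
  assumes "\<rho> \<ge> 0"
  shows "C1_c UNIV (\<lambda>z. (e \<bullet> z) * bump 3 (\<rho>\<^sup>2) z)"
    and "frechet_derivative (\<lambda>z. (e \<bullet> z) * bump 3 (\<rho>\<^sup>2) z) (at z) v = bump_gradient \<rho> e z \<bullet> v"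
proof -
  have d: "((\<lambda>z. (e \<bullet> z) * bump 3 (\<rho>\<^sup>2) z) has_derivative (\<lambda>v. bump_gradient \<rho> e z \<bullet> v)) (at z)" for z
  proof (rule has_derivative_eq_rhs)
    show "((\<lambda>z. (e \<bullet> z) * bump 3 (\<rho>\<^sup>2) z) has_derivative
        (\<lambda>v. (e \<bullet> z) * (- 6 * bump 2 (\<rho>\<^sup>2) z * (z \<bullet> v)) + (e \<bullet> v) * bump 3 (\<rho>\<^sup>2) z)) (at z)"
      by (rule has_derivative_mult[OF _ has_derivative_bump3]) (auto intro!: derivative_eq_intros)
  qed (auto simp: bump_gradient_def algebra_simps inner_diff_left)
  have c: "continuous_on UNIV (\<lambda>z. bump_gradient \<rho> e z \<bullet> b)" for b
    unfolding bump_gradient_def by (intro continuous_intros)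
  show "C1_c UNIV (\<lambda>z. (e \<bullet> z) * bump 3 (\<rho>\<^sup>2) z)"
  proof (rule C1_cI[OF d c, of "cball 0 \<rho>"])
    show "(e \<bullet> z) * bump 3 (\<rho>\<^sup>2) z = 0" if "z \<notin> cball 0 \<rho>" for z
      using that assms bump_eq_0[of \<rho> z 3] by auto
  qed auto
  show "frechet_derivative (\<lambda>z. (e \<bullet> z) * bump 3 (\<rho>\<^sup>2) z) (at z) v = bump_gradient \<rho> e z \<bullet> v"
    by (simp add: frechet_derivative_at[OF d, symmetric])
qed

text \<open>The sphere itself is included in the last two claims: \<rho> is only a lower bound for
  the distance to the other sheets, and one of them may lie exactly at that distance.\<close>

lemma C1_c_bump_gradient:
  fixes e :: "'a::euclidean_space"
  assumes "\<rho> \<ge> 0"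
  shows "C1_c UNIV (bump_gradient \<rho> e)"
    and "frechet_derivative (bump_gradient \<rho> e) (at 0) v = 0"
    and "norm z \<ge> \<rho> \<Longrightarrow> bump_gradient \<rho> e z = 0"
    and "norm z \<ge> \<rho> \<Longrightarrow> frechet_derivative (bump_gradient \<rho> e) (at z) v = 0"
proof -
  define D where "D = (\<lambda>z v::'a. (- 6 * bump 2 (\<rho>\<^sup>2) z * (z \<bullet> v)) *\<^sub>R e -
      ((6 * (e \<bullet> z) * bump 2 (\<rho>\<^sup>2) z) *\<^sub>R v + (6 * (e \<bullet> z) * (- 4 * bump 1 (\<rho>\<^sup>2) z * (z \<bullet> v)) + 6 * (e \<bullet> v) * bump 2 (\<rho>\<^sup>2) z) *\<^sub>R z))"
  have d: "(bump_gradient \<rho> e has_derivative D z) (at z)" for z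
  proof -
    have "((\<lambda>z. 6 * (e \<bullet> z)) has_derivative (\<lambda>v. 6 * (e \<bullet> v))) (at z)" by (auto intro!: derivative_eq_intros)
    from has_derivative_mult[OF this has_derivative_bump2[of "\<rho>\<^sup>2" z]]
    have "((\<lambda>z. 6 * (e \<bullet> z) * bump 2 (\<rho>\<^sup>2) z) has_derivative
      (\<lambda>v. 6 * (e \<bullet> z) * (- 4 * bump 1 (\<rho>\<^sup>2) z * (z \<bullet> v)) + 6 * (e \<bullet> v) * bump 2 (\<rho>\<^sup>2) z)) (at z)" .
    from has_derivative_diff[OF has_derivative_scaleR_left[OF has_derivative_bump3[of "\<rho>\<^sup>2" z], of e] has_derivative_scaleR[OF this has_derivative_ident]]
    show ?thesis unfolding bump_gradient_def[abs_def] D_def .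
  qed
  have fd: "frechet_derivative (bump_gradient \<rho> e) (at z) = D z" for z
    by (rule frechet_derivative_at[OF d, symmetric])
  have z: "bump_gradient \<rho> e z = 0" if "norm z \<ge> \<rho>" for z
    using that assms bump_eq_0[of \<rho> z 3] bump_eq_0[of \<rho> z 2] by (simp add: bump_gradient_def)
  show "C1_c UNIV (bump_gradient \<rho> e)"
  proof (rule C1_cI[OF d, of "cball 0 \<rho>"])
    show "continuous_on UNIV (\<lambda>x. D x b)" for b unfolding D_def by (intro continuous_intros)
    show "bump_gradient \<rho> e x = 0" if "x \<notin> cball 0 \<rho>" for x using that z[of x] by auto
  qed auto
  show "frechet_derivative (bump_gradient \<rho> e) (at 0) v = 0" by (simp add: fd D_def)
  show "norm z \<ge> \<rho> \<Longrightarrow> bump_gradient \<rho> e z = 0" by (rule z)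
  show "norm z \<ge> \<rho> \<Longrightarrow> frechet_derivative (bump_gradient \<rho> e) (at z) v = 0"
    using assms bump_eq_0[of \<rho> z 1] bump_eq_0[of \<rho> z 2] by (simp add: fd D_def)
qed

text \<open>For V the gradient of g this is the j-th partial derivative of g along a sheet; for V a
  cutoff times a fixed vector it is the flux in the stationarity equation.\<close>

definition pairing :: "('b::euclidean_space \<Rightarrow> 'b) \<Rightarrow> 'n::finite \<Rightarrow> 'b \<times> ('b^'n) \<Rightarrow> real" where
  "pairing V j p = V (fst p) \<bullet> (snd p $ j)"

lemma norm_fst_snd_nth_le:
  fixes p :: "'b::euclidean_space \<times> ('b^'n)"
  shows "norm (fst p) \<le> norm p" "norm (snd p $ j) \<le> norm p"
  using norm_fst_le[of "fst p" "snd p"] norm_snd_le[of "snd p" "fst p"] Finite_Cartesian_Product.norm_nth_le[of "snd p" j] by auto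

lemma continuous_on_pairing:
  assumes "C1_c UNIV V"
  shows "continuous_on UNIV (pairing V j)"
  unfolding pairing_def[abs_def]
  by (intro continuous_intros continuous_on_compose2[OF C1_c_continuous[OF assms, of UNIV]]) auto

text \<open>The constant grows with \<open>norm p\<close>, because the increment of V is multiplied
  by the linear part of p.\<close>

lemma pairing_growth:
  assumes V: "C1_c UNIV V"
  shows "\<exists>C\<ge>0. \<forall>q. \<bar>pairing V j q - pairing V j p\<bar> \<le> C * norm (q - p)"
proof -
  obtain K where K: "K \<ge> 0" "\<And>x. norm (V x) \<le> K" "\<And>x y. norm (V x - V y) \<le> K * norm (x - y)"
    using C1_c_bounds[OF V] by metis
  have "\<bar>pairing V j q - pairing V j p\<bar> \<le> (K + K * norm p) * norm (q - p)" for q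
  proof -
    have "pairing V j q - pairing V j p = V (fst q) \<bullet> (snd (q - p) $ j) + (V (fst q) - V (fst p)) \<bullet> (snd p $ j)"
      by (simp add: pairing_def inner_diff_left inner_diff_right)
    also have "\<bar>\<dots>\<bar> \<le> norm (V (fst q)) * norm (snd (q - p) $ j) + norm (V (fst q) - V (fst p)) * norm (snd p $ j)"
      by (intro order_trans[OF abs_triangle_ineq] add_mono Cauchy_Schwarz_ineq2)
    also have "\<dots> \<le> K * norm (q - p) + (K * norm (q - p)) * norm p"
    proof (intro add_mono mult_mono)
      have "norm (V (fst q) - V (fst p)) \<le> K * norm (fst (q - p))" using K(3)[of "fst q" "fst p"] by simp
      also have "\<dots> \<le> K * norm (q - p)" using K(1) norm_fst_snd_nth_le(1)[of "q - p"] by (intro mult_left_mono)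
      finally show "norm (V (fst q) - V (fst p)) \<le> K * norm (q - p)" .
    qed (use K norm_fst_snd_nth_le(2)[of "q - p" j] norm_fst_snd_nth_le(2)[of p j] in auto)
    finally show ?thesis by (simp add: algebra_simps)
  qed
  then show ?thesis using K(1) by (intro exI[of _ "K + K * norm p"]) auto
qed

lemma has_derivative_pairing:
  assumes V: "C1_c UNIV V"
  shows "(pairing V j has_derivative
     (\<lambda>q. V (fst p) \<bullet> (snd q $ j) + frechet_derivative V (at (fst p)) (fst q) \<bullet> (snd p $ j))) (at p)"
  unfolding pairing_def[abs_def]
proof (rule has_derivative_inner)
  show "((\<lambda>q. V (fst q)) has_derivative (\<lambda>q. frechet_derivative V (at (fst p)) (fst q))) (at p)"
    by (rule has_derivative_compose[OF has_derivative_fst[OF has_derivative_ident] C1_c_has_derivative[OF V]])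
  show "((\<lambda>q. snd q $ j) has_derivative (\<lambda>q. snd q $ j)) (at p)"
    by (intro bounded_linear_imp_has_derivative bounded_linear_compose[OF bounded_linear_vec_nth bounded_linear_snd])
qed

lemma sum_mset_if_eq:
  "(\<Sum>p\<in>#M. if P p then K else 0) = real (size (filter_mset P M)) * (K::real)"
  by (induction M) (auto simp: algebra_simps)

lemma sum_mset_sum_swap:
  fixes F :: "'a \<Rightarrow> 'i \<Rightarrow> real"
  shows "(\<Sum>p\<in>#M. \<Sum>i\<in>I. F p i) = (\<Sum>i\<in>I. \<Sum>p\<in>#M. F p i)"
  by (induction M) (auto simp: sum.distrib)

text \<open>The sum of the constants of the finitely many points of J serves for all of
  them.\<close>

lemma uniform_growth_mset:
  fixes \<phi> :: "'e::real_normed_vector \<Rightarrow> real"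
  assumes "\<And>p. p \<in># J \<Longrightarrow> \<exists>C\<ge>0. \<forall>q. \<bar>\<phi> q - \<phi> p\<bar> \<le> C * b (norm (q - p))" and b: "\<And>s. s \<ge> 0 \<Longrightarrow> b s \<ge> 0"
  shows "\<exists>C\<ge>0. \<forall>p\<in>#J. \<forall>q. \<bar>\<phi> q - \<phi> p\<bar> \<le> C * b (norm (q - p))"
proof -
  obtain C where C: "\<And>p. p \<in># J \<Longrightarrow> C p \<ge> 0" "\<And>p q. p \<in># J \<Longrightarrow> \<bar>\<phi> q - \<phi> p\<bar> \<le> C p * b (norm (q - p))"
    using assms(1) by metis
  define D where "D = (\<Sum>p\<in>set_mset J. C p)"
  have "\<bar>\<phi> q - \<phi> p\<bar> \<le> D * b (norm (q - p))" if p: "p \<in># J" for p q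
  proof -
    have "C p \<le> D" unfolding D_def using p C(1) by (intro member_le_sum) auto
    then have "C p * b (norm (q - p)) \<le> D * b (norm (q - p))" using b by (intro mult_right_mono) auto
    then show ?thesis using C(2)[OF p, of q] by linarith
  qed
  moreover have "D \<ge> 0" unfolding D_def using C(1) by (intro sum_nonneg) auto
  ultimately show ?thesis by blast
qed

text \<open>The data of one ball that are fixed before a point or a test function is chosen:
  coordinates of \<open>j1 v\<close>, the set A on which they control it, and the scales with their
  majorant.\<close>

locale jet_scales =
  fixes v :: "real^'n \<Rightarrow> (real^'k) multiset" and Q :: nat and x0 :: "real^'n" and r R :: real
    and N :: nat and f :: "nat \<Rightarrow> real^'n \<Rightarrow> real" and G :: "nat \<Rightarrow> real^'n \<Rightarrow> real^'n" and c :: real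
    and A :: "(real^'n) set" and h :: "nat \<Rightarrow> real" and E :: "real^'n \<Rightarrow> ennreal"
  assumes r: "0 < r" "r < R" and c: "c \<ge> 0"
    and f: "\<And>j. j < N \<Longrightarrow> integrable lborel (f j)" and G: "\<And>j. j < N \<Longrightarrow> integrable lborel (G j)"
    and A: "A \<in> sets lebesgue" "A \<subseteq> ball x0 R" "AE z in lebesgue. z \<in> ball x0 R \<longrightarrow> z \<in> A"
    and size_jet: "\<And>z. z \<in> A \<Longrightarrow> size (j1 v z) = Q" and jet: "\<And>z. z \<in> A \<Longrightarrow> is_approx_jet v z (j1 v z)"
    and Gdist_le: "\<And>z z'. z \<in> A \<Longrightarrow> z' \<in> A \<Longrightarrow> Gdist (j1 v z') (j1 v z) \<le> c * (\<Sum>j\<in>{..<N}. \<bar>f j z' - f j z\<bar>)"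
    and h: "\<And>k. 0 < h k" "h \<longlonglongrightarrow> 0"
    and E: "E \<in> borel_measurable borel" "(\<integral>\<^sup>+x. E x * indicator (ball x0 r) x \<partial>lborel) < \<infinity>"
      "\<And>i k x. i \<in> {..<N} \<Longrightarrow> taylor_err (h k) (f i) (G i) x \<le> E x"
    and lim: "AE x in lebesgue. x \<in> ball x0 r \<longrightarrow> (\<forall>i\<in>{..<N}. (\<lambda>k. taylor_err (h k) (f i) (G i) x) \<longlonglongrightarrow> 0
        \<and> (\<lambda>k. osc (h k) (\<lambda>x. (f i x)\<^sup>2) x) \<longlonglongrightarrow> 0)"
begin

definition good :: "real^'n \<Rightarrow> bool" where
  "good x \<longleftrightarrow> x \<in> A \<and> x \<in> ball x0 r \<and> (\<forall>i\<in>{..<N}. (\<lambda>k. taylor_err (h k) (f i) (G i) x) \<longlonglongrightarrow> 0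
        \<and> (\<lambda>k. osc (h k) (\<lambda>x. (f i x)\<^sup>2) x) \<longlonglongrightarrow> 0)"

lemma AE_good: "AE x in lebesgue. x \<in> ball x0 r \<longrightarrow> good x"
  using lim A(3) by eventually_elim (use r in \<open>auto simp: good_def\<close>)

text \<open>The factor for A gives a total function whose sum runs over exactly Q sheets wherever it
  is nonzero.\<close>

definition tr :: "((real^'k) \<times> ((real^'k)^'n) \<Rightarrow> real) \<Rightarrow> real^'n \<Rightarrow> real" where
  "tr \<phi> z = indicator A z * (\<Sum>p\<in>#j1 v z. \<phi> p)"

lemma f_measurable: "j \<in> {..<N} \<Longrightarrow> f j \<in> borel_measurable borel"
  using f by auto

text \<open>The sum is continuous in the distance of Q-points, which on A is bounded by the
  increments of the coordinates.\<close>

lemma tr_measurable: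
  assumes \<phi>: "continuous_on UNIV \<phi>"
  shows "tr \<phi> \<in> borel_measurable lebesgue"
  unfolding tr_def[abs_def]
proof (rule borel_measurable_continuous_coordinates[OF A(1), of N f])
  show "f j \<in> borel_measurable lebesgue" if "j < N" for j
    using f_measurable[of j] that by (intro measurable_completion) auto
  fix z and e :: real assume z: "z \<in> A" and "e > 0"
  obtain \<delta> where \<delta>: "\<delta> > 0" "\<And>T. size T = size (j1 v z) \<Longrightarrow> Gdist T (j1 v z) < \<delta> \<Longrightarrow> \<bar>(\<Sum>x\<in>#T. \<phi> x) - (\<Sum>x\<in>#j1 v z. \<phi> x)\<bar> < e"
    using sum_mset_continuous_Gdist[OF \<phi> \<open>e > 0\<close>] by metis
  \<comment> \<open>Keeps \<open>c * real N * \<delta>'\<close> below \<delta>, also when c or N is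
    0.\<close>
  define \<delta>' where "\<delta>' = \<delta> / (c * real N + 1)"
  have \<delta>': "\<delta>' > 0" using \<delta>(1) c by (simp add: \<delta>'_def add_nonneg_pos)
  have "\<bar>(\<Sum>p\<in>#j1 v z'. \<phi> p) - (\<Sum>p\<in>#j1 v z. \<phi> p)\<bar> < e" if z': "z' \<in> A" and n: "\<forall>j<N. \<bar>f j z' - f j z\<bar> < \<delta>'" for z'
  proof (rule \<delta>(2))
    show "size (j1 v z') = size (j1 v z)" using size_jet z z' by simp
    have "Gdist (j1 v z') (j1 v z) \<le> c * (\<Sum>j\<in>{..<N}. \<bar>f j z' - f j z\<bar>)" by (rule Gdist_le[OF z z'])
    also have "\<dots> \<le> c * (\<Sum>j\<in>{..<N}. \<delta>')" using n c by (intro mult_left_mono sum_mono) (auto simp: less_imp_le)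
    also have "\<dots> = \<delta> * (c * real N / (c * real N + 1))" by (simp add: \<delta>'_def)
    also have "\<dots> < \<delta> * 1"
    proof (rule mult_strict_left_mono[OF _ \<delta>(1)])
      have "c * real N \<ge> 0" using c by simp
      then show "c * real N / (c * real N + 1) < 1" by simp
    qed
    also have "\<dots> = \<delta>" by simp
    finally show "Gdist (j1 v z') (j1 v z) < \<delta>" .
  qed
  then show "\<exists>\<delta>>0. \<forall>z'\<in>A. (\<forall>j<N. \<bar>f j z' - f j z\<bar> < \<delta>) \<longrightarrow> \<bar>(\<Sum>p\<in>#j1 v z'. \<phi> p) - (\<Sum>p\<in>#j1 v z. \<phi> p)\<bar> < e"
    using \<delta>' by blast
qed

lemma tr_growth:
  assumes x: "x \<in> A" and C: "C \<ge> 0" "\<And>p q. p \<in># j1 v x \<Longrightarrow> \<bar>\<phi> q - \<phi> p\<bar> \<le> C * norm (q - p)"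
  shows "AE z in lebesgue. z \<in> ball x0 R \<longrightarrow> \<bar>tr \<phi> z - tr \<phi> x\<bar> \<le> (real Q * C * c) * (\<Sum>j\<in>{..<N}. \<bar>f j z - f j x\<bar>)"
  using A(3)
proof eventually_elim
  case (elim z)
  show ?case
  proof
    assume "z \<in> ball x0 R"
    then have z: "z \<in> A" using elim by blast
    have "\<bar>tr \<phi> z - tr \<phi> x\<bar> \<le> real (size (j1 v x)) * (C * Gdist (j1 v z) (j1 v x))"
      using sum_mset_diff_le_Gdist[of "j1 v z" "j1 v x" \<phi> "\<lambda>s. C * s"] C x z size_jet
      by (simp add: tr_def mult_left_mono)
    also have "\<dots> \<le> real Q * (C * (c * (\<Sum>j\<in>{..<N}. \<bar>f j z - f j x\<bar>)))"
      unfolding size_jet[OF x] using Gdist_le[OF x z] C(1) by (intro mult_left_mono) auto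
    finally show "\<bar>tr \<phi> z - tr \<phi> x\<bar> \<le> (real Q * C * c) * (\<Sum>j\<in>{..<N}. \<bar>f j z - f j x\<bar>)" by (simp add: mult.assoc)
  qed
qed

lemma good_ball: 
  assumes "x \<in> ball x0 r"
  shows "ball x (R - r) \<subseteq> ball x0 R"
proof
  fix z assume "z \<in> ball x (R - r)"
  then show "z \<in> ball x0 R" using assms dist_triangle[of x0 z x] by simp
qed

text \<open>A point of J consists of a point of the first jet and its derivative; the kernel in
  direction i evaluates the derivative of \<phi> on the i-th column of the latter.\<close>

lemma tr_limit:
  assumes x: "good x" and J: "is_approx_jet (j1 v) x J"
    and C: "C \<ge> 0" "\<And>p q. p \<in># j1 v x \<Longrightarrow> \<bar>\<phi> q - \<phi> p\<bar> \<le> C * norm (q - p)"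
    and \<phi>: "continuous_on UNIV \<phi>" "\<And>p. p \<in># j1 v x \<Longrightarrow> (\<phi> has_derivative \<phi>' p) (at p)"
  shows "(\<lambda>k. \<integral>y. kap i y * ((tr \<phi> (x + h k *\<^sub>R y) - tr \<phi> x) / h k) \<partial>lebesgue)
      \<longlonglongrightarrow> - bump_mass TYPE('n) * (\<Sum>P\<in>#J. \<phi>' (fst P) (snd P $ i))"
    and "\<forall>\<^sub>F k in sequentially. integrable lebesgue (\<lambda>y. kap i y * ((tr \<phi> (x + h k *\<^sub>R y) - tr \<phi> x) / h k))"
proof -
  have xA: "x \<in> A" "x \<in> ball x0 r" using x by (auto simp: good_def)
  have J1: "j1 v x = image_mset fst J" using J by (simp add: is_approx_jet_def)
  have d: "R - r > 0" using r by simp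
  have L: "approx_derivative (tr \<phi>) x (\<lambda>s. \<Sum>P\<in>#J. \<phi>' (fst P) (hom_apply (snd P) s))"
  proof (rule approx_derivative_sum_mset[OF J _ d])
    show "size J = Q" using size_jet[OF xA(1)] by (simp add: J1)
    show "AE z in lebesgue. z \<in> ball x (R - r) \<longrightarrow> size (j1 v z) = Q \<and> tr \<phi> z = (\<Sum>a\<in>#j1 v z. \<phi> a)"
      using A(3) by eventually_elim (use good_ball[OF xA(2)] size_jet in \<open>auto simp: tr_def\<close>)
    show "tr \<phi> x = (\<Sum>a\<in>#j1 v x. \<phi> a)" using xA by (simp add: tr_def)
    show "(\<phi> has_derivative \<phi>' (fst P)) (at (fst P))" if "P \<in># J" for P
      using that by (intro \<phi>(2)) (simp add: J1)
  qed
  have gr: "AE z in lebesgue. z \<in> ball x (R - r) \<longrightarrow> \<bar>tr \<phi> z - tr \<phi> x\<bar> \<le> (real Q * C * c) * (\<Sum>j\<in>{..<N}. \<bar>f j z - f j x\<bar>)"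
  proof -
    have "AE z in lebesgue. z \<in> ball x0 R \<longrightarrow> \<bar>tr \<phi> z - tr \<phi> x\<bar> \<le> (real Q * C * c) * (\<Sum>j\<in>{..<N}. \<bar>f j z - f j x\<bar>)"
      by (rule tr_growth[OF xA(1) C])
    then show ?thesis by eventually_elim (use good_ball[OF xA(2)] in auto)
  qed
  have err: "(\<lambda>k. taylor_err (h k) (f i) (G i) x) \<longlonglongrightarrow> 0" if "i \<in> {..<N}" for i
    using x that by (simp add: good_def)
  have CC: "real Q * C * c \<ge> 0" using C(1) c by simp
  note l = integral_kap_quotient_tendsto[OF finite_lessThan h err f_measurable d CC tr_measurable[OF \<phi>(1)] gr L, of i]
  show "(\<lambda>k. \<integral>y. kap i y * ((tr \<phi> (x + h k *\<^sub>R y) - tr \<phi> x) / h k) \<partial>lebesgue)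
      \<longlonglongrightarrow> - bump_mass TYPE('n) * (\<Sum>P\<in>#J. \<phi>' (fst P) (snd P $ i))"
    using l(1) by (simp add: hom_apply_axis)
  show "\<forall>\<^sub>F k in sequentially. integrable lebesgue (\<lambda>y. kap i y * ((tr \<phi> (x + h k *\<^sub>R y) - tr \<phi> x) / h k))"
    using l(2) .
qed

text \<open>The Lipschitz bound of g gives a growth constant valid for all x. The value of the
  derivative comes from the first jet of v, while the growth is controlled by the coordinates of
  \<open>j1 v\<close>.\<close>

lemma tr_weak_derivative:
  assumes g: "C1_c UNIV g" and V: "\<And>y b. frechet_derivative g (at y) b = V y \<bullet> b" and VC: "C1_c UNIV V"
    and \<psi>: "C1_c (ball x0 r) \<psi>"
  shows "(\<integral>x. tr (\<lambda>p. g (fst p)) x * frechet_derivative \<psi> (at x) (axis j 1) \<partial>lebesgue) = - (\<integral>x. tr (pairing V j) x * \<psi> x \<partial>lebesgue)"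
proof -
  let ?u = "tr (\<lambda>p. g (fst p))"
  obtain K where K: "K \<ge> 0" "\<And>x. norm (g x) \<le> K" "\<And>x y. norm (g x - g y) \<le> K * norm (x - y)"
    using C1_c_bounds[OF g] by metis
  have gg: "\<bar>g (fst q) - g (fst p)\<bar> \<le> K * norm (q - p)" for p q :: "(real^'k) \<times> ((real^'k)^'n)"
  proof -
    have "\<bar>g (fst q) - g (fst p)\<bar> \<le> K * norm (fst (q - p))" using K(3)[of "fst q" "fst p"] by simp
    also have "\<dots> \<le> K * norm (q - p)" using K(1) norm_fst_snd_nth_le(1)[of "q - p"] by (intro mult_left_mono)
    finally show ?thesis .
  qed
  have CC: "real Q * K * c \<ge> 0" using K(1) c by simp
  have lim': "AE x in lebesgue. x \<in> ball x0 r \<longrightarrow> (\<forall>i\<in>{..<N}. (\<lambda>k. taylor_err (h k) (f i) (G i) x) \<longlonglongrightarrow> 0)"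
    using lim by eventually_elim auto
  have cg: "continuous_on UNIV (\<lambda>p::(real^'k) \<times> ((real^'k)^'n). g (fst p))"
    by (rule continuous_on_compose2[OF C1_c_continuous[OF g, of UNIV]]) (auto intro: continuous_intros)
  show ?thesis
  proof (rule weak_derivative_of_approx[OF finite_lessThan r h E lim' f_measurable _ CC tr_measurable[OF cg] _ _ _ tr_measurable[OF continuous_on_pairing[OF VC]] _ \<psi>])
    show "integrable lborel (G i)" if "i \<in> {..<N}" for i using G that by simp
    show "\<bar>?u x\<bar> \<le> real Q * K" for x
    proof (cases "x \<in> A")
      case True
      obtain ps where ps: "mset ps = j1 v x" using ex_mset by blast
      have "\<bar>?u x\<bar> = \<bar>\<Sum>l<Q. g (fst (ps ! l))\<bar>"
        using True sum_mset_eq_sum_nth[OF ps, of "\<lambda>p. g (fst p)"] size_jet[OF True] by (simp add: tr_def)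
      also have "\<dots> \<le> (\<Sum>l<Q. \<bar>g (fst (ps ! l))\<bar>)" by (rule sum_abs)
      also have "\<dots> \<le> (\<Sum>l<Q. K)" using K(2) by (intro sum_mono) auto
      finally show ?thesis by simp
    qed (use K(1) in \<open>auto simp: tr_def\<close>)
    show "?u x = 0" if "x \<notin> ball x0 R" for x using that A(2) by (auto simp: tr_def indicator_def)
    show "AE x in lebesgue. x \<in> ball x0 R \<longrightarrow> (AE z in lebesgue. z \<in> ball x0 R \<longrightarrow> \<bar>?u z - ?u x\<bar> \<le> real Q * K * c * (\<Sum>i\<in>{..<N}. \<bar>f i z - f i x\<bar>))"
      using A(3) by eventually_elim (use tr_growth[OF _ K(1) gg] in blast)
    show "AE x in lebesgue. x \<in> ball x0 r \<longrightarrow> (\<exists>L. approx_derivative ?u x L \<and> L (axis j 1) = tr (pairing V j) x)"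
      using AE_good
    proof eventually_elim
      case (elim x)
      show ?case
      proof (intro impI exI conjI)
        assume "x \<in> ball x0 r"
        then have xA: "x \<in> A" "x \<in> ball x0 r" using elim by (auto simp: good_def)
        have d: "R - r > 0" using r by simp
        have vz: "v z = image_mset fst (j1 v z)" if "z \<in> A" for z using jet[OF that] by (simp add: is_approx_jet_def)
        show "approx_derivative ?u x (\<lambda>s. \<Sum>p\<in>#j1 v x. frechet_derivative g (at (fst p)) (hom_apply (snd p) s))"
        proof (rule approx_derivative_sum_mset[OF jet[OF xA(1)] size_jet[OF xA(1)] d])
          show "AE z in lebesgue. z \<in> ball x (R - r) \<longrightarrow> size (v z) = Q \<and> ?u z = (\<Sum>a\<in>#v z. g a)"
            using A(3)
          proof eventually_elim
            case (elim z)
            show ?case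
            proof
              assume "z \<in> ball x (R - r)"
              then have z: "z \<in> A" using elim good_ball[OF xA(2)] by blast
              show "size (v z) = Q \<and> ?u z = (\<Sum>a\<in>#v z. g a)"
                using vz[OF z] size_jet[OF z] z by (simp add: tr_def image_mset.compositionality o_def)
            qed
          qed
          show "?u x = (\<Sum>a\<in>#v x. g a)" using vz[OF xA(1)] xA(1) by (simp add: tr_def image_mset.compositionality o_def)
          show "(g has_derivative frechet_derivative g (at (fst p))) (at (fst p))" for p :: "(real^'k) \<times> ((real^'k)^'n)"
            by (rule C1_c_has_derivative[OF g])
        qed
        show "(\<Sum>p\<in>#j1 v x. frechet_derivative g (at (fst p)) (hom_apply (snd p) (axis j 1))) = tr (pairing V j) x"
          using xA(1) by (simp add: tr_def pairing_def V hom_apply_axis)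
      qed
    qed
  qed
qed

end

section \<open>Symmetry of the second jet\<close>

lemma integral_kap_lebesgue: "(\<integral>y. kap i y \<partial>lebesgue) = 0" "integrable lebesgue (kap i)"
  using integral_kap[of i] integrable_kap[of i] by (auto simp: integral_completion integrable_completion)

text \<open>The kernel has integral 0, so the constant \<open>t x\<close> may be subtracted.\<close>

lemma integral_kap_shift:
  assumes h: "h \<noteq> 0" and int: "integrable lebesgue (\<lambda>y. kap i y * ((t (x + h *\<^sub>R y) - t x) / h))"
  shows "integrable lebesgue (\<lambda>y. kap i y * t (x + h *\<^sub>R y))"
    and "(\<integral>y. kap i y * t (x + h *\<^sub>R y) \<partial>lebesgue) = h * (\<integral>y. kap i y * ((t (x + h *\<^sub>R y) - t x) / h) \<partial>lebesgue)"
proof -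
  have eq: "(\<lambda>y. kap i y * t (x + h *\<^sub>R y)) = (\<lambda>y. h * (kap i y * ((t (x + h *\<^sub>R y) - t x) / h)) + t x * kap i y)"
    using h by (auto simp: fun_eq_iff field_simps)
  show "integrable lebesgue (\<lambda>y. kap i y * t (x + h *\<^sub>R y))"
    unfolding eq by (intro Bochner_Integration.integrable_add integrable_mult_right int integral_kap_lebesgue(2))
  have "(\<integral>y. kap i y * t (x + h *\<^sub>R y) \<partial>lebesgue) = (\<integral>y. h * (kap i y * ((t (x + h *\<^sub>R y) - t x) / h)) \<partial>lebesgue) + (\<integral>y. t x * kap i y \<partial>lebesgue)"
    unfolding eq by (intro Bochner_Integration.integral_add integrable_mult_right int integral_kap_lebesgue(2))
  also have "\<dots> = h * (\<integral>y. kap i y * ((t (x + h *\<^sub>R y) - t x) / h) \<partial>lebesgue)"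
    by (simp add: integral_kap_lebesgue(1))
  finally show "(\<integral>y. kap i y * t (x + h *\<^sub>R y) \<partial>lebesgue) = h * (\<integral>y. kap i y * ((t (x + h *\<^sub>R y) - t x) / h) \<partial>lebesgue)" .
qed

text \<open>Up to a factor h, \<open>kap i\<close> rescaled is the i-th derivative of the rescaled
  \<open>bump 3 1\<close>; the second claim is the equality of its mixed derivatives, checked on
  explicit formulas.\<close>

lemma kap_scaled:
  fixes x :: "real^'n"
  assumes h: "h > 0" and sub: "cball x h \<subseteq> U"
  shows "C1_c U (\<lambda>z. kap i ((1 / h) *\<^sub>R (z - x)))"
    and "frechet_derivative (\<lambda>z. kap i ((1 / h) *\<^sub>R (z - x))) (at z) (axis j 1)
       = frechet_derivative (\<lambda>z. kap j ((1 / h) *\<^sub>R (z - x))) (at z) (axis i 1)"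
proof -
  define D where "D = (\<lambda>i y v::real^'n. (- 6 * bump 2 1 y) * v $ i + (- 6 * (- 4 * bump 1 1 y * (y \<bullet> v))) * y $ i)"
  have dk: "(kap i has_derivative D i y) (at y)" for i y
    unfolding kap_def[abs_def] D_def
    by (intro has_derivative_mult has_derivative_mult_right has_derivative_bump2 bounded_linear_imp_has_derivative bounded_linear_vec_nth)
  have d: "((\<lambda>z. kap i ((1 / h) *\<^sub>R (z - x))) has_derivative (\<lambda>v. D i ((1 / h) *\<^sub>R (z - x)) ((1 / h) *\<^sub>R v))) (at z)" for i z
    by (rule has_derivative_compose[OF _ dk]) (auto intro!: derivative_eq_intros)
  show "C1_c U (\<lambda>z. kap i ((1 / h) *\<^sub>R (z - x)))"
  proof (rule C1_cI[OF d, where S = "cball x h"])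
    show "continuous_on UNIV (\<lambda>z. D i ((1 / h) *\<^sub>R (z - x)) ((1 / h) *\<^sub>R b))" for b
      unfolding D_def
      by (intro continuous_intros continuous_on_compose2[OF continuous_on_bump[of UNIV]]) auto
    show "kap i ((1 / h) *\<^sub>R (z - x)) = 0" if "z \<notin> cball x h" for z
    proof -
      have "norm ((1 / h) *\<^sub>R (z - x)) = norm (z - x) / h" using h by simp
      then have "(1 / h) *\<^sub>R (z - x) \<notin> ball 0 1"
        using that h by (simp only: mem_ball_0) (simp add: dist_norm norm_minus_commute)
      then show ?thesis using kap_bound[of i "(1 / h) *\<^sub>R (z - x)"] by simp
    qed
  qed (use sub in auto)
  have fd: "frechet_derivative (\<lambda>z. kap i ((1 / h) *\<^sub>R (z - x))) (at z) = (\<lambda>v. D i ((1 / h) *\<^sub>R (z - x)) ((1 / h) *\<^sub>R v))" for i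
    by (rule frechet_derivative_at[OF d, symmetric])
  have sw: "D i y (a *\<^sub>R axis j 1) = D j y (a *\<^sub>R axis i 1)" for y a
  proof -
    have ax: "(axis j (1::real) :: real^'n) $ i = (if i = j then 1 else 0)" for i j by (simp add: axis_def)
    show ?thesis by (simp add: D_def inner_axis ax)
  qed
  show "frechet_derivative (\<lambda>z. kap i ((1 / h) *\<^sub>R (z - x))) (at z) (axis j 1)
       = frechet_derivative (\<lambda>z. kap j ((1 / h) *\<^sub>R (z - x))) (at z) (axis i 1)"
    unfolding fd by (rule sw)
qed

lemma eventually_cball_subset:
  assumes "x \<in> ball x0 r" "\<And>k. 0 < h k" "h \<longlonglongrightarrow> (0::real)"
  shows "\<forall>\<^sub>F k in sequentially. cball x (h k) \<subseteq> ball x0 r"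
proof -
  have "r - dist x0 x > 0" using assms(1) by simp
  from order_tendstoD(2)[OF assms(3) this]
  show ?thesis
  proof eventually_elim
    case (elim k)
    show ?case
    proof
      fix z assume "z \<in> cball x (h k)"
      then show "z \<in> ball x0 r" using elim dist_triangle[of x0 z x] by simp
    qed
  qed
qed

lemma translate_origin:
  assumes "C1_c UNIV F"
  shows "C1_c UNIV (\<lambda>y. F (y - a))"
    and "frechet_derivative (\<lambda>y. F (y - a)) (at y) = frechet_derivative F (at (y - a))"
  using C1_c_translate[OF assms, of a UNIV] by auto

text \<open>The field V is constant to first order at every point of the jet, nonzero only at a, so that the
  sum sees the second derivatives of the sheets through a and nothing else.\<close>

lemma sum_pairing_derivative:
  fixes J :: "(((real^'k) \<times> ((real^'k)^'n)) \<times> (((real^'k) \<times> ((real^'k)^'n))^'n)) multiset"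
  assumes V: "V a = s *\<^sub>R e" "\<And>P. P \<in># J \<Longrightarrow> fst (fst P) \<noteq> a \<Longrightarrow> V (fst (fst P)) = 0"
    "\<And>P b. P \<in># J \<Longrightarrow> frechet_derivative V (at (fst (fst P))) b = 0"
    and S: "\<And>P. P \<in># J \<Longrightarrow> fst (fst P) = a \<Longrightarrow> snd P = C"
  shows "(\<Sum>P\<in>#J. V (fst (fst P)) \<bullet> (snd (snd P $ i) $ j) + frechet_derivative V (at (fst (fst P))) (fst (snd P $ i)) \<bullet> (snd (fst P) $ j))
    = real (size (filter_mset (\<lambda>P. fst (fst P) = a) J)) * s * (e \<bullet> (snd (C $ i) $ j))"
proof -
  have "(\<Sum>P\<in>#J. V (fst (fst P)) \<bullet> (snd (snd P $ i) $ j) + frechet_derivative V (at (fst (fst P))) (fst (snd P $ i)) \<bullet> (snd (fst P) $ j))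
    = (\<Sum>P\<in>#J. if fst (fst P) = a then s * (e \<bullet> (snd (C $ i) $ j)) else 0)"
    by (rule arg_cong[where f = sum_mset], rule image_mset_cong) (use V S in auto)
  also have "\<dots> = real (size (filter_mset (\<lambda>P. fst (fst P) = a) J)) * (s * (e \<bullet> (snd (C $ i) $ j)))" by (rule sum_mset_if_eq)
  finally show ?thesis by (simp add: mult.assoc)
qed

context jet_scales
begin

text \<open>The limit has two parts: V paired with the second jet, and the derivative of V, which
  the choice of V will make vanish on the jet.\<close>

lemma tr_pairing_limit:
  assumes x: "good x" and J: "is_approx_jet (j1 v) x J" and V: "C1_c UNIV V"
  shows "(\<lambda>k. \<integral>y. kap i y * ((tr (pairing V j) (x + h k *\<^sub>R y) - tr (pairing V j) x) / h k) \<partial>lebesgue)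
      \<longlonglongrightarrow> - bump_mass TYPE('n) * (\<Sum>P\<in>#J. V (fst (fst P)) \<bullet> (snd (snd P $ i) $ j) + frechet_derivative V (at (fst (fst P))) (fst (snd P $ i)) \<bullet> (snd (fst P) $ j))"
    and "\<forall>\<^sub>F k in sequentially. integrable lebesgue (\<lambda>y. kap i y * ((tr (pairing V j) (x + h k *\<^sub>R y) - tr (pairing V j) x) / h k))"
proof -
  obtain C where C: "C \<ge> 0" "\<And>p q. p \<in># j1 v x \<Longrightarrow> \<bar>pairing V j q - pairing V j p\<bar> \<le> C * norm (q - p)"
  proof -
    have "\<exists>C\<ge>0. \<forall>p\<in>#j1 v x. \<forall>q. \<bar>pairing V j q - pairing V j p\<bar> \<le> C * norm (q - p)"
      by (rule uniform_growth_mset[where b = "\<lambda>s. s"], rule pairing_growth[OF V])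
    then show ?thesis using that by blast
  qed
  show "(\<lambda>k. \<integral>y. kap i y * ((tr (pairing V j) (x + h k *\<^sub>R y) - tr (pairing V j) x) / h k) \<partial>lebesgue)
      \<longlonglongrightarrow> - bump_mass TYPE('n) * (\<Sum>P\<in>#J. V (fst (fst P)) \<bullet> (snd (snd P $ i) $ j) + frechet_derivative V (at (fst (fst P))) (fst (snd P $ i)) \<bullet> (snd (fst P) $ j))"
    by (rule tr_limit(1)[OF x J C continuous_on_pairing[OF V] has_derivative_pairing[OF V]])
  show "\<forall>\<^sub>F k in sequentially. integrable lebesgue (\<lambda>y. kap i y * ((tr (pairing V j) (x + h k *\<^sub>R y) - tr (pairing V j) x) / h k))"
    by (rule tr_limit(2)[OF x J C continuous_on_pairing[OF V] has_derivative_pairing[OF V]])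
qed

text \<open>Equal points have equal linear parts in the first jet, and equal points of the first jet
  have equal derivatives in J; so all sheets through one point share their second jet. As the jet
  has finitely many points, the remaining ones keep a positive distance.\<close>

lemma isolated_sheet:
  assumes x: "good x" and J: "is_approx_jet (j1 v) x J" and P0: "P0 \<in># J"
  obtains \<rho> where "\<rho> > 0" "\<And>P. P \<in># J \<Longrightarrow> fst (fst P) \<noteq> fst (fst P0) \<Longrightarrow> norm (fst (fst P) - fst (fst P0)) \<ge> \<rho>"
    "\<And>P. P \<in># J \<Longrightarrow> fst (fst P) = fst (fst P0) \<Longrightarrow> snd P = snd P0"
    "size (filter_mset (\<lambda>P. fst (fst P) = fst (fst P0)) J) > 0"
proof -
  have xA: "x \<in> A" using x by (simp add: good_def)
  have J1: "j1 v x = image_mset fst J" and c2: "\<forall>P\<in>#J. \<forall>P'\<in>#J. fst P = fst P' \<longrightarrow> snd P = snd P'"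
    using J[unfolded is_approx_jet_def, THEN conjunct1] J[unfolded is_approx_jet_def, THEN conjunct2, THEN conjunct1] .
  have c1: "\<forall>p\<in>#j1 v x. \<forall>p'\<in>#j1 v x. fst p = fst p' \<longrightarrow> snd p = snd p'"
    using jet[OF xA, unfolded is_approx_jet_def, THEN conjunct2, THEN conjunct1] .
  obtain \<rho> where \<rho>: "\<rho> > 0" "\<And>y. y \<in> (\<lambda>P. fst (fst P)) ` set_mset J \<Longrightarrow> y \<noteq> fst (fst P0) \<Longrightarrow> \<rho> \<le> dist (fst (fst P0)) y"
    using finite_set_avoid[of "(\<lambda>P. fst (fst P)) ` set_mset J" "fst (fst P0)"] by auto
  show ?thesis
  proof (rule that[OF \<rho>(1)])
    show "norm (fst (fst P) - fst (fst P0)) \<ge> \<rho>" if "P \<in># J" "fst (fst P) \<noteq> fst (fst P0)" for P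
      using \<rho>(2)[of "fst (fst P)"] that by (simp add: dist_norm norm_minus_commute)
    show "snd P = snd P0" if "P \<in># J" "fst (fst P) = fst (fst P0)" for P
    proof (rule c2[rule_format, OF that(1) P0])
      have "fst P \<in># j1 v x" "fst P0 \<in># j1 v x" using that P0 by (auto simp: J1)
      then show "fst P = fst P0" using c1[rule_format, of "fst P" "fst P0"] that(2) by (simp add: prod_eq_iff)
    qed
    have "P0 \<in># filter_mset (\<lambda>P. fst (fst P) = fst (fst P0)) J" using P0 by simp
    then show "size (filter_mset (\<lambda>P. fst (fst P) = fst (fst P0)) J) > 0"
      by (metis empty_not_add_mset multi_member_split nonempty_has_size)
  qed
qed

text \<open>Testing \<open>w_j\<close> with the rescaled \<open>kap i\<close> amounts to testing u
  with a mixed second derivative of the bump, which is symmetric in i and j. After blow-up at x the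
  two sides tend to multiples of \<open>L i j\<close> and \<open>L j i\<close>, and the field V
  makes these see the sheets through a alone.\<close>

lemma second_jet_symmetric:
  assumes x: "good x" and J: "is_approx_jet (j1 v) x J" and P0: "P0 \<in># J"
  shows "snd (snd P0 $ i) $ j = snd (snd P0 $ j) $ i"
proof (rule vector_eq_ldot[THEN iffD1, rule_format])
  fix e :: "real^'k"
  have xr: "x \<in> ball x0 r" using x by (simp add: good_def)
  obtain \<rho> where \<rho>: "\<rho> > 0" "\<And>P. P \<in># J \<Longrightarrow> fst (fst P) \<noteq> fst (fst P0) \<Longrightarrow> norm (fst (fst P) - fst (fst P0)) \<ge> \<rho>"
    "\<And>P. P \<in># J \<Longrightarrow> fst (fst P) = fst (fst P0) \<Longrightarrow> snd P = snd P0"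
    "size (filter_mset (\<lambda>P. fst (fst P) = fst (fst P0)) J) > 0"
    using isolated_sheet[OF x J P0] by blast
  define a where "a = fst (fst P0)"
  define V where "V = (\<lambda>y. bump_gradient \<rho> e (y - a))"
  define g where "g = (\<lambda>y. (e \<bullet> (y - a)) * bump 3 (\<rho>\<^sup>2) (y - a))"
  have \<rho>0: "\<rho> \<ge> 0" using \<rho>(1) by simp
  have VC: "C1_c UNIV V" and Vd: "\<And>y. frechet_derivative V (at y) = frechet_derivative (bump_gradient \<rho> e) (at (y - a))"
    unfolding V_def by (rule translate_origin[OF C1_c_bump_gradient(1)[OF \<rho>0]])+
  have gC: "C1_c UNIV g" and gd: "\<And>y b. frechet_derivative g (at y) b = V y \<bullet> b"
    unfolding g_def V_def using translate_origin[OF C1_c_bump_linear(1)[OF \<rho>0, of e], of a]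
    by (simp_all add: C1_c_bump_linear(2)[OF \<rho>0])
  define L where "L = (\<lambda>i j. (\<Sum>P\<in>#J. V (fst (fst P)) \<bullet> (snd (snd P $ i) $ j) + frechet_derivative V (at (fst (fst P))) (fst (snd P $ i)) \<bullet> (snd (fst P) $ j)))"
  define q where "q = (\<lambda>i j k. \<integral>y. kap i y * ((tr (pairing V j) (x + h k *\<^sub>R y) - tr (pairing V j) x) / h k) \<partial>lebesgue)"
  have ql: "(\<lambda>k. q i j k) \<longlonglongrightarrow> - bump_mass TYPE('n) * L i j" for i j
    unfolding q_def L_def by (rule tr_pairing_limit(1)[OF x J VC])
  have qs: "\<forall>\<^sub>F k in sequentially. q i j k = q j i k"
    using eventually_cball_subset[OF xr h] tr_pairing_limit(2)[OF x J VC, of i j] tr_pairing_limit(2)[OF x J VC, of j i]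
  proof eventually_elim
    case (elim k)
    have hk: "h k > 0" by (rule h)
    then have hk0: "h k \<noteq> 0" by simp
    \<comment> \<open>Change of variables to the unit ball; the value at x is inserted at no cost
      because the kernel has integral 0.\<close>
    have sc: "(\<integral>z. tr (pairing V j) z * kap i ((1 / h k) *\<^sub>R (z - x)) \<partial>lebesgue) = \<bar>h k\<bar> ^ DIM(real^'n) * (h k * q i j k)"
      if int: "integrable lebesgue (\<lambda>y. kap i y * ((tr (pairing V j) (x + h k *\<^sub>R y) - tr (pairing V j) x) / h k))" for i j
    proof -
      have "(\<integral>z. tr (pairing V j) z * kap i ((1 / h k) *\<^sub>R (z - x)) \<partial>lebesgue)
        = \<bar>h k\<bar> ^ DIM(real^'n) * (\<integral>y. tr (pairing V j) (x + h k *\<^sub>R y) * kap i ((1 / h k) *\<^sub>R (x + h k *\<^sub>R y - x)) \<partial>lebesgue)"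
        using C1_c_borel_measurable(1)[OF kap_scaled(1)[OF hk elim(1)], of i]
        by (intro integral_affine_lebesgue[OF hk0] borel_measurable_times tr_measurable continuous_on_pairing[OF VC] measurable_completion) auto
      also have "(\<integral>y. tr (pairing V j) (x + h k *\<^sub>R y) * kap i ((1 / h k) *\<^sub>R (x + h k *\<^sub>R y - x)) \<partial>lebesgue)
        = (\<integral>y. kap i y * tr (pairing V j) (x + h k *\<^sub>R y) \<partial>lebesgue)" using hk by (simp add: mult.commute)
      also have "\<dots> = h k * q i j k" unfolding q_def by (rule integral_kap_shift(2)[OF hk0 int])
      finally show ?thesis .
    qed
    have "(\<integral>z. tr (pairing V j) z * kap i ((1 / h k) *\<^sub>R (z - x)) \<partial>lebesgue) = (\<integral>z. tr (pairing V i) z * kap j ((1 / h k) *\<^sub>R (z - x)) \<partial>lebesgue)"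
      using tr_weak_derivative[OF gC gd VC kap_scaled(1)[OF hk elim(1)], of j i] tr_weak_derivative[OF gC gd VC kap_scaled(1)[OF hk elim(1)], of i j]
        kap_scaled(2)[OF hk elim(1), of i _ j] by simp
    then show ?case using sc[OF elim(2)] sc[OF elim(3)] hk by simp
  qed
  have "(\<lambda>k. q i j k) \<longlonglongrightarrow> - bump_mass TYPE('n) * L j i"
    by (rule Lim_transform_eventually[OF ql[of j i]]) (use qs in eventually_elim, simp)
  then have "- bump_mass TYPE('n) * L i j = - bump_mass TYPE('n) * L j i" using ql[of i j] LIMSEQ_unique by blast
  then have LL: "L i j = L j i" using bump_mass_pos[where 'n = 'n] by simp
  have V1: "V a = (\<rho>\<^sup>2) ^ 3 *\<^sub>R e" by (simp add: V_def bump_gradient_def bump_def)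
  have V2: "V (fst (fst P)) = 0" if "P \<in># J" "fst (fst P) \<noteq> a" for P
    using \<rho>(2)[OF that(1)] that(2) C1_c_bump_gradient(3)[OF \<rho>0] by (simp add: V_def a_def)
  have V3: "frechet_derivative V (at (fst (fst P))) b = 0" if "P \<in># J" for P b
    using \<rho>(2)[OF that(1)] C1_c_bump_gradient(2,4)[OF \<rho>0] by (cases "fst (fst P) = a") (auto simp: Vd a_def)
  have Lij: "L i j = real (size (filter_mset (\<lambda>P. fst (fst P) = a) J)) * (\<rho>\<^sup>2) ^ 3 * (e \<bullet> (snd (snd P0 $ i) $ j))" for i j
    unfolding L_def by (rule sum_pairing_derivative[OF V1 V2 V3]) (use \<rho>(3) in \<open>auto simp: a_def\<close>)
  show "e \<bullet> (snd (snd P0 $ i) $ j) = e \<bullet> (snd (snd P0 $ j) $ i)"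
  proof -
    have s: "real (size (filter_mset (\<lambda>P. fst (fst P) = a) J)) > 0" using \<rho>(4) unfolding a_def of_nat_0_less_iff .
    have "real (size (filter_mset (\<lambda>P. fst (fst P) = a) J)) * (\<rho>\<^sup>2) ^ 3 > 0" by (rule mult_pos_pos[OF s]) (use \<rho>(1) in simp)
    then have "real (size (filter_mset (\<lambda>P. fst (fst P) = a) J)) * (\<rho>\<^sup>2) ^ 3 \<noteq> 0" by (rule less_imp_neq[symmetric])
    from mult_left_cancel[OF this, THEN iffD1, OF LL[unfolded Lij]] show ?thesis .
  qed
qed

end

section \<open>The trace of the second jet\<close>

lemma bump3_bound: "\<bar>bump 3 1 (y::'a::euclidean_space)\<bar> \<le> 1 * indicator (ball 0 1) y"
  using bump_le[of 1 3 y] bump_nonneg[of 3 1 y] bump_eq_0[of 1 y 3] by (cases "y \<in> ball 0 1") auto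

text \<open>The bump localises in x at scale h and V localises in y; differentiating in x produces
  \<open>kap\<close> and the factor 1/h.\<close>

lemma C1_c_tensor:
  fixes V :: "'b::euclidean_space \<Rightarrow> 'b" and x :: "real^'n"
  assumes V: "C1_c UNIV V" and h: "h > 0" and sub: "cball x h \<subseteq> \<Omega>"
  defines "\<psi> \<equiv> \<lambda>p. bump 3 1 ((1 / h) *\<^sub>R (fst p - x)) *\<^sub>R V (snd p)"
  shows "C1_c (\<Omega> \<times> UNIV) \<psi>"
    and "frechet_derivative \<psi> (at (z, a)) (axis i 1, 0) = (kap i ((1 / h) *\<^sub>R (z - x)) / h) *\<^sub>R V a"
    and "frechet_derivative \<psi> (at (z, a)) (0, b) = bump 3 1 ((1 / h) *\<^sub>R (z - x)) *\<^sub>R frechet_derivative V (at a) b"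
proof -
  define \<zeta> where "\<zeta> = (\<lambda>p::(real^'n) \<times> 'b. (1 / h) *\<^sub>R (fst p - x))"
  define D where "D = (\<lambda>p q. bump 3 1 (\<zeta> p) *\<^sub>R frechet_derivative V (at (snd p)) (snd q)
     + (- 6 * bump 2 1 (\<zeta> p) * (\<zeta> p \<bullet> ((1 / h) *\<^sub>R fst q))) *\<^sub>R V (snd p))"
  have d1: "((\<lambda>p. bump 3 1 (\<zeta> p)) has_derivative (\<lambda>q. - 6 * bump 2 1 (\<zeta> p) * (\<zeta> p \<bullet> ((1 / h) *\<^sub>R fst q)))) (at p)" for p
  proof (rule has_derivative_compose[OF _ has_derivative_bump3])
    show "(\<zeta> has_derivative (\<lambda>q. (1 / h) *\<^sub>R fst q)) (at p)"
      unfolding \<zeta>_def by (auto intro!: derivative_eq_intros)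
  qed
  have d2: "((\<lambda>p. V (snd p)) has_derivative (\<lambda>q. frechet_derivative V (at (snd p)) (snd q))) (at p)" for p :: "(real^'n) \<times> 'b"
    by (rule has_derivative_compose[OF has_derivative_snd[OF has_derivative_ident] C1_c_has_derivative[OF V]])
  have d: "(\<psi> has_derivative D p) (at p)" for p
    using has_derivative_scaleR[OF d1[of p] d2[of p]] unfolding \<psi>_def D_def \<zeta>_def .
  obtain K where K: "compact K" "\<And>y. y \<notin> K \<Longrightarrow> V y = 0" using C1_c_support[OF V] by metis
  have c\<zeta>: "continuous_on UNIV \<zeta>" unfolding \<zeta>_def by (intro continuous_intros)
  have cV: "continuous_on UNIV (\<lambda>p::(real^'n) \<times> 'b. V (snd p))"
    by (rule continuous_on_compose2[OF C1_c_continuous[OF V, of UNIV]]) (auto intro: continuous_intros)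
  have cV': "continuous_on UNIV (\<lambda>p::(real^'n) \<times> 'b. frechet_derivative V (at (snd p)) b)" for b
    by (rule continuous_on_compose2[OF C1_c_continuous_frechet_derivative[OF V, of UNIV]]) (auto intro: continuous_intros)
  have cb: "continuous_on UNIV (\<lambda>p. bump k 1 (\<zeta> p))" for k
    by (rule continuous_on_compose2[OF continuous_on_bump[of UNIV] c\<zeta>]) auto
  show "C1_c (\<Omega> \<times> UNIV) \<psi>"
  proof (rule C1_cI[OF d, where S = "cball x h \<times> K"])
    show "continuous_on UNIV (\<lambda>p. D p q)" for q
      unfolding D_def by (intro continuous_intros cb cV cV' c\<zeta>)
    show "compact (cball x h \<times> K)" using K(1) by (intro compact_Times) auto
    show "cball x h \<times> K \<subseteq> \<Omega> \<times> UNIV" using sub by auto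
    fix p assume p: "p \<notin> cball x h \<times> K"
    show "\<psi> p = 0"
    proof (cases "snd p \<in> K")
      case True
      then have "fst p \<notin> cball x h" using p by (cases p) auto
      then have "norm (fst p - x) > h" by (simp add: dist_norm norm_minus_commute)
      then have "norm (\<zeta> p) \<ge> 1" using h by (simp add: \<zeta>_def)
      then show ?thesis using bump_eq_0[of 1 "\<zeta> p" 3] by (simp add: \<psi>_def \<zeta>_def)
    qed (simp add: \<psi>_def K(2))
  qed
  have fd: "frechet_derivative \<psi> (at p) = D p" for p by (rule frechet_derivative_at[OF d, symmetric])
  have lin: "linear (frechet_derivative V (at y))" for y
    using C1_c_has_derivative[OF V] has_derivative_linear by blast
  show "frechet_derivative \<psi> (at (z, a)) (axis i 1, 0) = (kap i ((1 / h) *\<^sub>R (z - x)) / h) *\<^sub>R V a"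
    by (simp add: fd D_def \<zeta>_def kap_def inner_axis linear_0[OF lin])
  show "frechet_derivative \<psi> (at (z, a)) (0, b) = bump 3 1 ((1 / h) *\<^sub>R (z - x)) *\<^sub>R frechet_derivative V (at a) b"
    by (simp add: fd D_def \<zeta>_def)
qed

context jet_scales
begin

text \<open>With no factor 1/h it suffices that t tends to 0 in the mean. Linear increments are of
  order h in the mean, because their quotients by h are bounded there; squares of increments are
  reduced to linear increments and increments of squares, which \<open>osc\<close> controls.\<close>

lemma quadratic_limit:
  assumes x: "good x" and t: "t \<in> borel_measurable lebesgue" and B: "B \<ge> 0"
    and le: "AE z in lebesgue. z \<in> ball x0 R \<longrightarrow> \<bar>t z\<bar> \<le> B * (\<Sum>j\<in>{..<N}. \<bar>f j z - f j x\<bar> + (f j z - f j x)\<^sup>2)"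
    and \<kappa>: "\<kappa> \<in> borel_measurable borel" "\<And>y. \<bar>\<kappa> y\<bar> \<le> M * indicator (ball 0 1) y"
  shows "(\<lambda>k. \<integral>y. \<kappa> y * t (x + h k *\<^sub>R y) \<partial>lebesgue) \<longlonglongrightarrow> 0"
    and "\<forall>\<^sub>F k in sequentially. integrable lebesgue (\<lambda>y. \<kappa> y * t (x + h k *\<^sub>R y))"
proof -
  have xr: "x \<in> ball x0 r" using x by (simp add: good_def)
  define \<beta> where "\<beta> = emeasure lborel (ball (0::real^'n) 1)"
  have \<beta>: "\<beta> < \<infinity>" unfolding \<beta>_def using emeasure_bounded_finite[OF bounded_ball] by auto
  \<comment> \<open>The bound for one coordinate after integration over the unit ball; the weight
    comes from \<open>(s - u)^2 \<le> 2 |u| |s - u| + |s^2 - u^2|\<close>.\<close>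
  define T where "T = (\<lambda>k j. ennreal (1 + 2 * \<bar>f j x\<bar>) * (ennreal (h k) * (taylor_err (h k) (f j) (G j) x + ennreal (norm (G j x)) * \<beta>)) + osc (h k) (\<lambda>x. (f j x)\<^sup>2) x)"
  let ?d1 = "\<lambda>k j y. ennreal (\<bar>f j (x + h k *\<^sub>R y) - f j x\<bar> / h k) * indicator (ball 0 1) y"
  let ?d2 = "\<lambda>k j y. ennreal \<bar>(f j (x + h k *\<^sub>R y))\<^sup>2 - (f j x)\<^sup>2\<bar> * indicator (ball 0 1) y"
  have m1: "?d1 k j \<in> borel_measurable lebesgue" and m2: "?d2 k j \<in> borel_measurable lebesgue" if "j \<in> {..<N}" for j k
  proof -
    have [measurable]: "f j \<in> borel_measurable borel" by (rule f_measurable[OF that])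
    show "?d1 k j \<in> borel_measurable lebesgue" by (rule measurable_completion) measurable
    show "?d2 k j \<in> borel_measurable lebesgue" by (rule measurable_completion) measurable
  qed
  have Tl: "(\<lambda>k. T k j) \<longlonglongrightarrow> 0" if "j \<in> {..<N}" for j
  proof -
    have te: "(\<lambda>k. taylor_err (h k) (f j) (G j) x) \<longlonglongrightarrow> 0" and os: "(\<lambda>k. osc (h k) (\<lambda>x. (f j x)\<^sup>2) x) \<longlonglongrightarrow> 0"
      using x that by (auto simp: good_def)
    have hh: "(\<lambda>k. ennreal (h k)) \<longlonglongrightarrow> ennreal 0" by (intro tendsto_ennrealI h)
    \<comment> \<open>Multiplication in \<open>ennreal\<close> is not continuous at 0 times
      infinity, so the second factor must have a finite limit.\<close>
    have fin: "0 + ennreal (norm (G j x)) * \<beta> \<noteq> top" using \<beta> by (simp add: ennreal_mult_eq_top_iff)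
    have "(\<lambda>k. ennreal (h k) * (taylor_err (h k) (f j) (G j) x + ennreal (norm (G j x)) * \<beta>)) \<longlonglongrightarrow> ennreal 0 * (0 + ennreal (norm (G j x)) * \<beta>)"
      by (rule tendsto_mult_ennreal[OF hh tendsto_add[OF te tendsto_const]]) (use fin in auto)
    then have "(\<lambda>k. ennreal (h k) * (taylor_err (h k) (f j) (G j) x + ennreal (norm (G j x)) * \<beta>)) \<longlonglongrightarrow> 0" by simp
    from tendsto_add[OF ennreal_tendsto_cmult[OF _ this] os] show ?thesis unfolding T_def by simp
  qed
  have bound: "(\<integral>\<^sup>+y. ennreal \<bar>t (x + h k *\<^sub>R y) - 0\<bar> * indicator (ball 0 1) y \<partial>lebesgue) \<le> ennreal B * (\<Sum>j\<in>{..<N}. T k j)"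
    if k: "h k < R - r" for k
  proof -
    have hk: "h k > 0" by (rule h)
    then have hk0: "h k \<noteq> 0" by simp
    let ?S = "\<lambda>y. \<Sum>j\<in>{..<N}. ennreal ((1 + 2 * \<bar>f j x\<bar>) * h k) * ?d1 k j y + ?d2 k j y"
    have mj: "(\<lambda>y. ennreal ((1 + 2 * \<bar>f j x\<bar>) * h k) * ?d1 k j y + ?d2 k j y) \<in> borel_measurable lebesgue" if "j \<in> {..<N}" for j
      by (intro borel_measurable_add borel_measurable_times_ennreal borel_measurable_const m1[OF that] m2[OF that])
    have mS: "?S \<in> borel_measurable lebesgue" by (intro borel_measurable_sum mj)
    have "(\<integral>\<^sup>+y. ennreal \<bar>t (x + h k *\<^sub>R y) - 0\<bar> * indicator (ball 0 1) y \<partial>lebesgue) \<le> (\<integral>\<^sup>+y. ennreal B * ?S y \<partial>lebesgue)"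
    proof (rule nn_integral_mono_AE)
      show "AE y in lebesgue. ennreal \<bar>t (x + h k *\<^sub>R y) - 0\<bar> * indicator (ball 0 1) y \<le> ennreal B * ?S y"
        using AE_affine_lebesgue[OF hk0 le, of x]
      proof eventually_elim
        case (elim y)
        show ?case
        proof (cases "y \<in> ball 0 1")
          case True
          have "h k * norm y < h k * 1" using True hk by (intro mult_strict_left_mono) auto
          then have "x + h k *\<^sub>R y \<in> ball x (R - r)" using k hk order_less_trans[of "h k * norm y" "h k" "R - r"] by (simp add: dist_norm)
          then have "\<bar>t (x + h k *\<^sub>R y)\<bar> \<le> B * (\<Sum>j\<in>{..<N}. \<bar>f j (x + h k *\<^sub>R y) - f j x\<bar> + (f j (x + h k *\<^sub>R y) - f j x)\<^sup>2)"
            using elim good_ball[OF xr] by blast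
          also have "\<dots> \<le> B * (\<Sum>j\<in>{..<N}. ((1 + 2 * \<bar>f j x\<bar>) * h k) * (\<bar>f j (x + h k *\<^sub>R y) - f j x\<bar> / h k) + \<bar>(f j (x + h k *\<^sub>R y))\<^sup>2 - (f j x)\<^sup>2\<bar>)"
          proof (intro mult_left_mono sum_mono B)
            fix j
            have "a + b \<le> ((1 + 2 * p) * h k) * (a / h k) + d" if "b \<le> 2 * p * a + d" for a b p d :: real
            proof -
              have "((1 + 2 * p) * h k) * (a / h k) = a + 2 * p * a" using hk by (simp add: field_simps)
              then show ?thesis using that by linarith
            qed
            moreover have "(s - u)\<^sup>2 \<le> 2 * \<bar>u\<bar> * \<bar>s - u\<bar> + \<bar>s\<^sup>2 - u\<^sup>2\<bar>" for s u :: real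
            proof -
              have "(s - u)\<^sup>2 = (s\<^sup>2 - u\<^sup>2) - 2 * (u * (s - u))" by (simp add: power2_eq_square algebra_simps)
              moreover have "\<bar>u * (s - u)\<bar> = \<bar>u\<bar> * \<bar>s - u\<bar>" by (simp add: abs_mult)
              ultimately show ?thesis by linarith
            qed
            ultimately show "\<bar>f j (x + h k *\<^sub>R y) - f j x\<bar> + (f j (x + h k *\<^sub>R y) - f j x)\<^sup>2
               \<le> ((1 + 2 * \<bar>f j x\<bar>) * h k) * (\<bar>f j (x + h k *\<^sub>R y) - f j x\<bar> / h k) + \<bar>(f j (x + h k *\<^sub>R y))\<^sup>2 - (f j x)\<^sup>2\<bar>" by blast
          qed
          finally have "ennreal \<bar>t (x + h k *\<^sub>R y)\<bar> \<le> ennreal (B * (\<Sum>j\<in>{..<N}. ((1 + 2 * \<bar>f j x\<bar>) * h k) * (\<bar>f j (x + h k *\<^sub>R y) - f j x\<bar> / h k) + \<bar>(f j (x + h k *\<^sub>R y))\<^sup>2 - (f j x)\<^sup>2\<bar>))"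
            by (rule ennreal_leI)
          also have "\<dots> = ennreal B * (\<Sum>j\<in>{..<N}. ennreal (((1 + 2 * \<bar>f j x\<bar>) * h k) * (\<bar>f j (x + h k *\<^sub>R y) - f j x\<bar> / h k) + \<bar>(f j (x + h k *\<^sub>R y))\<^sup>2 - (f j x)\<^sup>2\<bar>))"
            using hk B by (subst sum_ennreal, simp, intro ennreal_mult) (auto intro!: sum_nonneg add_nonneg_nonneg mult_nonneg_nonneg)
          also have "\<dots> = ennreal B * ?S y"
          proof (intro arg_cong[where f = "(*) (ennreal B)"] sum.cong refl)
            fix j
            have nn: "(1 + 2 * \<bar>f j x\<bar>) * h k \<ge> 0" "\<bar>f j (x + h k *\<^sub>R y) - f j x\<bar> / h k \<ge> 0" using hk by auto
            show "ennreal (((1 + 2 * \<bar>f j x\<bar>) * h k) * (\<bar>f j (x + h k *\<^sub>R y) - f j x\<bar> / h k) + \<bar>(f j (x + h k *\<^sub>R y))\<^sup>2 - (f j x)\<^sup>2\<bar>)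
              = ennreal ((1 + 2 * \<bar>f j x\<bar>) * h k) * ?d1 k j y + ?d2 k j y"
              using True by (simp only: ennreal_plus[OF mult_nonneg_nonneg[OF nn] abs_ge_zero] ennreal_mult[OF nn]) simp
          qed
          finally show ?thesis using True by simp
        qed simp
      qed
    qed
    also have "\<dots> = ennreal B * (\<Sum>j\<in>{..<N}. \<integral>\<^sup>+y. ennreal ((1 + 2 * \<bar>f j x\<bar>) * h k) * ?d1 k j y + ?d2 k j y \<partial>lebesgue)"
      unfolding nn_integral_cmult[OF mS] by (rule arg_cong[where f = "(*) (ennreal B)"], rule nn_integral_sum) (rule mj)
    also have "\<dots> \<le> ennreal B * (\<Sum>j\<in>{..<N}. T k j)"
    proof (intro mult_left_mono sum_mono)
      fix j assume j: "j \<in> {..<N}"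
      have "(\<integral>\<^sup>+y. ennreal ((1 + 2 * \<bar>f j x\<bar>) * h k) * ?d1 k j y + ?d2 k j y \<partial>lebesgue)
        = ennreal ((1 + 2 * \<bar>f j x\<bar>) * h k) * (\<integral>\<^sup>+y. ?d1 k j y \<partial>lebesgue) + (\<integral>\<^sup>+y. ?d2 k j y \<partial>lebesgue)"
        unfolding nn_integral_cmult[OF m1[OF j], symmetric]
        by (rule nn_integral_add[OF borel_measurable_times_ennreal[OF borel_measurable_const m1[OF j]] m2[OF j]])
      also have "\<dots> \<le> ennreal ((1 + 2 * \<bar>f j x\<bar>) * h k) * (taylor_err (h k) (f j) (G j) x + ennreal (norm (G j x)) * \<beta>) + osc (h k) (\<lambda>x. (f j x)\<^sup>2) x"
        unfolding \<beta>_def using nn_integral_abs_le_taylor_err[OF hk f_measurable[OF j], of x "G j"]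
        by (intro add_mono mult_left_mono) (auto simp: osc_def nn_integral_completion)
      also have "\<dots> = T k j" unfolding T_def using hk by (simp add: ennreal_mult mult.assoc)
      finally show "(\<integral>\<^sup>+y. ennreal ((1 + 2 * \<bar>f j x\<bar>) * h k) * ?d1 k j y + ?d2 k j y \<partial>lebesgue) \<le> T k j" .
    qed simp
    finally show ?thesis .
  qed
  have "(\<lambda>k. \<Sum>j\<in>{..<N}. T k j) \<longlonglongrightarrow> (\<Sum>j\<in>{..<N}. 0)" by (intro tendsto_sum Tl)
  then have "(\<lambda>k. ennreal B * (\<Sum>j\<in>{..<N}. T k j)) \<longlonglongrightarrow> ennreal B * 0"
    by (intro ennreal_tendsto_cmult) auto
  then have up: "(\<lambda>k. ennreal B * (\<Sum>j\<in>{..<N}. T k j)) \<longlonglongrightarrow> 0" by simp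
  have evk: "\<forall>\<^sub>F k in sequentially. h k < R - r" using order_tendstoD(2)[OF h(2), of "R - r"] r by simp
  have lim0: "(\<lambda>k. \<integral>\<^sup>+y. ennreal \<bar>t (x + h k *\<^sub>R y) - 0\<bar> * indicator (ball 0 1) y \<partial>lebesgue) \<longlonglongrightarrow> 0"
    by (rule tendsto_sandwich[OF _ eventually_mono[OF evk bound] tendsto_const up]) simp
  have hk0: "h k \<noteq> 0" for k using h(1)[of k] by simp
  have mt: "(\<lambda>y. t (x + h k *\<^sub>R y)) \<in> borel_measurable lebesgue" for k
    by (rule measurable_compose[OF measurable_affine_lebesgue[OF hk0] t])
  note l = integral_kernel_tendsto[where D = "\<lambda>k y. t (x + h k *\<^sub>R y)" and L = "\<lambda>_. 0" and K = 0, OF lim0 mt _ _ \<kappa>]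
  show "(\<lambda>k. \<integral>y. \<kappa> y * t (x + h k *\<^sub>R y) \<partial>lebesgue) \<longlonglongrightarrow> 0" using l(1) by simp
  show "\<forall>\<^sub>F k in sequentially. integrable lebesgue (\<lambda>y. \<kappa> y * t (x + h k *\<^sub>R y))" using l(2) by simp
qed

text \<open>By Cauchy-Schwarz the square of the sum of increments is at most N times the sum of
  their squares, hence \<open>c + c\<^sup>2 * real N\<close>. As \<phi> vanishes on the jet at x,
  the increment of the sum is the sum itself.\<close>

lemma tr_quadratic_growth:
  assumes x: "x \<in> A" and C: "C \<ge> 0" "\<And>p q. p \<in># j1 v x \<Longrightarrow> \<bar>\<phi> q - \<phi> p\<bar> \<le> C * (norm (q - p) + (norm (q - p))\<^sup>2)"
    and z: "\<And>p. p \<in># j1 v x \<Longrightarrow> \<phi> p = 0"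
  shows "AE z in lebesgue. z \<in> ball x0 R \<longrightarrow>
    \<bar>tr \<phi> z\<bar> \<le> (real Q * C * (c + c\<^sup>2 * real N)) * (\<Sum>j\<in>{..<N}. \<bar>f j z - f j x\<bar> + (f j z - f j x)\<^sup>2)"
  using A(3)
proof eventually_elim
  case (elim z)
  show ?case
  proof
    assume "z \<in> ball x0 R"
    then have zA: "z \<in> A" using elim by blast
    define S where "S = (\<Sum>j\<in>{..<N}. \<bar>f j z - f j x\<bar>)"
    define S2 where "S2 = (\<Sum>j\<in>{..<N}. (f j z - f j x)\<^sup>2)"
    have S: "S \<ge> 0" "S2 \<ge> 0" by (auto simp: S_def S2_def intro!: sum_nonneg)
    have SS: "S\<^sup>2 \<le> real N * S2"
      using Cauchy_Schwarz_ineq_sum[of "\<lambda>_. 1" "\<lambda>j. \<bar>f j z - f j x\<bar>" "{..<N}"] by (simp add: S_def S2_def)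
    have s0: "(\<Sum>p\<in>#j1 v x. \<phi> p) = 0"
    proof -
      have "(\<Sum>p\<in>#j1 v x. \<phi> p) = (\<Sum>p\<in>#j1 v x. 0)" by (rule arg_cong[where f = sum_mset], rule image_mset_cong) (rule z)
      then show ?thesis by simp
    qed
    have d0: "0 \<le> Gdist (j1 v z) (j1 v x)" using Gdist_matching[of "j1 v z" "j1 v x"] size_jet x zA by metis
    have d: "Gdist (j1 v z) (j1 v x) \<le> c * S" unfolding S_def by (rule Gdist_le[OF x zA])
    have "\<bar>tr \<phi> z\<bar> \<le> real (size (j1 v x)) * (C * (Gdist (j1 v z) (j1 v x) + (Gdist (j1 v z) (j1 v x))\<^sup>2))"
      using sum_mset_diff_le_Gdist[of "j1 v z" "j1 v x" \<phi> "\<lambda>s. C * (s + s\<^sup>2)"] C x zA size_jet s0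
      by (simp add: tr_def mult_left_mono add_mono power_mono)
    also have "\<dots> \<le> real Q * (C * (c * S + (c * S)\<^sup>2))"
      unfolding size_jet[OF x] using d d0 C(1) by (intro mult_left_mono add_mono power_mono) auto
    also have "\<dots> \<le> real Q * (C * ((c + c\<^sup>2 * real N) * (S + S2)))"
    proof (intro mult_left_mono C(1))
      have "(c * S)\<^sup>2 \<le> c\<^sup>2 * (real N * S2)" using SS by (simp add: power_mult_distrib mult_left_mono)
      then have "c * S + (c * S)\<^sup>2 \<le> c * S + c\<^sup>2 * real N * S2" by simp
      also have "\<dots> \<le> (c + c\<^sup>2 * real N) * (S + S2)" using c S by (simp add: algebra_simps)
      finally show "c * S + (c * S)\<^sup>2 \<le> (c + c\<^sup>2 * real N) * (S + S2)" .
    qed simp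
    finally show "\<bar>tr \<phi> z\<bar> \<le> (real Q * C * (c + c\<^sup>2 * real N)) * (\<Sum>j\<in>{..<N}. \<bar>f j z - f j x\<bar> + (f j z - f j x)\<^sup>2)"
      by (simp add: S_def S2_def sum.distrib mult.assoc)
  qed
qed

end

text \<open>The contraction of Dv with \<open>D_y V Dv\<close>: the part of the first variation in
  which the test field is differentiated in y, quadratic in the gradient.\<close>

definition drift :: "('b::euclidean_space \<Rightarrow> 'b) \<Rightarrow> 'b \<times> ('b^'n) \<Rightarrow> real" where
  "drift V p = (\<Sum>i\<in>UNIV. (snd p $ i) \<bullet> frechet_derivative V (at (fst p)) (snd p $ i))"

lemma outer_stationary_integrand:
  fixes V :: "real^'k \<Rightarrow> real^'k" and x :: "real^'n"
  assumes V: "C1_c UNIV V" and h: "h > 0"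
  defines "\<psi> \<equiv> \<lambda>p. bump 3 1 ((1 / h) *\<^sub>R (fst p - x)) *\<^sub>R V (snd p)"
  shows "(\<Sum>(a, B)\<in>#J. B \<bullet> (\<chi> i. frechet_derivative \<psi> (at (z, a)) (axis i 1, 0) + frechet_derivative \<psi> (at (z, a)) (0, B $ i)))
    = (\<Sum>i\<in>UNIV. (kap i ((1 / h) *\<^sub>R (z - x)) / h) * (\<Sum>p\<in>#J. pairing V i p)) + bump 3 1 ((1 / h) *\<^sub>R (z - x)) * (\<Sum>p\<in>#J. drift V p)"
proof -
  let ?\<zeta> = "(1 / h) *\<^sub>R (z - x)"
  note fd = C1_c_tensor(2,3)[OF V h subset_UNIV, where z = z and x = x, folded \<psi>_def]
  have inner: "B \<bullet> (\<chi> i. F i) = (\<Sum>i\<in>UNIV. B $ i \<bullet> F i)" for B :: "(real^'k)^'n" and F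
    by (simp add: inner_vec_def)
  have "(\<Sum>(a, B)\<in>#J. B \<bullet> (\<chi> i. frechet_derivative \<psi> (at (z, a)) (axis i 1, 0) + frechet_derivative \<psi> (at (z, a)) (0, B $ i)))
    = (\<Sum>p\<in>#J. (\<Sum>i\<in>UNIV. (kap i ?\<zeta> / h) * pairing V i p) + bump 3 1 ?\<zeta> * drift V p)"
  proof (rule arg_cong[where f = sum_mset], rule image_mset_cong)
    fix p :: "(real^'k) \<times> ((real^'k)^'n)"
    show "(case p of (a, B) \<Rightarrow> B \<bullet> (\<chi> i. frechet_derivative \<psi> (at (z, a)) (axis i 1, 0) + frechet_derivative \<psi> (at (z, a)) (0, B $ i)))
      = (\<Sum>i\<in>UNIV. (kap i ?\<zeta> / h) * pairing V i p) + bump 3 1 ?\<zeta> * drift V p"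
      unfolding fd case_prod_beta drift_def pairing_def sum_distrib_left sum.distrib[symmetric] inner
      by (intro sum.cong refl) (simp add: inner_add_right inner_commute)
  qed
  also have "\<dots> = (\<Sum>p\<in>#J. \<Sum>i\<in>UNIV. (kap i ?\<zeta> / h) * pairing V i p) + (\<Sum>p\<in>#J. bump 3 1 ?\<zeta> * drift V p)"
    by (rule sum_mset.distrib)
  also have "\<dots> = (\<Sum>i\<in>UNIV. (kap i ?\<zeta> / h) * (\<Sum>p\<in>#J. pairing V i p)) + bump 3 1 ?\<zeta> * (\<Sum>p\<in>#J. drift V p)"
    unfolding sum_mset_sum_swap by (simp add: sum_mset_distrib_left)
  finally show ?thesis .
qed

context jet_scales
begin

text \<open>Stationarity for the test field at scale \<open>h k\<close>, in rescaled variables. The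
  factor 1/h from the derivative in x and the vanishing integral of \<open>kap\<close> turn the flux
  into difference quotients; the drift carries no such factor.\<close>

lemma outer_stationary_scaled:
  assumes x: "x \<in> ball x0 r" and st: "outer_stationary \<Omega> v" and \<Omega>: "ball x0 R \<subseteq> \<Omega>" "\<Omega> \<in> sets lebesgue"
    and V: "C1_c UNIV V" and k: "cball x (h k) \<subseteq> ball x0 R"
    and d: "continuous_on UNIV (drift V :: (real^'k) \<times> ((real^'k)^'n) \<Rightarrow> real)"
    and i1: "\<And>i. integrable lebesgue (\<lambda>y. kap i y * ((tr (pairing V i) (x + h k *\<^sub>R y) - tr (pairing V i) x) / h k))"
    and i2: "integrable lebesgue (\<lambda>y. bump 3 1 y * tr (drift V) (x + h k *\<^sub>R y))"
  shows "(\<Sum>i\<in>UNIV. \<integral>y. kap i y * ((tr (pairing V i) (x + h k *\<^sub>R y) - tr (pairing V i) x) / h k) \<partial>lebesgue)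
    = - (\<integral>y. bump 3 1 y * tr (drift V) (x + h k *\<^sub>R y) \<partial>lebesgue)"
proof -
  have hk: "h k > 0" by (rule h)
  then have hk0: "h k \<noteq> 0" by simp
  define \<psi> where "\<psi> = (\<lambda>p. bump 3 1 ((1 / h k) *\<^sub>R (fst p - x)) *\<^sub>R V (snd p))"
  define H where "H = (\<lambda>z. \<Sum>(a, B)\<in>#j1 v z. B \<bullet> (\<chi> i. frechet_derivative \<psi> (at (z, a)) (axis i 1, 0) + frechet_derivative \<psi> (at (z, a)) (0, B $ i)))"
  define K where "K = (\<lambda>z. (\<Sum>i\<in>UNIV. (kap i ((1 / h k) *\<^sub>R (z - x)) / h k) * tr (pairing V i) z) + bump 3 1 ((1 / h k) *\<^sub>R (z - x)) * tr (drift V) z)"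
  have H: "H z = (\<Sum>i\<in>UNIV. (kap i ((1 / h k) *\<^sub>R (z - x)) / h k) * (\<Sum>p\<in>#j1 v z. pairing V i p)) + bump 3 1 ((1 / h k) *\<^sub>R (z - x)) * (\<Sum>p\<in>#j1 v z. drift V p)" for z
    unfolding H_def \<psi>_def by (rule outer_stationary_integrand[OF V hk])
  have "C1_c (\<Omega> \<times> UNIV) \<psi>" unfolding \<psi>_def by (rule C1_c_tensor(1)[OF V hk]) (use k \<Omega> in blast)
  then have "(\<integral>z. H z \<partial>lebesgue_on \<Omega>) = 0" using st unfolding outer_stationary_def H_def by blast
  then have 0: "(\<integral>z. indicator \<Omega> z * H z \<partial>lebesgue) = 0" using \<Omega>(2) by (simp add: integral_restrict_space)
  have Km: "K \<in> borel_measurable lebesgue"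
  proof -
    have m: "(\<lambda>z. kap i ((1 / h k) *\<^sub>R (z - x)) / h k) \<in> borel_measurable lebesgue" "(\<lambda>z. bump 3 1 ((1 / h k) *\<^sub>R (z - x))) \<in> borel_measurable lebesgue" for i
      by (rule measurable_completion, measurable)+
    show ?thesis unfolding K_def
      by (intro borel_measurable_add borel_measurable_sum borel_measurable_times m tr_measurable continuous_on_pairing[OF V] d)
  qed
  have "AE z in lebesgue. K z = indicator \<Omega> z * H z"
    using A(3)
  proof eventually_elim
    case (elim z)
    \<comment> \<open>A controls the integrand only inside the large ball; outside it both kernels
      vanish.\<close>
    show ?case
    proof (cases "z \<in> ball x0 R")
      case True
      then show ?thesis using elim \<Omega>(1) by (auto simp: K_def H tr_def)
    next
      case False
      then have "z \<notin> cball x (h k)" using k by blast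
      then have "norm (z - x) > h k" by (simp add: dist_norm norm_minus_commute)
      moreover have "norm ((1 / h k) *\<^sub>R (z - x)) = norm (z - x) / h k" using hk by simp
      ultimately have "(1 / h k) *\<^sub>R (z - x) \<notin> ball 0 1" using hk by (simp only: mem_ball_0) simp
      then have "kap i ((1 / h k) *\<^sub>R (z - x)) = 0" "bump 3 1 ((1 / h k) *\<^sub>R (z - x)) = 0" for i
        using kap_bound[of i "(1 / h k) *\<^sub>R (z - x)"] bump3_bound[of "(1 / h k) *\<^sub>R (z - x)"] by auto
      then show ?thesis by (simp add: K_def H)
    qed
  qed
  from integral_cong_AE_lebesgue[OF Km this] 0 have "(\<integral>z. K z \<partial>lebesgue) = 0" by simp
  \<comment> \<open>The change of variables has a positive factor, so the rescaled integral vanishes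
    as well.\<close>
  then have e0: "(\<integral>y. K (x + h k *\<^sub>R y) \<partial>lebesgue) = 0"
    using integral_affine_lebesgue[OF hk0 Km, of x] hk by simp
  have e1: "K (x + h k *\<^sub>R y) = (\<Sum>i\<in>UNIV. (1 / h k) * (kap i y * tr (pairing V i) (x + h k *\<^sub>R y))) + bump 3 1 y * tr (drift V) (x + h k *\<^sub>R y)" for y
    using hk by (simp add: K_def)
  have e2: "(\<integral>y. (\<Sum>i\<in>UNIV. (1 / h k) * (kap i y * tr (pairing V i) (x + h k *\<^sub>R y))) + bump 3 1 y * tr (drift V) (x + h k *\<^sub>R y) \<partial>lebesgue)
    = (\<Sum>i\<in>UNIV. (1 / h k) * (\<integral>y. kap i y * tr (pairing V i) (x + h k *\<^sub>R y) \<partial>lebesgue)) + (\<integral>y. bump 3 1 y * tr (drift V) (x + h k *\<^sub>R y) \<partial>lebesgue)"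
  proof -
    have ii: "integrable lebesgue (\<lambda>y. (1 / h k) * (kap i y * tr (pairing V i) (x + h k *\<^sub>R y)))" for i
      by (intro integrable_mult_right integral_kap_shift(1)[OF hk0 i1])
    have "(\<integral>y. (\<Sum>i\<in>UNIV. (1 / h k) * (kap i y * tr (pairing V i) (x + h k *\<^sub>R y))) + bump 3 1 y * tr (drift V) (x + h k *\<^sub>R y) \<partial>lebesgue)
      = (\<integral>y. (\<Sum>i\<in>UNIV. (1 / h k) * (kap i y * tr (pairing V i) (x + h k *\<^sub>R y))) \<partial>lebesgue) + (\<integral>y. bump 3 1 y * tr (drift V) (x + h k *\<^sub>R y) \<partial>lebesgue)"
      by (rule Bochner_Integration.integral_add[OF Bochner_Integration.integrable_sum[OF ii] i2])
    also have "(\<integral>y. (\<Sum>i\<in>UNIV. (1 / h k) * (kap i y * tr (pairing V i) (x + h k *\<^sub>R y))) \<partial>lebesgue)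
      = (\<Sum>i\<in>UNIV. (\<integral>y. (1 / h k) * (kap i y * tr (pairing V i) (x + h k *\<^sub>R y)) \<partial>lebesgue))"
      by (rule Bochner_Integration.integral_sum[OF ii])
    finally show ?thesis by (simp only: integral_mult_right_zero)
  qed
  have e3: "(1 / h k) * (\<integral>y. kap i y * tr (pairing V i) (x + h k *\<^sub>R y) \<partial>lebesgue)
    = (\<integral>y. kap i y * ((tr (pairing V i) (x + h k *\<^sub>R y) - tr (pairing V i) x) / h k) \<partial>lebesgue)" for i
    unfolding integral_kap_shift(2)[OF hk0 i1] using hk by simp
  show ?thesis using e0 unfolding e1 e2 e3 by linarith
qed

text \<open>The test field is a cutoff times e. Its derivative vanishes on the whole jet at x: at a
  because the cutoff has its maximum there, at the other points because they lie where the cutoff is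
  flat zero or on the edge of its support. So the drift vanishes at x and tends to 0 in the mean,
  while the flux quotients tend to the trace on one sheet.\<close>

lemma second_jet_trace_free:
  assumes x: "good x" and J: "is_approx_jet (j1 v) x J" and P0: "P0 \<in># J"
    and st: "outer_stationary \<Omega> v" and \<Omega>: "ball x0 R \<subseteq> \<Omega>" "\<Omega> \<in> sets lebesgue"
  shows "(\<Sum>i\<in>UNIV. snd (snd P0 $ i) $ i) = 0"
proof (rule vector_eq_ldot[THEN iffD1, rule_format])
  fix e :: "real^'k"
  have xr: "x \<in> ball x0 r" and xA: "x \<in> A" using x by (auto simp: good_def)
  obtain \<rho> where \<rho>: "\<rho> > 0" "\<And>P. P \<in># J \<Longrightarrow> fst (fst P) \<noteq> fst (fst P0) \<Longrightarrow> norm (fst (fst P) - fst (fst P0)) \<ge> \<rho>"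
    "\<And>P. P \<in># J \<Longrightarrow> fst (fst P) = fst (fst P0) \<Longrightarrow> snd P = snd P0"
    "size (filter_mset (\<lambda>P. fst (fst P) = fst (fst P0)) J) > 0"
    using isolated_sheet[OF x J P0] by blast
  define a where "a = fst (fst P0)"
  define V where "V = (\<lambda>y. bump 3 (\<rho>\<^sup>2) (y - a) *\<^sub>R e)"
  \<comment> \<open>The derivative of V in direction b is \<open>- 6 * (Y y \<bullet> b)\<close>
    times e; Y is bounded, Lipschitz and zero at all points of the jet.\<close>
  define Y where "Y = (\<lambda>y. bump 2 (\<rho>\<^sup>2) (y - a) *\<^sub>R (y - a))"
  have \<rho>0: "\<rho> \<ge> 0" using \<rho>(1) by simp
  have VC: "C1_c UNIV V" and Vd: "\<And>y. frechet_derivative V (at y) = frechet_derivative (\<lambda>z. bump 3 (\<rho>\<^sup>2) z *\<^sub>R e) (at (y - a))"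
    unfolding V_def by (rule translate_origin[OF C1_c_bump_times(1)[OF \<rho>0]])+
  have Vd': "frechet_derivative V (at y) b = (- 6 * (Y y \<bullet> b)) *\<^sub>R e" for y b
    by (simp add: Vd C1_c_bump_times(2)[OF \<rho>0] Y_def)
  have YC: "C1_c UNIV Y" unfolding Y_def by (rule translate_origin(1)[OF C1_c_bump_times_ident[OF \<rho>0]])
  have dr: "drift V p = (\<Sum>i\<in>UNIV. - 6 * (Y (fst p) \<bullet> (snd p $ i)) * ((snd p $ i) \<bullet> e))" for p :: "(real^'k) \<times> ((real^'k)^'n)"
    by (simp add: drift_def Vd')
  have drc: "continuous_on UNIV (drift V :: (real^'k) \<times> ((real^'k)^'n) \<Rightarrow> real)"
    unfolding dr[abs_def]
    by (intro continuous_intros continuous_on_compose2[OF C1_c_continuous[OF YC, of UNIV]]) auto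
  have J1: "j1 v x = image_mset fst J" using J[unfolded is_approx_jet_def, THEN conjunct1] .
  have YJ: "Y (fst (fst P)) = 0" if "P \<in># J" for P
    using \<rho>(2)[OF that] bump_eq_0[OF _ \<rho>0, of "fst (fst P) - a" 2] by (cases "fst (fst P) = a") (auto simp: Y_def a_def)
  have Yx: "Y (fst p) = 0" if "p \<in># j1 v x" for p using that YJ by (auto simp: J1)
  have drx: "drift V p = 0" if "p \<in># j1 v x" for p using Yx[OF that] by (simp add: dr)
  obtain K where K: "K \<ge> 0" "\<And>y. norm (Y y) \<le> K" "\<And>y z. norm (Y y - Y z) \<le> K * norm (y - z)"
    using C1_c_bounds[OF YC] by metis
  have "\<exists>C\<ge>0. \<forall>p\<in>#j1 v x. \<forall>q. \<bar>drift V q - drift V p\<bar> \<le> C * (norm (q - p) + (norm (q - p))\<^sup>2)"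
  proof (rule uniform_growth_mset[where b = "\<lambda>s. s + s\<^sup>2"])
    fix p assume p: "p \<in># j1 v x"
    \<comment> \<open>The 12 is 6 from the derivative of the cutoff times 2 from
      \<open>(a + b)^2 \<le> 2 a^2 + 2 b^2\<close>.\<close>
    define C where "C = (\<Sum>i\<in>(UNIV::'n set). 12 * norm e * K * ((norm p)\<^sup>2 + 1))"
    have "\<bar>drift V q - drift V p\<bar> \<le> C * (norm (q - p) + (norm (q - p))\<^sup>2)" for q
    proof -
      define s where "s = norm (q - p)"
      have s: "s \<ge> 0" by (simp add: s_def)
      have Ys: "norm (Y (fst q)) \<le> K * s"
      proof -
        have "norm (Y (fst q)) \<le> K * norm (fst (q - p))" using K(3)[of "fst q" "fst p"] Yx[OF p] by simp
        also have "\<dots> \<le> K * s" unfolding s_def using K(1) norm_fst_snd_nth_le(1)[of "q - p"] by (intro mult_left_mono)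
        finally show ?thesis .
      qed
      have "\<bar>drift V q - drift V p\<bar> = \<bar>\<Sum>i\<in>UNIV. - 6 * (Y (fst q) \<bullet> (snd q $ i)) * ((snd q $ i) \<bullet> e)\<bar>" using drx[OF p] by (simp only: dr diff_0_right)
      also have "\<dots> \<le> (\<Sum>i\<in>UNIV. \<bar>- 6 * (Y (fst q) \<bullet> (snd q $ i)) * ((snd q $ i) \<bullet> e)\<bar>)" by (rule sum_abs)
      also have "\<dots> \<le> (\<Sum>i\<in>(UNIV::'n set). (12 * norm e * K * ((norm p)\<^sup>2 + 1)) * (s + s\<^sup>2))"
      proof (rule sum_mono)
        fix i :: 'n
        define m where "m = norm (snd q $ i)"
        have "m \<le> norm (snd p $ i) + norm (snd (q - p) $ i)"
          unfolding m_def using norm_triangle_ineq[of "snd p $ i" "snd (q - p) $ i"] by simp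
        also have "\<dots> \<le> norm p + s" unfolding s_def by (intro add_mono norm_fst_snd_nth_le)
        finally have "m\<^sup>2 \<le> (norm p + s)\<^sup>2" by (intro power_mono) (auto simp: m_def)
        also have "\<dots> \<le> 2 * (norm p)\<^sup>2 + 2 * s\<^sup>2"
          using zero_le_power2[of "norm p - s"] by (simp add: power2_sum power2_diff)
        finally have m2: "m\<^sup>2 \<le> 2 * (norm p)\<^sup>2 + 2 * s\<^sup>2" .
        have "\<bar>- 6 * (Y (fst q) \<bullet> (snd q $ i)) * ((snd q $ i) \<bullet> e)\<bar> = 6 * (\<bar>Y (fst q) \<bullet> (snd q $ i)\<bar> * \<bar>(snd q $ i) \<bullet> e\<bar>)" by (simp add: abs_mult)
        also have "\<dots> \<le> 6 * ((norm (Y (fst q)) * m) * (m * norm e))"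
          unfolding m_def by (intro mult_left_mono mult_mono Cauchy_Schwarz_ineq2) auto
        also have "\<dots> = 6 * norm e * (norm (Y (fst q)) * m\<^sup>2)" by (simp add: power2_eq_square)
        also have "\<dots> \<le> 6 * norm e * (norm (Y (fst q)) * (2 * (norm p)\<^sup>2 + 2 * s\<^sup>2))" using m2 by (intro mult_left_mono) auto
        \<comment> \<open>Y is bounded by \<open>K * s\<close> and by K: the first bound is used
          against the square of \<open>norm p\<close>, the second against the square of s. The first
          alone would give a cubic term, beyond the quadratic growth that
          \<open>quadratic_limit\<close> admits.\<close>
        also have "\<dots> \<le> 6 * norm e * ((K * s) * (2 * (norm p)\<^sup>2) + K * (2 * s\<^sup>2))"
          unfolding distrib_left[of "norm (Y (fst q))"] using Ys K(2) by (intro mult_left_mono add_mono mult_right_mono) auto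
        also have "\<dots> = 12 * norm e * K * ((norm p)\<^sup>2 * s + 1 * s\<^sup>2)" by (simp add: algebra_simps)
        also have "\<dots> \<le> 12 * norm e * K * (((norm p)\<^sup>2 + 1) * (s + s\<^sup>2))"
          using s K(1) by (intro mult_left_mono) (auto simp: algebra_simps)
        finally show "\<bar>- 6 * (Y (fst q) \<bullet> (snd q $ i)) * ((snd q $ i) \<bullet> e)\<bar> \<le> (12 * norm e * K * ((norm p)\<^sup>2 + 1)) * (s + s\<^sup>2)"
          by (simp only: mult.assoc)
      qed
      also have "\<dots> = C * (s + s\<^sup>2)" unfolding C_def by (rule sum_distrib_right[symmetric])
      finally show ?thesis by (simp add: s_def)
    qed
    moreover have "C \<ge> 0" unfolding C_def using K(1) by (intro sum_nonneg mult_nonneg_nonneg) auto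
    ultimately show "\<exists>C\<ge>0. \<forall>q. \<bar>drift V q - drift V p\<bar> \<le> C * (norm (q - p) + (norm (q - p))\<^sup>2)" by blast
  qed simp
  then obtain C where C: "C \<ge> 0" "\<And>p q. p \<in># j1 v x \<Longrightarrow> \<bar>drift V q - drift V p\<bar> \<le> C * (norm (q - p) + (norm (q - p))\<^sup>2)" by blast
  have Bnn: "real Q * C * (c + c\<^sup>2 * real N) \<ge> 0" using C(1) c by (intro mult_nonneg_nonneg add_nonneg_nonneg) auto
  have gr: "AE z in lebesgue. z \<in> ball x0 R \<longrightarrow>
    \<bar>tr (drift V) z\<bar> \<le> (real Q * C * (c + c\<^sup>2 * real N)) * (\<Sum>j\<in>{..<N}. \<bar>f j z - f j x\<bar> + (f j z - f j x)\<^sup>2)"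
    by (rule tr_quadratic_growth[OF xA C drx])
  note ql = quadratic_limit[OF x tr_measurable[OF drc] Bnn gr borel_measurable_bump[of 3 1] bump3_bound]
  define L where "L = (\<lambda>i j. (\<Sum>P\<in>#J. V (fst (fst P)) \<bullet> (snd (snd P $ i) $ j) + frechet_derivative V (at (fst (fst P))) (fst (snd P $ i)) \<bullet> (snd (fst P) $ j)))"
  define q where "q = (\<lambda>i k. \<integral>y. kap i y * ((tr (pairing V i) (x + h k *\<^sub>R y) - tr (pairing V i) x) / h k) \<partial>lebesgue)"
  have "(\<lambda>k. \<Sum>i\<in>UNIV. q i k) \<longlonglongrightarrow> (\<Sum>i\<in>UNIV. - bump_mass TYPE('n) * L i i)"
    unfolding q_def L_def by (intro tendsto_sum tr_pairing_limit(1)[OF x J VC])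
  moreover have "(\<lambda>k. \<Sum>i\<in>UNIV. q i k) \<longlonglongrightarrow> 0"
  proof (rule Lim_transform_eventually)
    show "(\<lambda>k. - (\<integral>y. bump 3 1 y * tr (drift V) (x + h k *\<^sub>R y) \<partial>lebesgue)) \<longlonglongrightarrow> 0"
      using tendsto_minus[OF ql(1)] by simp
    have "\<forall>\<^sub>F k in sequentially. \<forall>i\<in>(UNIV::'n set). integrable lebesgue (\<lambda>y. kap i y * ((tr (pairing V i) (x + h k *\<^sub>R y) - tr (pairing V i) x) / h k))"
      by (intro eventually_ball_finite ballI tr_pairing_limit(2)[OF x J VC]) auto
    then show "\<forall>\<^sub>F k in sequentially. - (\<integral>y. bump 3 1 y * tr (drift V) (x + h k *\<^sub>R y) \<partial>lebesgue) = (\<Sum>i\<in>UNIV. q i k)"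
      using ql(2) eventually_cball_subset[OF xr h]
    proof eventually_elim
      case (elim k)
      have k: "cball x (h k) \<subseteq> ball x0 R" using elim(3) r by (auto intro: order_trans)
      show ?case unfolding q_def
        by (rule outer_stationary_scaled[OF xr st \<Omega> VC k drc, symmetric]) (use elim in auto)
    qed
  qed
  ultimately have "(\<Sum>i\<in>UNIV. - bump_mass TYPE('n) * L i i) = 0" using LIMSEQ_unique by blast
  then have "bump_mass TYPE('n) * (\<Sum>i\<in>UNIV. L i i) = 0" by (simp add: sum_negf sum_distrib_left)
  then have L0: "(\<Sum>i\<in>UNIV. L i i) = 0" using bump_mass_pos[where 'n = 'n] by simp
  have V1: "V a = (\<rho>\<^sup>2) ^ 3 *\<^sub>R e" by (simp add: V_def bump_def)
  have V2: "V (fst (fst P)) = 0" if "P \<in># J" "fst (fst P) \<noteq> a" for P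
    using \<rho>(2)[OF that(1)] that(2) bump_eq_0[OF _ \<rho>0, of "fst (fst P) - a" 3] by (simp add: V_def a_def)
  have V3: "frechet_derivative V (at (fst (fst P))) b = 0" if "P \<in># J" for P b
    using YJ[OF that] by (simp add: Vd')
  have Lij: "L i j = (real (size (filter_mset (\<lambda>P. fst (fst P) = a) J)) * (\<rho>\<^sup>2) ^ 3) * (e \<bullet> (snd (snd P0 $ i) $ j))" for i j
    unfolding L_def by (rule sum_pairing_derivative[OF V1 V2 V3]) (use \<rho>(3) in \<open>auto simp: a_def\<close>)
  have s: "real (size (filter_mset (\<lambda>P. fst (fst P) = a) J)) > 0" using \<rho>(4) unfolding a_def of_nat_0_less_iff .
  have m: "real (size (filter_mset (\<lambda>P. fst (fst P) = a) J)) * (\<rho>\<^sup>2) ^ 3 > 0" by (rule mult_pos_pos[OF s]) (use \<rho>(1) in simp)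
  have z: "(real (size (filter_mset (\<lambda>P. fst (fst P) = a) J)) * (\<rho>\<^sup>2) ^ 3) * (\<Sum>i\<in>UNIV. e \<bullet> (snd (snd P0 $ i) $ i)) = 0"
    using L0 unfolding Lij by (simp only: sum_distrib_left)
  have "(\<Sum>i\<in>UNIV. e \<bullet> (snd (snd P0 $ i) $ i)) = 0"
    using mult_eq_0_iff[THEN iffD1, OF z] less_imp_neq[OF m] by (elim disjE) auto
  then show "e \<bullet> (\<Sum>i\<in>UNIV. snd (snd P0 $ i) $ i) = e \<bullet> 0" by (simp add: inner_sum_right)
qed

end

section \<open>Assembling the local data, and passage from balls to the open set\<close>

lemma jet_scales_exists:
  fixes v :: "real^'n \<Rightarrow> (real^'k) multiset"
  assumes Q: "Q \<ge> 1" and W: "W12_Q Q (ball x0 R) (j1 v)" and r: "0 < r" "r < R"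
  shows "\<exists>N f G c A h E. jet_scales v Q x0 r R N f G c A h E"
proof (rule W12_Q_coordinates[OF W])
  fix N f G c A
  assume c: "c \<ge> (0::real)"
    and f: "\<And>j. j < N \<Longrightarrow> integrable lborel (f j)" "\<And>j. j < N \<Longrightarrow> integrable lborel (\<lambda>x. (f j x)\<^sup>2)"
    and G: "\<And>j. j < N \<Longrightarrow> integrable lborel (G j)" "\<And>j. j < N \<Longrightarrow> weak_gradient (ball x0 R) (f j) (G j)"
    and A: "A \<in> sets lebesgue" "A \<subseteq> ball x0 R" "AE z in lebesgue. z \<in> ball x0 R \<longrightarrow> z \<in> A"
    and size: "\<And>z. z \<in> A \<Longrightarrow> size (j1 v z) = Q"
    and Gd: "\<And>z z'. z \<in> A \<Longrightarrow> z' \<in> A \<Longrightarrow> Gdist (j1 v z') (j1 v z) \<le> c * (\<Sum>j\<in>{..<N::nat}. \<bar>f j z' - f j z\<bar>)"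
  have jet: "is_approx_jet v z (j1 v z)" if "z \<in> A" for z
  proof -
    \<comment> \<open>The default value of \<open>j1\<close> is empty, whereas the size on A is
      \<open>Q \<ge> 1\<close>; so an approximate jet exists at every point of A.\<close>
    have "j1 v z \<noteq> {#}" using size[OF that] Q by auto
    then have "\<exists>J. is_approx_jet v z J" unfolding j1_def by metis
    then show ?thesis unfolding j1_def by (simp add: someI_ex)
  qed
  show ?thesis
  proof (rule taylor_sequence[OF finite_lessThan r])
    fix h E
    assume h: "\<And>k. 0 < h k" "h \<longlonglongrightarrow> (0::real)" and E: "E \<in> borel_measurable borel"
      "(\<integral>\<^sup>+x. E x * indicator (ball x0 r) x \<partial>lborel) < \<infinity>"
      "\<And>i k x. i \<in> {..<N} \<Longrightarrow> taylor_err (h k) (f i) (G i) x \<le> E x"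
      and lim: "AE x in lborel. x \<in> ball x0 r \<longrightarrow> (\<forall>i\<in>{..<N}. (\<lambda>k. taylor_err (h k) (f i) (G i) x) \<longlonglongrightarrow> 0
        \<and> (\<lambda>k. osc (h k) (\<lambda>x. (f i x)\<^sup>2) x) \<longlonglongrightarrow> 0)"
    have "jet_scales v Q x0 r R N f G c A h E"
      by (unfold_locales; fact r c f(1) G(1) A size jet Gd h E AE_completion[OF lim])
    then show ?thesis by blast
  qed (use f G in auto)
qed

text \<open>A member rules out the empty default value of \<open>j1\<close>, so \<open>j1 v\<close>
  does have an approximate jet at x.\<close>

lemma j2_memberE:
  assumes "(a, B, S) \<in># j2 v x"
  obtains P where "is_approx_jet (j1 v) x (j1 (j1 v) x)" "P \<in># j1 (j1 v) x" "\<And>i. S $ i = snd (snd P $ i)"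
proof -
  obtain P where P: "P \<in># j1 (j1 v) x" "(a, B, S) = (case P of ((a, A), C) \<Rightarrow> (a, A, \<chi> i. snd (C $ i)))"
    using assms unfolding j2_def by auto
  have "\<exists>J. is_approx_jet (j1 v) x J"
  proof (rule ccontr)
    assume "\<not> ?thesis"
    then have "j1 (j1 v) x = {#}" unfolding j1_def[of "j1 v"] by (rule if_not_P)
    then show False using P(1) by simp
  qed
  then have "is_approx_jet (j1 v) x (j1 (j1 v) x)" unfolding j1_def[of "j1 v"] by (simp add: someI_ex)
  moreover have "S $ i = snd (snd P $ i)" for i using P(2) by (cases P) auto
  ultimately show ?thesis using that P(1) by blast
qed

text \<open>By Lindelof countably many half balls cover the open set; the full ball inside \<Omega>
  leaves room around the half ball for the shifts.\<close>

lemma AE_local_balls: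
  fixes \<Omega> :: "'a::euclidean_space set"
  assumes "open \<Omega>" and P: "\<And>x R. R > 0 \<Longrightarrow> cball x R \<subseteq> \<Omega> \<Longrightarrow> AE z in lebesgue. z \<in> ball x (R / 2) \<longrightarrow> P z"
  shows "AE z in lebesgue_on \<Omega>. P z"
proof -
  have "\<forall>x\<in>\<Omega>. \<exists>R>0. cball x R \<subseteq> \<Omega>" using assms(1) open_contains_cball by blast
  then obtain R where R: "\<And>x. x \<in> \<Omega> \<Longrightarrow> R x > 0" "\<And>x. x \<in> \<Omega> \<Longrightarrow> cball x (R x) \<subseteq> \<Omega>" by metis
  define F where "F = (\<lambda>x. ball x (R x / 2)) ` \<Omega>"
  obtain F' where F': "F' \<subseteq> F" "countable F'" "\<Union>F' = \<Union>F" using Lindelof[of F] by (auto simp: F_def)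
  have "AE z in lebesgue. \<forall>B\<in>F'. z \<in> B \<longrightarrow> P z"
  proof (rule AE_ball_countable[THEN iffD2, OF F'(2)], rule ballI)
    fix B assume "B \<in> F'"
    then obtain x where "x \<in> \<Omega>" "B = ball x (R x / 2)" using F'(1) by (auto simp: F_def)
    then show "AE z in lebesgue. z \<in> B \<longrightarrow> P z" using P R by simp
  qed
  moreover have "\<Omega> \<subseteq> \<Union>F'" unfolding F'(3) F_def using R(1) by force
  ultimately have "AE z in lebesgue. z \<in> \<Omega> \<longrightarrow> P z" by (auto elim!: eventually_mono)
  then show ?thesis using assms(1) by (simp add: AE_restrict_space_iff)
qed

theorem lemma3p10:
  fixes \<Omega> :: "(real^'n) set" and v :: "real^'n \<Rightarrow> (real^'k) multiset" and Q :: nat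
  assumes "CARD('n) \<ge> 2" and "Q \<ge> 1" and "open \<Omega>"
    and "\<And>x. x \<in> \<Omega> \<Longrightarrow> size (v x) = Q"
    and "W22_Q_loc Q \<Omega> v"
  shows "(AE x in lebesgue_on \<Omega>. \<forall>(a, A, S)\<in>#j2 v x. \<forall>i j. S $ i $ j = S $ j $ i) \<and>
    (outer_stationary \<Omega> v \<longrightarrow>
      (AE x in lebesgue_on \<Omega>. \<forall>(a, A, S)\<in>#j2 v x.
         (\<forall>i j. S $ i $ j = S $ j $ i) \<and> (\<Sum>i\<in>UNIV. S $ i $ i) = 0))"
proof -
  have "AE z in lebesgue. z \<in> ball x (R / 2) \<longrightarrow> (\<forall>(a, A, S)\<in>#j2 v z.
      (\<forall>i j. S $ i $ j = S $ j $ i) \<and> (outer_stationary \<Omega> v \<longrightarrow> (\<Sum>i\<in>UNIV. S $ i $ i) = 0))"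
    if R: "R > 0" "cball x R \<subseteq> \<Omega>" for x R
  proof -
    \<comment> \<open>The closed ball is compact and contained in \<Omega>, so the local hypothesis
      applies to the open ball.\<close>
    have "W12_Q Q (ball x R) (j1 v)"
      using assms(5) R unfolding W22_Q_loc_def W22_Q_def by simp
    then obtain N f G c A h E where "jet_scales v Q x (R / 2) R N f G c A h E"
      using jet_scales_exists[OF assms(2), of x R v "R / 2"] R(1) by auto
    then interpret jet_scales v Q x "R / 2" R N f G c A h E .
    have \<Omega>: "ball x R \<subseteq> \<Omega>" "\<Omega> \<in> sets lebesgue" using R(2) assms(3) by auto
    \<comment> \<open>The null set is fixed here, before a member of the second jet is taken; the
      test functions depend on that member.\<close>
    show ?thesis
      using AE_good
    proof eventually_elim
      case (elim z)
      show ?case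
      proof (intro impI ballI, clarify)
        fix a B S assume z: "z \<in> ball x (R / 2)" and m: "(a, B, S) \<in># j2 v z"
        then have g: "good z" using elim by blast
        obtain P where P: "is_approx_jet (j1 v) z (j1 (j1 v) z)" "P \<in># j1 (j1 v) z" "\<And>i. S $ i = snd (snd P $ i)"
          using j2_memberE[OF m] by blast
        show "(\<forall>i j. S $ i $ j = S $ j $ i) \<and> (outer_stationary \<Omega> v \<longrightarrow> (\<Sum>i\<in>UNIV. S $ i $ i) = 0)"
          unfolding P(3) using second_jet_symmetric[OF g P(1,2)] second_jet_trace_free[OF g P(1,2) _ \<Omega>] by blast
      qed
    qed
  qed
  from AE_local_balls[OF assms(3) this]
  have ae: "AE z in lebesgue_on \<Omega>. \<forall>(a, A, S)\<in>#j2 v z.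
      (\<forall>i j. S $ i $ j = S $ j $ i) \<and> (outer_stationary \<Omega> v \<longrightarrow> (\<Sum>i\<in>UNIV. S $ i $ i) = 0)" .
  show ?thesis
  proof (intro conjI impI)
    show "AE x in lebesgue_on \<Omega>. \<forall>(a, A, S)\<in>#j2 v x. \<forall>i j. S $ i $ j = S $ j $ i"
      using ae by eventually_elim fast
    assume "outer_stationary \<Omega> v"
    then show "AE x in lebesgue_on \<Omega>. \<forall>(a, A, S)\<in>#j2 v x. (\<forall>i j. S $ i $ j = S $ j $ i) \<and> (\<Sum>i\<in>UNIV. S $ i $ i) = 0"
      using ae by simp
  qed
qed

end
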